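(* Let $n$ be a positive integer, let $\omega\in\mathbb{C}$ be a constant, let $c,\lambda_{1},\lambda_{2},p_{1},p_{2}\in\mathbb{C}\setminus\{0\}$ be non-zero constants with $\lambda_{1}\neq\lambda_{2}$, and let $q,Q$ be polynomials in $z$ with complex coefficients such that $Q$ is not constant and $q\not\equiv0$. Suppose that $f$ is a transcendental entire function of finite order satisfying $$f^{n}(z)+\omega f^{n-1}(z)f'(z)+q(z)e^{Q(z)}f(z+c)=p_{1}e^{\lambda_{1}z}+p_{2}e^{\lambda_{2}z}\qquad(z\in\mathbb{C}).$$ Then the following conclusions hold. (1) If $n\geq 4$ in the case $\omega\neq0$, and $n\geq3$ in the case $\omega=0$, then $\sigma(f)=\deg Q=1$. (2) If $n\geq1$ and $\lambda(f)<\sigma(f)$, then either $$f(z)=\left(\frac{p_{2}n}{n+\omega\lambda_{2}}\right)^{\frac1n}e^{\frac{\lambda_{2}z}{n}},\qquad Q(z)=\left(\lambda_{1}-\frac{\lambda_{2}}{n}\right)z+b_{1},$$ or $$f(z)=\left(\frac{p_{1}n}{n+\omega\lambda_{1}}\right)^{\frac1n}e^{\frac{\lambda_{1}z}{n}},\qquad Q(z)=\left(\lambda_{2}-\frac{\lambda_{1}}{n}\right)z+b_{2},$$ where $b_{1},b_{2}\in\mathbb{C}$ satisfy, respectively, $$p_{1}=q\left(\frac{p_{2}n}{n+\omega\lambda_{2}}\right)^{\frac1n}e^{\frac{\lambda_{2}c}{n}+b_{1}}\quad\text{and}\quad p_{2}=q\left(\frac{p_{1}n}{n+\omega\lambda_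{1}}\right)^{\frac1n}e^{\frac{\lambda_{1}c}{n}+b_{2}}.$$
   Context: For an entire function $f$, with Nevanlinna characteristic $T(r,f)$, $\sigma(f)=\limsup_{r\to\infty}\frac{\log^{+} T(r,f)}{\log r}$ denotes the order of growth of $f$, and $\lambda(f)=\limsup_{r\to\infty}\frac{\log^{+} N(r,1/f)}{\log r}$ denotes the exponent of convergence of the zeros of $f$, where $N(r,1/f)$ is the (integrated) Nevanlinna counting function of the zeros of $f$ with multiplicity (the constants $\lambda_1,\lambda_2$ are unrelated to $\lambda(f)$). In part (2), $(\cdot)^{1/n}$ denotes some (suitable) $n$-th root, the same root being used in the formula for $f$ and in the corresponding relation for $b_{1}$ (resp. $b_{2}$). The asserted relations for $p_1$ (resp. $p_2$) are identities in $z$, with $q=q(z)$; part of the assertion in each alternative is that the denominator $n+\omega\lambda_{2}$ (resp. $n+\omega\lambda_{1}$) is non-zero. *)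

theory Defs
  imports "HOL-Complex_Analysis.Complex_Analysis"
begin

definition transcendental_entire :: "(complex \<Rightarrow> complex) \<Rightarrow> bool" where
  "transcendental_entire f \<longleftrightarrow>
     f holomorphic_on UNIV \<and> \<not> (\<exists>p :: complex poly. \<forall>z. f z = poly p z)"

definition log_plus :: "real \<Rightarrow> real" where
  "log_plus x = ln (max 1 x)"

(* n(r,g): number of poles of g in the closed disc of radius r, with multiplicity.
   The values of g at its poles play no role, so n(r,1/f) can be formed with HOL's
   total division. *)
definition pole_count :: "real \<Rightarrow> (complex \<Rightarrow> complex) \<Rightarrow> nat" where
  "pole_count r g = (\<Sum>z\<in>{z. norm z \<le> r \<and> is_pole g z}. nat (- zorder g z))"

definition nevanlinna_N :: "real \<Rightarrow> (complex \<Rightarrow> complex) \<Rightarrow> real" where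
  "nevanlinna_N r g =
     integral {0..r} (\<lambda>t. (real (pole_count t g) - real (pole_count 0 g)) / t)
     + real (pole_count 0 g) * ln r"

definition nevanlinna_m :: "real \<Rightarrow> (complex \<Rightarrow> complex) \<Rightarrow> real" where
  "nevanlinna_m r g =
     1 / (2 * pi) * integral {0..2 * pi} (\<lambda>\<theta>. log_plus (norm (g (of_real r * cis \<theta>))))"

definition nevanlinna_T :: "real \<Rightarrow> (complex \<Rightarrow> complex) \<Rightarrow> real" where
  "nevanlinna_T r g = nevanlinna_m r g + nevanlinna_N r g"

definition growth_order :: "(complex \<Rightarrow> complex) \<Rightarrow> ereal" where
  "growth_order f = Limsup at_top (\<lambda>r::real. ereal (log_plus (nevanlinna_T r f) / ln r))"

definition zero_exponent :: "(complex \<Rightarrow> complex) \<Rightarrow> ereal" where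
  "zero_exponent f =
     Limsup at_top (\<lambda>r::real. ereal (log_plus (nevanlinna_N r (\<lambda>z. 1 / f z)) / ln r))"

end

theory Submission
  imports Defs "HOL-Real_Asymp.Real_Asymp" "HOL-Computational_Algebra.Fundamental_Theorem_Algebra"
begin

text \<open>
  Two devices replace most of Nevanlinna theory. First, a continuous function on a circle is uniformly
  approximated by real parts of polynomials, so the maximum principle turns any continuous bound
  \<open>\<bar>f\<bar> \<le> exp \<phi>\<close> on the circle into \<open>\<bar>f 0\<bar> \<le> exp (mean of \<phi>)\<close>; this one-sided Jensen inequality
  needs no discussion of zeros. Secondly, such harmonic majorants obey Harnack's inequality, so at
  radii where \<open>T(r)\<close> hardly increases, the values of \<open>f\<close> on a disc of fixed size are controlled by the
  majorant at its centre up to a factor close to 1; this takes the place of the lemmas on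
  logarithmic derivatives and difference quotients.

  Part (1): write \<open>F\<close> for \<open>f\<^sup>n + \<omega> f\<^sup>n\<^sup>-\<^sup>1 f'\<close>, \<open>P\<close> for the right-hand side and \<open>g(z) = f(z + c)\<close>. Eliminating
  \<open>e\<^sup>Q\<close> by differentiation gives \<open>q g F' - F L = q g P' - P L\<close> with \<open>L = (q' + q Q') g + q g'\<close>. The left
  side is divisible by a power \<open>f\<^sup>m\<close> with \<open>m \<ge> 2\<close>, and the quotient is so small on circles that it vanishes if
  the order exceeds 1. Then \<open>q e\<^sup>Q g = k P\<close>, so \<open>f\<close> has a zero, which would be a multiple
  zero of \<open>P\<close>, unless \<open>f + \<omega> f' = 0\<close>. That the order and \<open>deg Q\<close> equal 1 then follows from Borel's theorem on sums
  of exponentials.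

  Part (2): Hadamard's factorization \<open>f = B e\<^sup>H\<close> with \<open>B\<close> of smaller growth than \<open>e\<^sup>H\<close> turns the
  equation into an exponential sum to which Borel's theorem applies.
\<close>

section \<open>Circle means and the maximum principle\<close>


text \<open>The thresholds on \<open>n\<close> come from the power of \<open>f\<close> that divides
  both \<open>F\<close> and its derivative: \<open>f^(n-1)\<close> if \<open>\<omega> = 0\<close>,
  \<open>f^(n-2)\<close> otherwise. So \<open>m >= 2\<close> means \<open>n >= 3\<close>,
  respectively \<open>n >= 4\<close>. With u the positive part of ln |f|, the quotient has logarithm
  at most about 3u, since it is quadratic in \<open>f\<close> and its derivatives times one shifted
  factor. After multiplication by \<open>f^m\<close> only the shifted factor remains, which gives u
  - mu where \<open>f\<close> is large. This is negative for m = 2, while m = 1 would give no decay.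
  All errors are O(r), caused by \<open>q\<close> and \<open>P\<close>, so T(r) has to beat every
  multiple of r: this is where order greater than 1 enters. The order is a limit superior, so T is
  known to be large only at some radii, and a radius of slow increase must be found beyond one of
  them without losing the size of T. In part (2) the right-hand side \<open>P\<close> plays two
  roles. If the exponent \<open>H\<close> had degree at least 2, all of \<open>P\<close> would be a
  coefficient of small growth. Once the degree is 1, the coefficients have order below 1, and
  \<open>P\<close> counts as two separate exponentials.\<close>

definition circle_mean :: "real \<Rightarrow> (complex \<Rightarrow> real) \<Rightarrow> real" where
  "circle_mean r \<phi> = 1 / (2 * pi) * integral {0..2 * pi} (\<lambda>t. \<phi> (of_real r * cis t))"

lemma circle_mean_integrable:
  fixes \<phi> :: "complex \<Rightarrow> real"
  assumes "continuous_on (sphere 0 r) \<phi>" "r \<ge> 0"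
  shows "(\<lambda>t. \<phi> (of_real r * cis t)) integrable_on {0..2 * pi}"
proof (rule integrable_continuous_interval)
  show "continuous_on {0..2*pi} (\<lambda>t. \<phi> (of_real r * cis t))"
    by (rule continuous_on_compose2[OF assms(1)]) 
       (use assms(2) in \<open>auto intro!: continuous_intros simp: norm_mult\<close>)
qed

lemma circle_mean_mono:
  assumes "continuous_on (sphere 0 r) \<phi>" "continuous_on (sphere 0 r) \<psi>" "r \<ge> 0"
    and "\<And>z. norm z = r \<Longrightarrow> \<phi> z \<le> \<psi> z"
  shows "circle_mean r \<phi> \<le> circle_mean r \<psi>"
  unfolding circle_mean_def
  by (intro mult_left_mono integral_le circle_mean_integrable assms)
     (use assms(3) in \<open>auto simp: norm_mult\<close>)

lemma circle_mean_add:
  assumes "continuous_on (sphere 0 r) \<phi>" "continuous_on (sphere 0 r) \<psi>" "r \<ge> 0"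
  shows "circle_mean r (\<lambda>z. \<phi> z + \<psi> z) = circle_mean r \<phi> + circle_mean r \<psi>"
  unfolding circle_mean_def
  by (subst integral_add) (use assms circle_mean_integrable in \<open>auto simp: algebra_simps\<close>)

lemma circle_mean_cmult: "circle_mean r (\<lambda>z. c * \<phi> z) = c * circle_mean r \<phi>"
  by (simp add: circle_mean_def)

lemma circle_mean_diff:
  assumes "continuous_on (sphere 0 r) \<phi>" "continuous_on (sphere 0 r) \<psi>" "r \<ge> 0"
  shows "circle_mean r (\<lambda>z. \<phi> z - \<psi> z) = circle_mean r \<phi> - circle_mean r \<psi>"
  unfolding circle_mean_def
  by (subst integral_diff) (use assms circle_mean_integrable in \<open>auto simp: algebra_simps\<close>)

lemma circle_mean_const [simp]: "circle_mean r (\<lambda>z. c) = c"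
  by (simp add: circle_mean_def)

lemma circle_mean_nonneg:
  assumes "continuous_on (sphere 0 r) \<phi>" "r \<ge> 0" "\<And>z. norm z = r \<Longrightarrow> \<phi> z \<ge> 0"
  shows "circle_mean r \<phi> \<ge> 0"
  using circle_mean_mono[of r "\<lambda>_. 0" \<phi>] assms by simp

lemma integral_cis_multiple:
  assumes "k > 0"
  shows "((\<lambda>t. cis (real k * t)) has_integral 0) {0..2 * pi}"
proof -
  have "((\<lambda>t. cis (real k * t)) has_integral
          (cis (real k * (2 * pi)) / (\<i> * of_nat k) - cis (real k * 0) / (\<i> * of_nat k))) {0..2 * pi}"
  proof (rule fundamental_theorem_of_calculus)
    fix t :: real
    have "((\<lambda>z. exp (\<i> * of_nat k * z) / (\<i> * of_nat k)) has_field_derivative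
            exp (\<i> * of_nat k * of_real t)) (at (of_real t))"
      using assms by (auto intro!: derivative_eq_intros)
    from has_vector_derivative_real_field[OF this]
    show "((\<lambda>t. cis (real k * t) / (\<i> * of_nat k)) has_vector_derivative cis (real k * t))
            (at t within {0..2 * pi})"
      by (simp add: cis_conv_exp mult.assoc)
  qed simp
  moreover have "cis (real k * (2 * pi)) = 1"
    using cis_multiple_2pi[of "real k"] by (simp add: mult_ac)
  ultimately show ?thesis by simp
qed

lemma integral_poly_circle:
  "((\<lambda>t. poly p (of_real r * cis t)) has_integral (2 * pi * poly p 0)) {0..2 * pi}"
proof -
  have "((\<lambda>t. \<Sum>i\<le>degree p. coeff p i * (of_real r * cis t) ^ i) has_integral
          (\<Sum>i\<le>degree p. if i = 0 then 2 * pi * coeff p 0 else 0)) {0..2 * pi}"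
  proof (intro has_integral_sum)
    fix i
    show "((\<lambda>t. coeff p i * (of_real r * cis t) ^ i) has_integral
            (if i = 0 then of_real (2 * pi) * coeff p 0 else 0)) {0..2 * pi}"
    proof (cases "i = 0")
      case True
      then show ?thesis
        using has_integral_const_real[of "coeff p 0" 0 "2 * pi"] by (simp add: scaleR_conv_of_real)
    next
      case False
      have "((\<lambda>t. (coeff p i * of_real r ^ i) * cis (real i * t)) has_integral
              (coeff p i * of_real r ^ i) * 0) {0..2 * pi}"
        by (intro has_integral_mult_right integral_cis_multiple) (use False in simp)
      then show ?thesis using False
        by (simp add: power_mult_distrib Complex.DeMoivre mult_ac)
    qed
  qed simp
  then show ?thesis
    by (simp add: poly_altdef poly_0_coeff_0)
qed

lemma circle_mean_Re_poly: "circle_mean r (\<lambda>z. Re (poly p z)) = Re (poly p 0)"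
proof -
  have "((\<lambda>t. Re (poly p (of_real r * cis t))) has_integral Re (2 * pi * poly p 0)) {0..2 * pi}"
    using has_integral_linear[OF integral_poly_circle bounded_linear_Re, of p r] by (simp add: o_def)
  then show ?thesis
    by (simp add: circle_mean_def integral_unique)
qed

definition Re_poly_on_circle :: "real \<Rightarrow> (complex \<Rightarrow> real) \<Rightarrow> bool" where
  "Re_poly_on_circle r g \<longleftrightarrow> (\<exists>p. \<forall>z\<in>sphere 0 r. g z = Re (poly p z))"

lemma Re_poly_on_circle_add:
  assumes "Re_poly_on_circle r f" "Re_poly_on_circle r g"
  shows "Re_poly_on_circle r (\<lambda>z. f z + g z)"
proof -
  obtain p q where "\<forall>z\<in>sphere 0 r. f z = Re (poly p z)" "\<forall>z\<in>sphere 0 r. g z = Re (poly q z)"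
    using assms by (auto simp: Re_poly_on_circle_def)
  then show ?thesis
    by (auto simp: Re_poly_on_circle_def intro!: exI[of _ "p + q"])
qed

lemma Re_poly_on_circle_sum:
  assumes "\<And>i. i \<in> I \<Longrightarrow> Re_poly_on_circle r (f i)"
  shows "Re_poly_on_circle r (\<lambda>z. \<Sum>i\<in>I. f i z)"
  using assms
proof (induction I rule: infinite_finite_induct)
  case (insert x F)
  then show ?case by (simp add: Re_poly_on_circle_add)
qed (auto simp: Re_poly_on_circle_def intro!: exI[of _ 0])

text \<open>On the circle \<open>z * cnj z = r^2\<close>, so the smaller of the two powers cancels.
  What is left is a power of \<open>z\<close> or of \<open>cnj z\<close>, and in the latter case
  conjugation does not change the real part.\<close>

lemma Re_poly_on_circle_monom:
  "Re_poly_on_circle r (\<lambda>z. Re (a * z ^ j * cnj (z ^ k)))"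
proof (cases "k \<le> j")
  case True
  have "z ^ j * cnj (z ^ k) = of_real (r ^ (2 * k)) * z ^ (j - k)" if "z \<in> sphere 0 r" for z
  proof -
    have "z ^ j = z ^ k * z ^ (j - k)" using True by (simp flip: power_add)
    then have "z ^ j * cnj (z ^ k) = (z ^ k * cnj (z ^ k)) * z ^ (j - k)" by simp
    also have "z ^ k * cnj (z ^ k) = of_real (r ^ (2 * k))"
      unfolding complex_norm_square[symmetric] using that by (simp add: norm_power power_mult mult.commute[of 2])
    finally show ?thesis .
  qed
  then have "\<forall>z\<in>sphere 0 r. Re (a * z ^ j * cnj (z ^ k)) = Re (poly (monom (a * of_real (r ^ (2 * k))) (j - k)) z)"
    by (simp add: poly_monom mult.assoc del: complex_cnj_power)
  then show ?thesis unfolding Re_poly_on_circle_def by blast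
next
  case False
  have "a * z ^ j * cnj (z ^ k) = cnj (cnj a * of_real (r ^ (2 * j)) * z ^ (k - j))" if "z \<in> sphere 0 r" for z
  proof -
    have "z ^ k = z ^ j * z ^ (k - j)" using False by (simp flip: power_add)
    then have "z ^ j * cnj (z ^ k) = (z ^ j * cnj (z ^ j)) * cnj (z ^ (k - j))" by simp
    also have "z ^ j * cnj (z ^ j) = of_real (r ^ (2 * j))"
      unfolding complex_norm_square[symmetric] using that by (simp add: norm_power power_mult mult.commute[of 2])
    finally show ?thesis by (simp add: mult.assoc)
  qed
  then have "\<forall>z\<in>sphere 0 r. Re (a * z ^ j * cnj (z ^ k)) = Re (poly (monom (cnj a * of_real (r ^ (2 * j))) (k - j)) z)"
    by (metis poly_monom cnj.sel(1))
  then show ?thesis unfolding Re_poly_on_circle_def by blast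
qed

text \<open>Re p Re q = 1/2 Re (p q + p cnj q). The first product is a polynomial, and the real part
  of the second agrees on the circle with that of a polynomial by the monomial case.\<close>

lemma Re_poly_on_circle_mult:
  assumes "Re_poly_on_circle r f" "Re_poly_on_circle r g"
  shows "Re_poly_on_circle r (\<lambda>z. f z * g z)"
proof -
  obtain p q where p: "\<forall>z\<in>sphere 0 r. f z = Re (poly p z)" and q: "\<forall>z\<in>sphere 0 r. g z = Re (poly q z)"
    using assms by (auto simp: Re_poly_on_circle_def)
  have "Re_poly_on_circle r (\<lambda>z. \<Sum>i\<le>degree p. \<Sum>j\<le>degree q.
           Re ((coeff p i * cnj (coeff q j)) * z ^ i * cnj (z ^ j)))" (is "Re_poly_on_circle r ?S")
    by (intro Re_poly_on_circle_sum Re_poly_on_circle_monom)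
  then obtain s where s: "\<forall>z\<in>sphere 0 r. ?S z = Re (poly s z)"
    unfolding Re_poly_on_circle_def by blast
  have S: "?S z = Re (poly p z * cnj (poly q z))" for z
    unfolding poly_altdef cnj_sum sum_product Re_sum by (simp add: mult_ac)
  have "f z * g z = Re (poly (smult (1/2) (p * q + s)) z)" if "z \<in> sphere 0 r" for z
  proof -
    have "Re (poly s z) = Re (poly p z * cnj (poly q z))" using s S that by metis
    moreover have "poly (smult (1/2) (p * q + s)) z = (poly p z * poly q z + poly s z) / 2" by simp
    moreover have "f z = Re (poly p z)" "g z = Re (poly q z)" using p q that by auto
    ultimately show ?thesis by (simp add: Re_divide_numeral)
  qed
  then show ?thesis unfolding Re_poly_on_circle_def by blast
qed

text \<open>Stone-Weierstrass for the algebra of real parts of polynomials on the circle; Re z and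
  Im z = Re (-i z) already separate points.\<close>

lemma Re_poly_approx:
  assumes "continuous_on (sphere 0 r) \<phi>" "e > 0"
  obtains p where "\<And>z. norm z = r \<Longrightarrow> \<bar>\<phi> z - Re (poly p z)\<bar> < e"
proof -
  have "\<exists>g. (continuous_on (sphere 0 r) g \<and> Re_poly_on_circle r g) \<and> (\<forall>z\<in>sphere 0 r. \<bar>\<phi> z - g z\<bar> < e)"
  proof (rule Stone_Weierstrass_HOL)
    fix c :: real
    show "continuous_on (sphere 0 r) (\<lambda>_. c) \<and> Re_poly_on_circle r (\<lambda>_. c)"
      by (auto simp: Re_poly_on_circle_def intro!: exI[of _ "[:of_real c:]"])
  next
    fix x y :: complex assume "x \<in> sphere 0 r \<and> y \<in> sphere 0 r \<and> x \<noteq> y"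
    then have "Re x \<noteq> Re y \<or> Re (-\<i> * x) \<noteq> Re (-\<i> * y)" by (simp add: complex_eq_iff)
    moreover have "Re_poly_on_circle r (\<lambda>z. Re (c * z))" for c
      unfolding Re_poly_on_circle_def by (intro exI[of _ "[:0, c:]"]) (simp add: mult.commute)
    from this[of 1] this[of "-\<i>"] have "Re_poly_on_circle r Re" "Re_poly_on_circle r (\<lambda>z. Re (-\<i> * z))"
      by simp_all
    moreover have "continuous_on (sphere 0 r) Re" "continuous_on (sphere 0 r) (\<lambda>z. Re (-\<i> * z))"
      by (intro continuous_intros)+
    ultimately show "\<exists>f. (continuous_on (sphere 0 r) f \<and> Re_poly_on_circle r f) \<and> f x \<noteq> f y"
      by blast
  qed (use assms in \<open>auto intro!: continuous_intros Re_poly_on_circle_add Re_poly_on_circle_mult\<close>)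
  then show ?thesis
    using that unfolding Re_poly_on_circle_def by force
qed

text \<open>Approximating \<open>\<phi> + e/2\<close> to within \<open>e/2\<close> lands strictly
  above \<open>\<phi>\<close> and at most \<open>e\<close> above it. The mean value property then
  gives the value at 0.\<close>

lemma Re_poly_majorant:
  assumes "continuous_on (sphere 0 r) \<phi>" "e > 0" "r \<ge> 0"
  obtains p where "\<And>z. norm z = r \<Longrightarrow> \<phi> z < Re (poly p z)"
    and "Re (poly p 0) \<le> circle_mean r \<phi> + e"
proof -
  obtain p where p: "\<And>z. norm z = r \<Longrightarrow> \<bar>\<phi> z + e / 2 - Re (poly p z)\<bar> < e / 2"
    by (rule Re_poly_approx[of r "\<lambda>z. \<phi> z + e / 2" "e / 2"]) (use assms in \<open>auto intro!: continuous_intros\<close>)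
  have "circle_mean r (\<lambda>z. Re (poly p z)) \<le> circle_mean r (\<lambda>z. \<phi> z + e)"
  proof (intro circle_mean_mono continuous_intros)
    fix z :: complex assume "norm z = r"
    from p[OF this] show "Re (poly p z) \<le> \<phi> z + e" by linarith
  qed (use assms in auto)
  also have "\<dots> = circle_mean r \<phi> + e"
    using assms by (subst circle_mean_add) auto
  finally have "Re (poly p 0) \<le> circle_mean r \<phi> + e"
    by (simp add: circle_mean_Re_poly)
  moreover have "\<phi> z < Re (poly p z)" if "norm z = r" for z
    using p[OF that] by linarith
  ultimately show ?thesis by (rule that[rotated])
qed

text \<open>Division by the zero-free function exp p reduces this to the maximum principle with
  bound 1.\<close>

lemma maximum_modulus_Re_poly:
  assumes "f holomorphic_on UNIV" "\<And>z. norm z = r \<Longrightarrow> norm (f z) \<le> exp (Re (poly p z))"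
    and "norm w \<le> r" "r > 0"
  shows "norm (f w) \<le> exp (Re (poly p w))"
proof -
  have "norm (f w * exp (- poly p w)) \<le> 1"
  proof (rule maximum_modulus_frontier[where f = "\<lambda>w. f w * exp (- poly p w)" and S = "cball 0 r"])
    show "(\<lambda>w. f w * exp (- poly p w)) holomorphic_on interior (cball 0 r)"
      by (intro holomorphic_intros holomorphic_on_subset[OF assms(1)]) auto
    show "continuous_on (closure (cball 0 r)) (\<lambda>w. f w * exp (- poly p w))"
      by (intro continuous_intros holomorphic_on_imp_continuous_on holomorphic_on_subset[OF assms(1)]) auto
    fix z assume "z \<in> frontier (cball 0 r :: complex set)"
    then have "norm (f z) \<le> exp (Re (poly p z))" using assms(2,4) by auto
    then show "norm (f z * exp (- poly p z)) \<le> 1"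
      by (simp add: norm_mult exp_minus norm_divide divide_simps)
  qed (use assms in auto)
  then show ?thesis by (simp add: norm_mult exp_minus norm_divide divide_simps)
qed

lemma norm_at_0_le_circle_mean:
  assumes f: "f holomorphic_on UNIV" and "continuous_on (sphere 0 r) \<phi>" "r > 0"
    and "\<And>z. norm z = r \<Longrightarrow> norm (f z) \<le> exp (\<phi> z)"
  shows "norm (f 0) \<le> exp (circle_mean r \<phi>)"
proof (cases "f 0 = 0")
  case False
  have "ln (norm (f 0)) \<le> circle_mean r \<phi>"
  proof (rule field_le_epsilon)
    fix e :: real assume "e > 0"
    then obtain p where p: "\<And>z. norm z = r \<Longrightarrow> \<phi> z < Re (poly p z)"
      "Re (poly p 0) \<le> circle_mean r \<phi> + e"
      using Re_poly_majorant[OF assms(2) _ less_imp_le[OF assms(3)]] by metis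
    have "norm (f 0) \<le> exp (Re (poly p 0))"
    proof (rule maximum_modulus_Re_poly[OF f, of r])
      fix z :: complex assume z: "norm z = r"
      show "norm (f z) \<le> exp (Re (poly p z))"
        using assms(4)[OF z] p(1)[OF z] by (meson exp_le_cancel_iff less_imp_le order_trans)
    qed (use assms in auto)
    also have "\<dots> \<le> exp (circle_mean r \<phi> + e)" using p by simp
    finally show "ln (norm (f 0)) \<le> circle_mean r \<phi> + e"
      using False by (metis exp_le_cancel_iff exp_ln zero_less_norm_iff)
  qed
  then show ?thesis using False by (metis exp_le_cancel_iff exp_ln zero_less_norm_iff)
qed simp

section \<open>Growth of entire functions and Borel's theorem\<close>


text \<open>The Cayley transform (G - a) / (G + cnj a) with a = G(z0) sends the right half-plane to
  the unit disc and z0 to 0, so Schwarz's lemma applies. Since the whole modulus is bounded, the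
  estimate yields Harnack's inequality as well as Borel-Caratheodory.\<close>

lemma Re_nonneg_ball_bound:
  assumes holo: "G holomorphic_on ball z0 R" and nonneg: "\<And>w. w \<in> ball z0 R \<Longrightarrow> Re (G w) \<ge> 0"
    and d: "dist z0 w \<le> d" "d < R"
  shows "norm (G w - \<i> * Im (G z0)) \<le> (R + d) / (R - d) * Re (G z0)"
proof -
  have R: "R > 0" and d0: "d \<ge> 0" using d zero_le_dist[of z0 w] by linarith+
  \<comment> \<open>Schwarz's lemma wants values in the open disc, hence a strictly positive real
    part; the general case follows by adding a small constant.\<close>
  have strict: "norm (H w - \<i> * Im (H z0)) * (R - d) \<le> (R + d) * Re (H z0)"
    if holo: "H holomorphic_on ball z0 R" and pos: "\<And>w. w \<in> ball z0 R \<Longrightarrow> Re (H w) > 0" for H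
  proof -
    define g where "g = (\<lambda>\<zeta>. H (z0 + of_real R * \<zeta>))"
    have ball: "z0 + of_real R * \<zeta> \<in> ball z0 R" if "norm \<zeta> < 1" for \<zeta> :: complex
      using that R by (simp add: dist_norm norm_mult)
    have g_holo: "g holomorphic_on ball 0 1"
      unfolding g_def using ball
      by (intro holomorphic_on_compose_gen[OF _ holo, unfolded o_def] holomorphic_intros) auto
    have g_pos: "Re (g \<zeta>) > 0" if "norm \<zeta> < 1" for \<zeta>
      unfolding g_def by (intro pos ball that)
    define a where "a = g 0"
    have a: "Re a > 0" using g_pos[of 0] by (simp add: a_def)
    define \<phi> where "\<phi> = (\<lambda>\<zeta>. (g \<zeta> - a) / (g \<zeta> + cnj a))"
    have nz: "g \<zeta> + cnj a \<noteq> 0" if "norm \<zeta> < 1" for \<zeta>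
    proof
      assume "g \<zeta> + cnj a = 0"
      then have "Re (g \<zeta> + cnj a) = 0" by simp
      then show False using g_pos[OF that] a by simp
    qed
    have less: "norm (g \<zeta> - a) < norm (g \<zeta> + cnj a)" if "norm \<zeta> < 1" for \<zeta>
    proof -
      \<comment> \<open>The difference of the two squares is 4 Re (g zeta) Re a.\<close>
      have "norm (g \<zeta> - a) ^ 2 < norm (g \<zeta> + cnj a) ^ 2"
        using mult_pos_pos[OF g_pos[OF that] a] unfolding cmod_power2
        by (simp add: power2_eq_square algebra_simps)
      then show ?thesis by (rule power_less_imp_less_base) simp
    qed
    define \<zeta> where "\<zeta> = (w - z0) / of_real R"
    have \<zeta>: "norm \<zeta> \<le> d / R" "norm \<zeta> < 1"
      using d R by (auto simp: \<zeta>_def norm_divide dist_norm norm_minus_commute divide_simps)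
    have "norm (\<phi> \<zeta>) \<le> norm \<zeta>"
    proof (rule Schwarz_Lemma(1))
      show "\<phi> holomorphic_on ball 0 1"
        unfolding \<phi>_def using nz by (intro holomorphic_intros g_holo) auto
      show "norm (\<phi> z) < 1" if "norm z < 1" for z
        unfolding \<phi>_def using less[OF that] nz[OF that] by (simp add: norm_divide divide_simps)
    qed (use \<zeta> in \<open>auto simp: \<phi>_def a_def\<close>)
    then have *: "norm (g \<zeta> - a) \<le> norm \<zeta> * norm (g \<zeta> + cnj a)"
      using nz[OF \<zeta>(2)] by (simp add: \<phi>_def norm_divide divide_simps)
    define b where "b = g \<zeta> - \<i> * Im a"
    have "g \<zeta> - a = b - of_real (Re a)" "g \<zeta> + cnj a = b + of_real (Re a)"
      by (auto simp: b_def complex_eq_iff)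
    with * have **: "norm (b - of_real (Re a)) \<le> norm \<zeta> * norm (b + of_real (Re a))" by simp
    have "norm b - Re a \<le> norm (b - of_real (Re a))"
      using norm_triangle_ineq2[of b "of_real (Re a)"] a by simp
    also note **
    also have "norm \<zeta> * norm (b + of_real (Re a)) \<le> (d / R) * (norm b + Re a)"
      using \<zeta> norm_triangle_ineq[of b "of_real (Re a)"] a d0 R by (intro mult_mono) auto
    finally have "norm b * (R - d) \<le> (R + d) * Re a"
      using R by (simp add: field_simps)
    moreover have "b = H w - \<i> * Im (H z0)" "a = H z0"
      using R by (simp_all add: b_def a_def g_def \<zeta>_def)
    ultimately show ?thesis by simp
  qed
  have "norm (G w - \<i> * Im (G z0)) * (R - d) \<le> (R + d) * Re (G z0)"
  proof (rule field_le_epsilon)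
    fix e :: real assume "e > 0"
    \<comment> \<open>The shift costs (R + d) e' on the right and (R - d) e' on the left, together 2
      R e' = e.\<close>
    define e' where "e' = e / (2 * R)"
    have e': "e' > 0" using \<open>e > 0\<close> R by (simp add: e'_def)
    have "norm (G w + e' - \<i> * Im (G z0 + e')) * (R - d) \<le> (R + d) * Re (G z0 + e')"
      by (rule strict[of "\<lambda>w. G w + e'"]) (use nonneg e' holo in \<open>auto intro!: holomorphic_intros add_nonneg_pos\<close>)
    moreover have "norm (G w - \<i> * Im (G z0)) \<le> norm (G w + e' - \<i> * Im (G z0 + e')) + e'"
      using norm_triangle_ineq4[of "G w + e' - \<i> * Im (G z0 + e')" "of_real e'"] e' by simp
    ultimately have "norm (G w - \<i> * Im (G z0)) * (R - d) \<le> (R + d) * Re (G z0 + e') + e' * (R - d)"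
      using d by (smt (verit) mult_right_mono distrib_right)
    also have "\<dots> = (R + d) * Re (G z0) + e"
      using R by (simp add: e'_def field_simps)
    finally show "norm (G w - \<i> * Im (G z0)) * (R - d) \<le> (R + d) * Re (G z0) + e" .
  qed
  then show ?thesis using d by (simp add: field_simps)
qed

lemma harnack:
  assumes "G holomorphic_on ball z0 R" "\<And>w. w \<in> ball z0 R \<Longrightarrow> Re (G w) \<ge> 0"
    and "dist z0 w \<le> d" "d < R"
  shows "Re (G w) \<le> (R + d) / (R - d) * Re (G z0)"
proof -
  have "Re (G w) = Re (G w - \<i> * Im (G z0))" by simp
  also have "\<dots> \<le> norm (G w - \<i> * Im (G z0))" by (rule complex_Re_le_cmod)
  also have "\<dots> \<le> (R + d) / (R - d) * Re (G z0)" by (rule Re_nonneg_ball_bound[OF assms])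
  finally show ?thesis .
qed

text \<open>The minimum principle for Re p, read off from the majorant principle for the constant
  function 1.\<close>

lemma Re_poly_nonneg:
  assumes "\<And>z. norm z = r \<Longrightarrow> 0 \<le> Re (poly p z)" "norm w \<le> r" "r > 0"
  shows "Re (poly p w) \<ge> 0"
  using maximum_modulus_Re_poly[of "\<lambda>_. 1" r p w] assms by simp

text \<open>Passes from a mean over a circle to a pointwise bound inside it. As
  \<open>\<phi>\<close> is nonnegative, a polynomial majorant has nonnegative real part on the disc,
  and Harnack compares its value at \<open>w\<close> with its value at 0, which is nearly the
  mean.\<close>

lemma norm_le_exp_circle_mean:
  assumes f: "f holomorphic_on UNIV" and cont: "continuous_on (sphere 0 r) \<phi>"
    and nonneg: "\<And>z. norm z = r \<Longrightarrow> 0 \<le> \<phi> z"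
    and le: "\<And>z. norm z = r \<Longrightarrow> norm (f z) \<le> exp (\<phi> z)" and w: "norm w < r"
  shows "norm (f w) \<le> exp ((r + norm w) / (r - norm w) * circle_mean r \<phi>)"
proof (cases "f w = 0")
  case False
  define \<kappa> where "\<kappa> = (r + norm w) / (r - norm w)"
  have r: "r > 0" using w norm_ge_zero[of w] by linarith
  have \<kappa>: "\<kappa> > 0" using w r unfolding \<kappa>_def by (intro divide_pos_pos add_pos_nonneg) auto
  have "ln (norm (f w)) \<le> \<kappa> * circle_mean r \<phi>"
  proof (rule field_le_epsilon)
    fix e :: real assume "e > 0"
    then have "e / \<kappa> > 0" using \<kappa> by simp
    then obtain p where p: "\<And>z. norm z = r \<Longrightarrow> \<phi> z < Re (poly p z)"
      "Re (poly p 0) \<le> circle_mean r \<phi> + e / \<kappa>"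
      using Re_poly_majorant[OF cont _ less_imp_le[OF r]] by metis
    have "norm (f w) \<le> exp (Re (poly p w))"
    proof (rule maximum_modulus_Re_poly[OF f, of r])
      fix z :: complex assume z: "norm z = r"
      show "norm (f z) \<le> exp (Re (poly p z))"
        using le[OF z] p(1)[OF z] by (meson exp_le_cancel_iff less_imp_le order_trans)
    qed (use w r in auto)
    then have "ln (norm (f w)) \<le> Re (poly p w)"
      using False by (metis exp_le_cancel_iff exp_ln zero_less_norm_iff)
    also have "\<dots> \<le> \<kappa> * Re (poly p 0)"
      unfolding \<kappa>_def
    proof (rule harnack[where G = "poly p"])
      show "0 \<le> Re (poly p z)" if "z \<in> ball 0 r" for z
        by (rule Re_poly_nonneg[of r]) (use p(1) nonneg r that in \<open>force intro: less_imp_le\<close>)+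
    qed (use w in \<open>auto intro!: holomorphic_intros\<close>)
    also have "\<dots> \<le> \<kappa> * (circle_mean r \<phi> + e / \<kappa>)"
      using p(2) \<kappa> by (intro mult_left_mono) auto
    also have "\<dots> = \<kappa> * circle_mean r \<phi> + e" using \<kappa> by (simp add: field_simps)
    finally show "ln (norm (f w)) \<le> \<kappa> * circle_mean r \<phi> + e" .
  qed
  then show ?thesis using False unfolding \<kappa>_def by (metis exp_le_cancel_iff exp_ln zero_less_norm_iff)
qed simp

lemma entire_factor_zero:
  assumes f: "f holomorphic_on UNIV" and nz: "\<not> (\<forall>z. f z = 0)"
  obtains g n where "g holomorphic_on UNIV" "g w \<noteq> 0" "\<And>z. f z = (z - w) ^ n * g z"
proof (cases "f w = 0 \<and> \<not> f constant_on UNIV")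
  case False
  then have "f w \<noteq> 0" using nz by (auto simp: constant_on_def)
  then show ?thesis using that[of f 0] f by simp
next
  case True
  obtain g r n where g: "0 < n" "0 < r" "g holomorphic_on ball w r"
    "\<And>z. z \<in> ball w r \<Longrightarrow> f z = (z - w) ^ n * g z" "\<And>z. z \<in> ball w r \<Longrightarrow> g z \<noteq> 0"
    using holomorphic_factor_zero_nonconstant[OF f open_UNIV connected_UNIV UNIV_I, of w] True by metis
  define G where "G = (\<lambda>z. if z \<in> ball w r then g z else f z / (z - w) ^ n)"
  have fG: "f z = (z - w) ^ n * G z" for z
    using g(2,4) by (auto simp: G_def)
  have "G holomorphic_on (ball w r \<union> (UNIV - {w}))"
  proof (rule holomorphic_on_Un)
    show "G holomorphic_on ball w r"
      using g(3) by (rule holomorphic_transform) (simp add: G_def)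
    have "(\<lambda>z. f z / (z - w) ^ n) holomorphic_on (UNIV - {w})"
      by (intro holomorphic_intros holomorphic_on_subset[OF f]) auto
    then show "G holomorphic_on (UNIV - {w})"
      by (rule holomorphic_transform) (use fG in auto)
  qed auto
  moreover have "ball w r \<union> (UNIV - {w}) = UNIV" using g(2) by auto
  ultimately show ?thesis
    using that[of G n] fG g(2,5) by (auto simp: G_def)
qed

text \<open>The source of all contradictions below: majorants of a function that is not identically
  zero cannot have means tending to minus infinity. A zero at the origin is divided out, and for
  \<open>r >= 1\<close> the removed factor has modulus at least 1 on the circle.\<close>

lemma circle_mean_lower_bound:
  assumes f: "f holomorphic_on UNIV" and nz: "\<not> (\<forall>z. f z = 0)"
  obtains C where "\<And>r \<phi>. \<lbrakk>r \<ge> 1; continuous_on (sphere 0 r) \<phi>;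
      \<And>z. norm z = r \<Longrightarrow> norm (f z) \<le> exp (\<phi> z)\<rbrakk> \<Longrightarrow> - C \<le> circle_mean r \<phi>"
proof -
  obtain g n where g: "g holomorphic_on UNIV" "g 0 \<noteq> 0" "\<And>z. f z = (z - 0) ^ n * g z"
    using entire_factor_zero[OF f nz, of 0] by metis
  show ?thesis
  proof (rule that[of "- ln (norm (g 0))"])
    fix r :: real and \<phi> :: "complex \<Rightarrow> real"
    assume r: "r \<ge> 1" and c: "continuous_on (sphere 0 r) \<phi>"
      and le: "\<And>z. norm z = r \<Longrightarrow> norm (f z) \<le> exp (\<phi> z)"
    have "norm (g 0) \<le> exp (circle_mean r \<phi>)"
    proof (rule norm_at_0_le_circle_mean[OF g(1) c])
      fix z :: complex assume z: "norm z = r"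
      have "norm (g z) \<le> r ^ n * norm (g z)" using r by (simp add: mult_le_cancel_right1)
      also have "\<dots> = norm (f z)" using z g(3) by (simp add: norm_mult norm_power)
      also have "\<dots> \<le> exp (\<phi> z)" by (rule le[OF z])
      finally show "norm (g z) \<le> exp (\<phi> z)" .
    qed (use r in auto)
    then show "- (- ln (norm (g 0))) \<le> circle_mean r \<phi>"
      using g(2) by (simp add: ln_le_cancel_iff flip: ln_exp) (metis exp_gt_zero ln_exp ln_le_cancel_iff zero_less_norm_iff)
  qed
qed

section \<open>Identity theorem and Wronskians\<close>

lemma entire_mult_eq_0:
  assumes "f holomorphic_on UNIV" "g holomorphic_on UNIV" "\<And>z. f z * g z = 0" "g w \<noteq> 0"
  shows "f z = (0::complex)"
proof (rule analytic_continuation_open[where f = f and g = "\<lambda>_. 0"])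
  show "open {z. g z \<noteq> 0}"
    by (intro open_Collect_neq holomorphic_on_imp_continuous_on assms continuous_on_const)
  show "{z. g z \<noteq> 0} \<noteq> {}" using assms(4) by auto
qed (use assms in auto)

text \<open>f / g has derivative zero near \<open>w\<close>; the zeros of \<open>g\<close> elsewhere
  are bypassed by analytic continuation from a ball.\<close>

lemma wronskian_zero_imp_proportional:
  assumes f: "f holomorphic_on UNIV" and g: "g holomorphic_on UNIV" and gw: "g w \<noteq> 0"
    and eq: "\<And>z. deriv f z * g z = f z * deriv g z"
  obtains c where "\<And>z. f z = c * g z"
proof -
  have "open {z. g z \<noteq> 0}"
    by (intro open_Collect_neq holomorphic_on_imp_continuous_on g continuous_on_const)
  then obtain e where e: "e > 0" "ball w e \<subseteq> {z. g z \<noteq> 0}"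
    using gw openE by (metis mem_Collect_eq)
  have "(\<lambda>z. f z / g z) constant_on ball w e"
  proof (rule has_field_derivative_0_imp_constant_on)
    fix z assume "z \<in> ball w e"
    then have gz: "g z \<noteq> 0" using e by auto
    have "((\<lambda>z. f z / g z) has_field_derivative (deriv f z * g z - f z * deriv g z) / (g z * g z)) (at z)"
      by (intro DERIV_divide holomorphic_derivI[OF f] holomorphic_derivI[OF g] gz) auto
    then show "((\<lambda>z. f z / g z) has_field_derivative 0) (at z)" using eq by simp
  qed auto
  then obtain c where c: "\<And>z. z \<in> ball w e \<Longrightarrow> f z / g z = c"
    by (auto simp: constant_on_def)
  have "f z = c * g z" for z
  proof (rule analytic_continuation_open[where f = f and g = "\<lambda>z. c * g z" and s = "ball w e" and s' = UNIV])
    fix z assume "z \<in> ball w e"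
    then have "g z \<noteq> 0" "f z / g z = c" using e c by auto
    then show "f z = c * g z" by (auto simp: field_simps)
  qed (use e f g in \<open>auto intro!: holomorphic_intros\<close>)
  then show ?thesis by (rule that)
qed

text \<open>Growth of order \<open>\<tau>\<close> and finite type, without an optimal constant. The
  base \<open>1 + norm z\<close> is at least 1, so for \<open>\<tau> >= 0\<close> constants, sums,
  translates and derivatives only change \<open>C\<close>.\<close>

definition fin_type :: "real \<Rightarrow> (complex \<Rightarrow> complex) \<Rightarrow> bool" where
  "fin_type \<tau> A \<longleftrightarrow> A holomorphic_on UNIV \<and> (\<exists>C. \<forall>z. norm (A z) \<le> exp (C * (1 + norm z) powr \<tau>))"

lemma fin_type_holomorphic: "fin_type \<tau> A \<Longrightarrow> A holomorphic_on S"
  by (auto simp: fin_type_def intro: holomorphic_on_subset)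

lemma fin_typeE:
  assumes "fin_type \<tau> A"
  obtains C where "C > 0" "\<And>z. norm (A z) \<le> exp (C * (1 + norm z) powr \<tau>)"
proof -
  obtain C where C: "\<And>z. norm (A z) \<le> exp (C * (1 + norm z) powr \<tau>)"
    using assms by (auto simp: fin_type_def)
  have "norm (A z) \<le> exp (max 1 C * (1 + norm z) powr \<tau>)" for z
    using C[of z] by (smt (verit) exp_le_cancel_iff mult_right_mono powr_ge_zero)
  then show ?thesis using that[of "max 1 C"] by auto
qed

lemma fin_typeI:
  assumes "A holomorphic_on UNIV" "\<And>z. norm (A z) \<le> exp (C * (1 + norm z) powr \<tau>)"
  shows "fin_type \<tau> A"
  using assms by (auto simp: fin_type_def)

lemma one_le_one_plus_norm_powr: "\<tau> \<ge> 0 \<Longrightarrow> 1 \<le> (1 + norm z) powr \<tau>"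
  by (simp add: ge_one_powr_ge_zero)

lemma fin_type_mono:
  assumes "fin_type \<sigma> A" "\<sigma> \<le> \<tau>"
  shows "fin_type \<tau> A"
proof -
  obtain C where C: "C > 0" "\<And>z. norm (A z) \<le> exp (C * (1 + norm z) powr \<sigma>)"
    using fin_typeE[OF assms(1)] by metis
  have "exp (C * (1 + norm z) powr \<sigma>) \<le> exp (C * (1 + norm z) powr \<tau>)" for z :: complex
    using C assms(2) by (simp add: powr_mono)
  then show ?thesis
    using C(2) assms(1) by (intro fin_typeI[where C = C] fin_type_holomorphic[OF assms(1)]) (blast intro: order_trans)
qed

lemma fin_type_const:
  assumes "\<tau> \<ge> 0"
  shows "fin_type \<tau> (\<lambda>_. c)"
proof (rule fin_typeI)
  fix z :: complex
  have "norm c \<le> exp (norm c)" using exp_ge_add_one_self[of "norm c"] by linarith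
  also have "\<dots> \<le> exp (norm c * (1 + norm z) powr \<tau>)"
    using one_le_one_plus_norm_powr[OF assms, of z] by (simp add: mult_le_cancel_left1)
  finally show "norm c \<le> exp (norm c * (1 + norm z) powr \<tau>)" .
qed auto

lemma fin_type_mult:
  assumes "fin_type \<tau> A" "fin_type \<tau> B"
  shows "fin_type \<tau> (\<lambda>z. A z * B z)"
proof -
  obtain C D where C: "\<And>z. norm (A z) \<le> exp (C * (1 + norm z) powr \<tau>)"
     and D: "\<And>z. norm (B z) \<le> exp (D * (1 + norm z) powr \<tau>)"
    using assms by (meson fin_typeE)
  show ?thesis
  proof (rule fin_typeI)
    show "norm (A z * B z) \<le> exp ((C + D) * (1 + norm z) powr \<tau>)" for z
      using mult_mono[OF C D, of z z] by (simp add: norm_mult distrib_right exp_add)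
  qed (intro holomorphic_intros assms(1,2)[THEN fin_type_holomorphic])
qed

lemma fin_type_add:
  assumes "fin_type \<tau> A" "fin_type \<tau> B" "\<tau> \<ge> 0"
  shows "fin_type \<tau> (\<lambda>z. A z + B z)"
proof -
  obtain C D where C: "C > 0" "\<And>z. norm (A z) \<le> exp (C * (1 + norm z) powr \<tau>)"
     and D: "D > 0" "\<And>z. norm (B z) \<le> exp (D * (1 + norm z) powr \<tau>)"
    using assms by (meson fin_typeE)
  show ?thesis
  proof (rule fin_typeI)
    fix z :: complex
    define x where "x = (1 + norm z) powr \<tau>"
    have x: "x \<ge> 1" unfolding x_def by (rule one_le_one_plus_norm_powr[OF assms(3)])
    have two: "2 \<le> exp x" using exp_ge_add_one_self[of x] x by linarith
    have "norm (A z + B z) \<le> exp (C * x) + exp (D * x)"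
      using C(2)[of z] D(2)[of z] norm_triangle_ineq[of "A z" "B z"] unfolding x_def by linarith
    also have "\<dots> \<le> exp ((C + D) * x) + exp ((C + D) * x)"
      using C(1) D(1) x by (intro add_mono) (auto simp: mult_right_mono)
    also have "exp ((C + D) * x) + exp ((C + D) * x) \<le> exp x * exp ((C + D) * x)"
      using mult_right_mono[of 2 "exp x" "exp ((C + D) * x)"] two by simp
    also have "\<dots> = exp ((1 + C + D) * x)" by (simp add: distrib_right exp_add)
    finally show "norm (A z + B z) \<le> exp ((1 + C + D) * (1 + norm z) powr \<tau>)" by (simp add: x_def)
  qed (intro holomorphic_intros assms(1,2)[THEN fin_type_holomorphic])
qed

lemma fin_type_minus: "fin_type \<tau> A \<Longrightarrow> fin_type \<tau> (\<lambda>z. - A z)"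
  by (auto simp: fin_type_def intro!: holomorphic_intros)

lemma fin_type_diff:
  "fin_type \<tau> A \<Longrightarrow> fin_type \<tau> B \<Longrightarrow> \<tau> \<ge> 0 \<Longrightarrow> fin_type \<tau> (\<lambda>z. A z - B z)"
  using fin_type_add[of \<tau> A "\<lambda>z. - B z"] by (simp add: fin_type_minus)

lemma fin_type_power: "fin_type \<tau> A \<Longrightarrow> \<tau> \<ge> 0 \<Longrightarrow> fin_type \<tau> (\<lambda>z. A z ^ n)"
  by (induction n) (auto intro: fin_type_const fin_type_mult)

lemma one_plus_norm_add_powr_le:
  assumes "norm w \<le> d" "\<tau> \<ge> 0"
  shows "(1 + norm (z + w)) powr \<tau> \<le> (1 + d) powr \<tau> * (1 + norm z) powr \<tau>"
proof -
  have d: "d \<ge> 0" using assms(1) norm_ge_zero[of w] by linarith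
  have "1 + norm (z + w) \<le> (1 + d) * (1 + norm z)"
    using norm_triangle_ineq[of z w] assms(1) mult_nonneg_nonneg[OF d norm_ge_zero[of z]]
    by (simp add: algebra_simps)
  then have "(1 + norm (z + w)) powr \<tau> \<le> ((1 + d) * (1 + norm z)) powr \<tau>"
    using assms by (intro powr_mono2) auto
  then show ?thesis using d by (simp add: powr_mult)
qed

lemma fin_type_shift:
  assumes "fin_type \<tau> A" "\<tau> \<ge> 0"
  shows "fin_type \<tau> (\<lambda>z. A (z + c))"
proof -
  obtain C where C: "C > 0" "\<And>z. norm (A z) \<le> exp (C * (1 + norm z) powr \<tau>)"
    using fin_typeE[OF assms(1)] by metis
  show ?thesis
  proof (rule fin_typeI)
    show "(\<lambda>z. A (z + c)) holomorphic_on UNIV"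
      by (intro holomorphic_on_compose_gen[OF _ fin_type_holomorphic[OF assms(1), of UNIV], unfolded o_def] holomorphic_intros) auto
    fix z
    have "norm (A (z + c)) \<le> exp (C * (1 + norm (z + c)) powr \<tau>)" by (rule C)
    also have "\<dots> \<le> exp (C * ((1 + norm c) powr \<tau> * (1 + norm z) powr \<tau>))"
      using C(1) assms one_plus_norm_add_powr_le[of c "norm c" \<tau> z] by simp
    finally show "norm (A (z + c)) \<le> exp (C * (1 + norm c) powr \<tau> * (1 + norm z) powr \<tau>)"
      by (simp add: mult.assoc)
  qed
qed

lemma norm_deriv_le:
  assumes f: "f holomorphic_on UNIV" and "\<And>w. norm (w - z) = 1 \<Longrightarrow> norm (f w) \<le> B"
  shows "norm (deriv f z) \<le> B"
  using Cauchy_inequality[of f z 1 B 1] assms holomorphic_on_subset[OF f]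
  by (auto simp: norm_minus_commute intro: holomorphic_on_imp_continuous_on)

lemma fin_type_deriv:
  assumes "fin_type \<tau> A" "\<tau> \<ge> 0"
  shows "fin_type \<tau> (deriv A)"
proof -
  obtain C where C: "C > 0" "\<And>z. norm (A z) \<le> exp (C * (1 + norm z) powr \<tau>)"
    using fin_typeE[OF assms(1)] by metis
  show ?thesis
  proof (rule fin_typeI)
    show "deriv A holomorphic_on UNIV"
      by (intro holomorphic_deriv fin_type_holomorphic[OF assms(1)] open_UNIV)
    fix z
    show "norm (deriv A z) \<le> exp (C * (1 + 1) powr \<tau> * (1 + norm z) powr \<tau>)"
    proof (rule norm_deriv_le[OF fin_type_holomorphic[OF assms(1)]])
      fix w :: complex assume w: "norm (w - z) = 1"
      have "norm (A w) \<le> exp (C * (1 + norm w) powr \<tau>)" by (rule C)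
      also have "\<dots> \<le> exp (C * ((1 + 1) powr \<tau> * (1 + norm z) powr \<tau>))"
        using C(1) w assms one_plus_norm_add_powr_le[of "w - z" 1 \<tau> z] by simp
      finally show "norm (A w) \<le> exp (C * (1 + 1) powr \<tau> * (1 + norm z) powr \<tau>)"
        by (simp add: mult.assoc)
    qed
  qed
qed

lemma fin_type_ident:
  assumes "\<tau> > 0"
  shows "fin_type \<tau> (\<lambda>z. z)"
proof (rule fin_typeI)
  fix z :: complex
  have "ln (1 + norm z) = (1 / \<tau>) * ln ((1 + norm z) powr \<tau>)"
    using assms by (simp add: ln_powr add_nonneg_eq_0_iff)
  also have "\<dots> \<le> (1 / \<tau>) * (1 + norm z) powr \<tau>"
    using assms by (intro mult_left_mono order_trans[OF ln_le_minus_one]) (auto simp: add_nonneg_eq_0_iff)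
  finally have "1 + norm z \<le> exp ((1 / \<tau>) * (1 + norm z) powr \<tau>)"
    by (metis add_pos_nonneg exp_le_cancel_iff exp_ln norm_ge_zero zero_less_one)
  then show "norm z \<le> exp ((1 / \<tau>) * (1 + norm z) powr \<tau>)" by simp
qed auto

lemma fin_type_poly: "\<tau> > 0 \<Longrightarrow> fin_type \<tau> (poly p)"
proof (induction p)
  case (pCons a p)
  then show ?case
    by (auto intro!: fin_type_add fin_type_mult fin_type_const fin_type_ident simp: poly_pCons[abs_def])
qed (simp add: fin_type_const poly_0[abs_def])

section \<open>Polynomial exponents and Borel's theorem\<close>

lemma norm_poly_le:
  obtains C where "C \<ge> 0" "\<And>z :: complex. norm (poly p z) \<le> C * (1 + norm z) ^ degree p"
proof -
  have "norm (poly p z) \<le> (\<Sum>i\<le>degree p. norm (coeff p i)) * (1 + norm z) ^ degree p" for z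
  proof -
    have "norm (poly p z) \<le> (\<Sum>i\<le>degree p. norm (coeff p i) * norm z ^ i)"
      unfolding poly_altdef by (rule order_trans[OF norm_sum]) (simp add: norm_mult norm_power)
    also have "\<dots> \<le> (\<Sum>i\<le>degree p. norm (coeff p i) * (1 + norm z) ^ degree p)"
    proof (intro sum_mono mult_left_mono)
      fix i assume "i \<in> {..degree p}"
      then show "norm z ^ i \<le> (1 + norm z) ^ degree p"
        by (intro order_trans[OF power_mono[of "norm z" "1 + norm z"] power_increasing]) auto
    qed auto
    finally show ?thesis by (simp add: sum_distrib_right)
  qed
  then show ?thesis by (intro that[of "\<Sum>i\<le>degree p. norm (coeff p i)"] sum_nonneg) auto
qed

lemma fin_type_exp_poly:
  assumes "real (degree p) \<le> \<tau>"
  shows "fin_type \<tau> (\<lambda>z. exp (poly p z))"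
proof -
  obtain C where C: "C \<ge> 0" "\<And>z. norm (poly p z) \<le> C * (1 + norm z) ^ degree p"
    using norm_poly_le[of p] by metis
  show ?thesis
  proof (rule fin_typeI)
    fix z
    have "Re (poly p z) \<le> C * (1 + norm z) ^ degree p"
      using C(2)[of z] complex_Re_le_cmod[of "poly p z"] by linarith
    also have "(1 + norm z) ^ degree p = (1 + norm z) powr real (degree p)"
      by (simp add: powr_realpow add_pos_nonneg)
    also have "C * \<dots> \<le> C * (1 + norm z) powr \<tau>"
      using C assms by (intro mult_left_mono powr_mono) auto
    finally show "norm (exp (poly p z)) \<le> exp (C * (1 + norm z) powr \<tau>)" by simp
  qed (auto intro!: holomorphic_intros)
qed

lemma Re_poly_large:
  assumes "degree H > 0"
  obtains c R where "c > 0" "\<And>r. r \<ge> R \<Longrightarrow> \<exists>w. norm w = r \<and> c * r ^ degree H \<le> Re (poly H w)"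
proof -
  define d where "d = degree H"
  define a where "a = lead_coeff H"
  have a: "a \<noteq> 0" using assms by (auto simp: a_def)
  define L where "L = H - monom a d"
  have H: "H = monom a d + L" by (simp add: L_def)
  have degL: "degree L \<le> d - 1"
  proof (rule degree_le, intro allI impI)
    fix i assume "d - 1 < i"
    then show "coeff L i = 0"
      using assms by (cases "i = d") (auto simp: L_def d_def a_def coeff_eq_0)
  qed
  obtain C where C: "C \<ge> 0" "\<And>z. norm (poly L z) \<le> C * (1 + norm z) ^ degree L"
    using norm_poly_le[of L] by metis
  show ?thesis
  proof (rule that[of "norm a / 2" "max 1 (2 * C * 2 ^ (d - 1) / norm a)"])
    fix r assume r: "r \<ge> max 1 (2 * C * 2 ^ (d - 1) / norm a)"
    \<comment> \<open>The argument makes the leading term \<open>a * w ^ d\<close> real and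
      positive. The radius bound makes the lower terms at most half of it.\<close>
    define w where "w = of_real r * cis (- Arg a / d)"
    have nw: "norm w = r" using r by (simp add: w_def norm_mult)
    have "a * w ^ d = of_real (r ^ d) * (a * cis (- Arg a))"
      using assms by (simp add: w_def power_mult_distrib Complex.DeMoivre d_def)
    also have "a * cis (- Arg a) = of_real (norm a)"
      using rcis_cmod_Arg[of a] by (metis add.right_inverse cis_zero mult.assoc mult.right_neutral rcis_def cis_mult)
    finally have main: "a * w ^ d = of_real (r ^ d * norm a)" by simp
    have "norm (poly L w) \<le> C * (1 + r) ^ degree L" using C(2)[of w] nw by simp
    also have "\<dots> \<le> C * (2 * r) ^ (d - 1)"
      using r degL C by (intro mult_left_mono order_trans[OF power_increasing[OF degL] power_mono]) auto
    also have "\<dots> = (C * 2 ^ (d - 1)) * r ^ (d - 1)" by (simp add: power_mult_distrib)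
    also have "\<dots> \<le> (norm a / 2 * r) * r ^ (d - 1)"
      using r a by (intro mult_right_mono) (auto simp: field_simps)
    also have "\<dots> = norm a / 2 * r ^ d"
      using assms by (cases d) (auto simp: d_def)
    finally have L: "norm (poly L w) \<le> norm a / 2 * r ^ d" .
    have "Re (poly H w) = r ^ d * norm a + Re (poly L w)"
      unfolding H by (simp only: poly_add poly_monom main) simp
    moreover have "- norm (poly L w) \<le> Re (poly L w)"
      using abs_Re_le_cmod[of "poly L w"] by linarith
    ultimately show "\<exists>w. norm w = r \<and> norm a / 2 * r ^ degree H \<le> Re (poly H w)"
      using L nw by (intro exI[of _ w]) (auto simp: d_def algebra_simps)
  qed (use a in auto)
qed

lemma powr_dominates:
  fixes c d \<tau> :: real
  assumes "c > 0" "\<tau> < d" "\<And>r. r \<ge> R \<Longrightarrow> c * r powr d \<le> K * r powr \<tau>"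
  shows False
proof -
  have "filterlim (\<lambda>r. r powr (d - \<tau>)) at_top (at_top :: real filter)"
    using assms(2) by real_asymp
  then have "eventually (\<lambda>r. r powr (d - \<tau>) > K / c) at_top"
    by (simp add: filterlim_at_top_dense)
  moreover have "eventually (\<lambda>r :: real. r \<ge> max 1 R) at_top" by (rule eventually_ge_at_top)
  ultimately have "eventually (\<lambda>r :: real. False) at_top"
  proof eventually_elim
    case (elim r)
    have "K * r powr \<tau> < c * r powr (d - \<tau>) * r powr \<tau>"
      using elim assms(1) by (intro mult_strict_right_mono) (auto simp: field_simps)
    also have "\<dots> = c * r powr d" by (simp add: mult.assoc flip: powr_add)
    finally show False using assms(3)[of r] elim by simp
  qed
  then show False by simp
qed

text \<open>Where Re H is positive, |A| = |B| exp (- Re H) is small. Thus ln |A| has the majorant K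
  (1 + 2r)^tau minus the positive part of Re H, and the lower bound for its mean makes the mean of
  that positive part O(r^tau). Harnack turns this into a pointwise bound, which the degree of
  \<open>H\<close> violates.\<close>

lemma exp_poly_dominates:
  assumes A: "fin_type \<tau> A" and B: "fin_type \<tau> B" and eq: "\<And>z. A z * exp (poly H z) = B z"
    and deg: "real (degree H) > \<tau>" and \<tau>: "\<tau> \<ge> 0"
  shows "A z = 0"
proof (rule ccontr)
  assume nz: "A z \<noteq> 0"
  define d where "d = degree H"
  obtain C0 where C0: "\<And>r \<phi>. \<lbrakk>r \<ge> 1; continuous_on (sphere 0 r) \<phi>;
      \<And>z. norm z = r \<Longrightarrow> norm (A z) \<le> exp (\<phi> z)\<rbrakk> \<Longrightarrow> - C0 \<le> circle_mean r \<phi>"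
    using circle_mean_lower_bound[OF fin_type_holomorphic[OF A]] nz by metis
  obtain C D where C: "C > 0" "\<And>z. norm (A z) \<le> exp (C * (1 + norm z) powr \<tau>)"
     and D: "D > 0" "\<And>z. norm (B z) \<le> exp (D * (1 + norm z) powr \<tau>)"
    using A B by (meson fin_typeE)
  define K where "K = max C D"
  have degH: "degree H > 0" using deg \<tau> by linarith
  obtain c R where c: "c > 0" "\<And>r. r \<ge> R \<Longrightarrow> \<exists>w. norm w = r \<and> c * r ^ d \<le> Re (poly H w)"
    using Re_poly_large[OF degH] unfolding d_def by metis
  have cont: "continuous_on (sphere 0 r) (\<lambda>z. max 0 (Re (poly H z)))" for r
    by (intro continuous_intros)
  have bound: "c * r ^ d \<le> 3 * (K * (1 + 2 * r) powr \<tau> + C0)" if r: "r \<ge> max 1 R" for r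
  proof -
    have "- C0 \<le> circle_mean (2 * r) (\<lambda>z. K * (1 + 2 * r) powr \<tau> - max 0 (Re (poly H z)))"
    proof (rule C0)
      fix z :: complex assume z: "norm z = 2 * r"
      have "norm (A z) \<le> exp (K * (1 + 2 * r) powr \<tau>)"
        by (rule order_trans[OF C(2)]) (use z in \<open>auto simp: K_def mult_right_mono\<close>)
      moreover have "norm (B z) \<le> exp (K * (1 + 2 * r) powr \<tau>)"
        by (rule order_trans[OF D(2)]) (use z in \<open>auto simp: K_def mult_right_mono\<close>)
      moreover have "norm (A z) * exp (Re (poly H z)) = norm (B z)"
        using eq[of z] by (metis norm_mult norm_exp_eq_Re)
      ultimately show "norm (A z) \<le> exp (K * (1 + 2 * r) powr \<tau> - max 0 (Re (poly H z)))"
        by (auto simp: max_def exp_diff field_simps)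
    qed (use r in \<open>auto intro!: continuous_intros\<close>)
    also have "\<dots> = K * (1 + 2 * r) powr \<tau> - circle_mean (2 * r) (\<lambda>z. max 0 (Re (poly H z)))"
      using r by (subst circle_mean_diff) (auto intro!: continuous_intros)
    finally have mean: "circle_mean (2 * r) (\<lambda>z. max 0 (Re (poly H z))) \<le> K * (1 + 2 * r) powr \<tau> + C0" by simp
    obtain w where w: "norm w = r" "c * r ^ d \<le> Re (poly H w)" using c(2)[of r] r by auto
    \<comment> \<open>The function exp H is majorized by the positive part of Re H. For |w| = r
      inside the circle of radius 2r the Harnack factor is 3r / r = 3.\<close>
    have "norm (exp (poly H w)) \<le> exp ((2 * r + norm w) / (2 * r - norm w) * circle_mean (2 * r) (\<lambda>z. max 0 (Re (poly H z))))"
      by (rule norm_le_exp_circle_mean) (use w r in \<open>auto intro!: holomorphic_intros continuous_intros\<close>)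
    then have "Re (poly H w) \<le> 3 * circle_mean (2 * r) (\<lambda>z. max 0 (Re (poly H z)))"
      using w r by simp
    also have "\<dots> \<le> 3 * (K * (1 + 2 * r) powr \<tau> + C0)"
      by (intro mult_left_mono mean) simp
    finally show ?thesis using w by simp
  qed
  show False
  proof (rule powr_dominates[where c = c and d = "real d" and \<tau> = \<tau> and R = "max 1 R"
      and K = "3 * (K * 3 powr \<tau> + \<bar>C0\<bar>)"])
    fix r assume r: "r \<ge> max 1 R"
    have K: "K \<ge> 0" using C(1) by (simp add: K_def)
    have "(1 + 2 * r) powr \<tau> \<le> (3 * r) powr \<tau>" using r \<tau> by (intro powr_mono2) auto
    then have "K * (1 + 2 * r) powr \<tau> \<le> K * (3 powr \<tau> * r powr \<tau>)"
      using K r by (simp add: powr_mult mult_left_mono)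
    moreover have "C0 \<le> \<bar>C0\<bar> * r powr \<tau>"
      using r \<tau> mult_left_mono[OF ge_one_powr_ge_zero[of r \<tau>], of "\<bar>C0\<bar>"] by simp
    moreover have "c * r powr d \<le> 3 * (K * (1 + 2 * r) powr \<tau> + C0)"
      using bound[OF r] r by (simp add: powr_realpow)
    ultimately show "c * r powr d \<le> 3 * (K * 3 powr \<tau> + \<bar>C0\<bar>) * r powr \<tau>"
      by (simp add: distrib_right distrib_left mult_ac)
  qed (use c deg in \<open>auto simp: d_def\<close>)
qed

text \<open>Induction on the number of terms. Once all Wronskians against the \<open>k\<close>-th
  term vanish, each \<open>B j * exp (H j - H k)\<close> is a constant multiple of
  \<open>B k\<close>. As \<open>H j - H k\<close> has degree above \<open>\<tau>\<close>, this
  forces \<open>B j = 0\<close>, and the sum reduces to its \<open>k\<close>-th term.\<close>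

lemma borel_exp_sum:
  assumes "finite I" "\<tau> > 0"
    and "\<And>i. i \<in> I \<Longrightarrow> fin_type \<tau> (B i)"
    and "\<And>i j. i \<in> I \<Longrightarrow> j \<in> I \<Longrightarrow> i \<noteq> j \<Longrightarrow> real (degree (H i - H j)) > \<tau>"
    and "\<And>z. (\<Sum>i\<in>I. B i z * exp (poly (H i) z)) = 0"
    and "k \<in> I"
  shows "B k z = 0"
  using assms
proof (induction "card I" arbitrary: I B k z)
  case (Suc m)
  show ?case
  proof (rule ccontr)
    assume nz: "B k z \<noteq> 0"
    note holo = fin_type_holomorphic[OF Suc.prems(3)]
    \<comment> \<open>Wronskians with the \<open>k\<close>-th term: eliminating that term shortens the sum by one.\<close>
    define W where "W = (\<lambda>j z. deriv (B j) z * B k z - B j z * deriv (B k) z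
                        + B j z * B k z * (poly (pderiv (H j)) z - poly (pderiv (H k)) z))"
    have dB: "(B j has_field_derivative deriv (B j) z) (at z)" if "j \<in> I" for j z
      using holomorphic_derivI[OF holo[OF that] open_UNIV UNIV_I] .
    have W_ft: "fin_type \<tau> (W j)" if "j \<in> I" for j
      unfolding W_def using that Suc.prems \<open>\<tau> > 0\<close>
      by (intro fin_type_add fin_type_diff fin_type_mult fin_type_deriv fin_type_poly) auto
    have sumW: "(\<Sum>j\<in>I - {k}. W j z * exp (poly (H j) z)) = 0" for z
    proof -
      have "((\<lambda>z. \<Sum>i\<in>I. B i z * exp (poly (H i) z)) has_field_derivative
              (\<Sum>i\<in>I. (deriv (B i) z + B i z * poly (pderiv (H i)) z) * exp (poly (H i) z))) (at z)"
        by (intro DERIV_sum) (auto intro!: derivative_eq_intros dB poly_DERIV simp: algebra_simps)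
      moreover have "((\<lambda>z. \<Sum>i\<in>I. B i z * exp (poly (H i) z)) has_field_derivative 0) (at z)"
        by (simp add: Suc.prems(5))
      ultimately have S': "(\<Sum>i\<in>I. (deriv (B i) z + B i z * poly (pderiv (H i)) z) * exp (poly (H i) z)) = 0"
        by (rule DERIV_unique)
      have "(\<Sum>j\<in>I. W j z * exp (poly (H j) z)) =
              B k z * (\<Sum>i\<in>I. (deriv (B i) z + B i z * poly (pderiv (H i)) z) * exp (poly (H i) z))
              - (deriv (B k) z + B k z * poly (pderiv (H k)) z) * (\<Sum>i\<in>I. B i z * exp (poly (H i) z))"
        unfolding sum_distrib_left sum_subtractf[symmetric]
        by (intro sum.cong refl) (simp add: W_def algebra_simps)
      also have "\<dots> = 0" using S' Suc.prems(5)[of z] by simp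
      finally have "(\<Sum>j\<in>I. W j z * exp (poly (H j) z)) = 0" .
      moreover have "W k z = 0" by (simp add: W_def)
      ultimately show ?thesis using Suc.prems(1,6) by (simp add: sum.remove)
    qed
    have W0: "W j z = 0" if "j \<in> I - {k}" for j z
    proof (rule Suc.hyps(1)[of "I - {k}" W])
      show "m = card (I - {k})" using Suc.hyps(2) Suc.prems(1,6) by simp
    qed (use that Suc.prems W_ft sumW in auto)
    have B0: "B j w = 0" if j: "j \<in> I - {k}" for j w
    proof -
      have jI: "j \<in> I" "j \<noteq> k" using j by auto
      define F where "F = (\<lambda>z. B j z * exp (poly (H j - H k) z))"
      have dF: "(F has_field_derivative
          (deriv (B j) z + B j z * poly (pderiv (H j - H k)) z) * exp (poly (H j - H k) z)) (at z)" for z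
        unfolding F_def by (auto intro!: derivative_eq_intros dB jI poly_DERIV simp: algebra_simps pderiv_diff)
      have F_holo: "F holomorphic_on UNIV"
        unfolding F_def by (intro holomorphic_intros holo jI)
      obtain c where c: "\<And>z. F z = c * B k z"
      proof (rule wronskian_zero_imp_proportional[OF F_holo holo[OF Suc.prems(6)] nz])
        fix z
        show "deriv F z * B k z = F z * deriv (B k) z"
        proof -
          have "deriv F z * B k z - F z * deriv (B k) z = W j z * exp (poly (H j - H k) z)"
            by (simp only: DERIV_imp_deriv[OF dF]) (simp add: F_def W_def pderiv_diff algebra_simps)
          then show ?thesis using W0[OF j, of z] by simp
        qed
      qed metis
      show ?thesis
      proof (rule exp_poly_dominates[of \<tau> "B j" "\<lambda>z. c * B k z" "H j - H k"])
        show "fin_type \<tau> (\<lambda>z. c * B k z)"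
          using Suc.prems(3,6) \<open>\<tau> > 0\<close> by (intro fin_type_mult fin_type_const) auto
        show "B j z * exp (poly (H j - H k) z) = c * B k z" for z
          using c[of z] by (simp add: F_def)
      qed (use Suc.prems jI \<open>\<tau> > 0\<close> in auto)
    qed
    have "(\<Sum>i\<in>I. B i z * exp (poly (H i) z)) = B k z * exp (poly (H k) z)"
      using Suc.prems(1,6) B0 by (simp add: sum.remove)
    with Suc.prems(5)[of z] nz show False by simp
  qed
qed auto

section \<open>The Nevanlinna characteristic and vanishing of small functions\<close>


lemma log_plus_nonneg [simp]: "log_plus x \<ge> 0"
  by (simp add: log_plus_def)

lemma le_exp_log_plus: "x \<le> exp (log_plus x)"
  by (simp add: log_plus_def)

lemma log_plus_leI: "x \<le> exp y \<Longrightarrow> y \<ge> 0 \<Longrightarrow> log_plus x \<le> y"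
  unfolding log_plus_def by (metis exp_le_cancel_iff exp_ln exp_zero less_max_iff_disj max.bounded_iff zero_less_one)

lemma log_plus_eq_0: "x \<le> 1 \<Longrightarrow> log_plus x = 0"
  by (simp add: log_plus_def max_def)

lemma exp_log_plus: "x \<ge> 1 \<Longrightarrow> exp (log_plus x) = x"
  by (simp add: log_plus_def max_def)

lemma continuous_on_log_plus_norm:
  assumes "f holomorphic_on UNIV"
  shows "continuous_on S (\<lambda>z. log_plus (norm (f z)))"
  unfolding log_plus_def
  by (intro continuous_intros holomorphic_on_imp_continuous_on holomorphic_on_subset[OF assms]) auto

lemma nevanlinna_T_entire:
  assumes "f holomorphic_on UNIV"
  shows "nevanlinna_T r f = circle_mean r (\<lambda>z. log_plus (norm (f z)))"
proof -
  have "\<not> is_pole f z" for z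
    using not_is_pole_holomorphic[OF open_UNIV UNIV_I assms] .
  then have "pole_count r f = 0" for r by (simp add: pole_count_def)
  then show ?thesis
    by (simp add: nevanlinna_T_def nevanlinna_N_def nevanlinna_m_def circle_mean_def)
qed

lemma nevanlinna_T_entire_nonneg:
  assumes "f holomorphic_on UNIV" "r \<ge> 0"
  shows "nevanlinna_T r f \<ge> 0"
  unfolding nevanlinna_T_entire[OF assms(1)]
  by (intro circle_mean_nonneg continuous_on_log_plus_norm assms) auto

lemma nevanlinna_T_le:
  assumes "f holomorphic_on UNIV" "\<And>z. norm (f z) \<le> exp (C * (1 + norm z) powr \<sigma>)" "C \<ge> 0" "r \<ge> 0"
  shows "nevanlinna_T r f \<le> C * (1 + r) powr \<sigma>"
proof -
  have "nevanlinna_T r f \<le> circle_mean r (\<lambda>_. C * (1 + r) powr \<sigma>)"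
    unfolding nevanlinna_T_entire[OF assms(1)]
  proof (intro circle_mean_mono continuous_on_log_plus_norm assms continuous_on_const log_plus_leI)
    fix z :: complex assume "norm z = r"
    then show "norm (f z) \<le> exp (C * (1 + r) powr \<sigma>)" using assms(2)[of z] by simp
  qed (use assms in auto)
  then show ?thesis by simp
qed

text \<open>T(r) is a circle mean of a nonnegative majorant of ln |f|, so it bounds \<open>f\<close>
  pointwise at any radius comparable with r.\<close>

lemma growth_order_less_imp_fin_type:
  assumes f: "f holomorphic_on UNIV" and less: "growth_order f < ereal \<sigma>" and "\<sigma> \<ge> 0"
  shows "fin_type \<sigma> f"
proof -
  have "eventually (\<lambda>r. ereal (log_plus (nevanlinna_T r f) / ln r) < ereal \<sigma>) at_top"
    using less unfolding growth_order_def by (rule Limsup_lessD)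
  then obtain r0 where r0: "\<And>r. r \<ge> r0 \<Longrightarrow> log_plus (nevanlinna_T r f) / ln r < \<sigma>"
    by (auto simp: eventually_at_top_linorder)
  define R0 where "R0 = max 2 r0"
  have T: "nevanlinna_T r f \<le> r powr \<sigma>" if "r \<ge> R0" for r
  proof -
    have "ln r > 0" "r > 0" using that by (auto simp: R0_def)
    with r0[of r] that have "log_plus (nevanlinna_T r f) \<le> \<sigma> * ln r"
      by (simp add: R0_def field_simps)
    then have "exp (log_plus (nevanlinna_T r f)) \<le> r powr \<sigma>"
      using \<open>r > 0\<close> by (simp add: powr_def)
    with le_exp_log_plus show ?thesis by (rule order_trans)
  qed
  show ?thesis
  proof (rule fin_typeI[OF f])
    fix w :: complex
    \<comment> \<open>This radius exceeds twice |w|, so the Harnack factor is at most 3, is at least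
      \<open>R0\<close>, so the bound for T holds, and is proportional to 1 + |w|.\<close>
    define r where "r = R0 * (1 + norm w)"
    have R0: "R0 \<ge> 2" by (simp add: R0_def)
    have r: "r \<ge> 2 * norm w + 2" "r \<ge> R0"
      unfolding r_def using mult_right_mono[OF R0, of "1 + norm w"] R0 by (auto simp: mult_le_cancel_left1)
    have wr: "norm w < r" using r norm_ge_zero[of w] by linarith
    have Tn: "nevanlinna_T r f \<ge> 0"
      using r norm_ge_zero[of w] by (intro nevanlinna_T_entire_nonneg f) linarith
    have "norm (f w) \<le> exp ((r + norm w) / (r - norm w) * circle_mean r (\<lambda>z. log_plus (norm (f z))))"
      by (intro norm_le_exp_circle_mean f continuous_on_log_plus_norm le_exp_log_plus)
         (use wr in auto)
    also have "\<dots> = exp ((r + norm w) / (r - norm w) * nevanlinna_T r f)"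
      by (simp add: nevanlinna_T_entire[OF f])
    also have "(r + norm w) / (r - norm w) \<le> 3"
      using r wr by (simp add: divide_simps)
    then have "exp ((r + norm w) / (r - norm w) * nevanlinna_T r f) \<le> exp (3 * nevanlinna_T r f)"
      unfolding exp_le_cancel_iff by (rule mult_right_mono[OF _ Tn])
    also have "\<dots> \<le> exp (3 * r powr \<sigma>)" using T[OF r(2)] by simp
    also have "3 * r powr \<sigma> = (3 * R0 powr \<sigma>) * (1 + norm w) powr \<sigma>"
      using R0 by (simp add: r_def powr_mult)
    finally show "norm (f w) \<le> exp ((3 * R0 powr \<sigma>) * (1 + norm w) powr \<sigma>)" .
  qed
qed

lemma fin_type_imp_growth_order_le:
  assumes f: "fin_type \<sigma> f" and \<sigma>: "\<sigma> \<ge> 0"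
  shows "growth_order f \<le> ereal \<sigma>"
proof -
  obtain C where C: "C > 0" "\<And>z. norm (f z) \<le> exp (C * (1 + norm z) powr \<sigma>)"
    using fin_typeE[OF f] by metis
  define D where "D = max 1 C"
  have "growth_order f \<le> Limsup at_top (\<lambda>r. ereal ((ln D + \<sigma> * ln (1 + r)) / ln r))"
    unfolding growth_order_def
  proof (rule Limsup_mono)
    show "eventually (\<lambda>r. ereal (log_plus (nevanlinna_T r f) / ln r) \<le> ereal ((ln D + \<sigma> * ln (1 + r)) / ln r)) at_top"
      using eventually_gt_at_top[of 1]
    proof eventually_elim
      case (elim r)
      have "nevanlinna_T r f \<le> C * (1 + r) powr \<sigma>"
        using C elim by (intro nevanlinna_T_le fin_type_holomorphic[OF f]) auto
      also have "\<dots> \<le> D * (1 + r) powr \<sigma>"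
        by (intro mult_right_mono) (auto simp: D_def)
      also have "\<dots> = exp (ln D + \<sigma> * ln (1 + r))"
        using elim by (simp add: exp_add D_def powr_def)
      finally have "log_plus (nevanlinna_T r f) \<le> ln D + \<sigma> * ln (1 + r)"
        using elim \<sigma> by (intro log_plus_leI) (auto simp: D_def)
      then show ?case using elim by (simp add: divide_right_mono)
    qed
  qed
  also have "((\<lambda>r. (ln D + \<sigma> * ln (1 + r)) / ln r) \<longlongrightarrow> \<sigma>) at_top"
    by real_asymp
  then have "Limsup at_top (\<lambda>r. ereal ((ln D + \<sigma> * ln (1 + r)) / ln r)) = ereal \<sigma>"
    by (intro lim_imp_Limsup) auto
  finally show ?thesis .
qed

lemma growth_order_greater_imp_large_T:
  assumes "growth_order f > ereal \<tau>" "\<tau> \<ge> 0"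
  obtains r where "r \<ge> R" "nevanlinna_T r f > r powr \<tau>"
proof -
  have "\<exists>r\<ge>max R 2. log_plus (nevanlinna_T r f) / ln r > \<tau>"
  proof (rule ccontr)
    assume "\<not> ?thesis"
    then have "eventually (\<lambda>r. ereal (log_plus (nevanlinna_T r f) / ln r) \<le> ereal \<tau>) at_top"
      unfolding eventually_at_top_linorder by (intro exI[of _ "max R 2"]) (auto simp: not_less)
    then have "growth_order f \<le> ereal \<tau>" unfolding growth_order_def by (rule Limsup_bounded)
    with assms show False by simp
  qed
  then obtain r where r: "r \<ge> max R 2" "log_plus (nevanlinna_T r f) / ln r > \<tau>" by blast
  have l: "ln r > 0" "r > 0" using r by auto
  then have *: "log_plus (nevanlinna_T r f) > \<tau> * ln r" using r by (simp add: field_simps)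
  then have "log_plus (nevanlinna_T r f) > 0" using l assms(2) by (smt (verit) mult_nonneg_nonneg)
  then have "nevanlinna_T r f > 1" using log_plus_eq_0[of "nevanlinna_T r f"] by linarith
  then have "nevanlinna_T r f = exp (log_plus (nevanlinna_T r f))" by (simp add: exp_log_plus)
  also have "\<dots> > exp (\<tau> * ln r)" using * by simp
  finally show ?thesis using that[of r] r l by (simp add: powr_def)
qed

text \<open>Walk outwards from a radius where \<open>m\<close> is large in steps of length
  \<open>K\<close>. If every step gained a factor above \<open>1 + \<epsilon>\<close>, the growth
  would be exponential, against the bound by a power. The first step with a smaller gain gives the
  radius, and the earlier gains keep \<open>m\<close> above \<open>D * r\<close> there.\<close>

lemma slowly_increasing_radius:
  fixes m :: "real \<Rightarrow> real"
  assumes bound: "\<And>r. r \<ge> 0 \<Longrightarrow> m r \<le> C * (1 + r) powr \<rho>"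
    and large: "\<And>R. \<exists>r\<ge>R. m r > r powr \<tau>" and \<tau>: "\<tau> > 1" and K: "K > 0" and \<epsilon>: "\<epsilon> > 0" and D: "D > 0"
  obtains r where "r \<ge> 1" "m (r + K) \<le> (1 + \<epsilon>) * m r" "m r \<ge> D * r"
proof -
  \<comment> \<open>The summand \<open>K / \<epsilon>\<close> is tuned to Bernoulli's inequality: (1
    + j eps)(s + K / eps) is at least s + j K, the radius after j steps.\<close>
  have "filterlim (\<lambda>r. r powr \<tau> / (D * (r + K / \<epsilon>))) at_top (at_top :: real filter)"
    using \<tau> D K \<epsilon> by real_asymp
  then have "eventually (\<lambda>r. r powr \<tau> / (D * (r + K / \<epsilon>)) > 1) at_top"
    by (simp add: filterlim_at_top_dense)
  then obtain R where R: "\<And>r. r \<ge> R \<Longrightarrow> r powr \<tau> / (D * (r + K / \<epsilon>)) > 1"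
    by (auto simp: eventually_at_top_linorder)
  obtain s where s: "s \<ge> max 1 R" "m s > s powr \<tau>" using large by blast
  have "D * (s + K / \<epsilon>) > 0" using s D K \<epsilon> by (intro mult_pos_pos add_pos_pos) auto
  with R[of s] s have ms: "m s > D * (s + K / \<epsilon>)" by (simp add: field_simps)
  have ex: "\<exists>j. m (s + real (Suc j) * K) \<le> (1 + \<epsilon>) * m (s + real j * K)"
  proof (rule ccontr)
    assume "\<not> ?thesis"
    then have step: "m (s + real (Suc j) * K) > (1 + \<epsilon>) * m (s + real j * K)" for j
      by (auto simp: not_le)
    have "m (s + real j * K) \<ge> (1 + \<epsilon>) ^ j * m s" for j
    proof (induction j)
      case (Suc j)
      have "(1 + \<epsilon>) ^ Suc j * m s \<le> (1 + \<epsilon>) * m (s + real j * K)"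
        using mult_left_mono[OF Suc, of "1 + \<epsilon>"] \<epsilon> by simp
      with step[of j] show ?case by linarith
    qed simp
    then have *: "(1 + \<epsilon>) ^ j * m s \<le> C * (1 + (s + real j * K)) powr \<rho>" for j
      using bound[of "s + real j * K"] s K by (smt (verit) mult_nonneg_nonneg of_nat_0_le_iff)
    have "((\<lambda>x::real. C * (1 + (s + x * K)) powr \<rho> / (1 + \<epsilon>) powr x) \<longlongrightarrow> 0) at_top"
      using K \<epsilon> by real_asymp
    then have lim: "(\<lambda>j. C * (1 + (s + real j * K)) powr \<rho> / (1 + \<epsilon>) powr real j) \<longlonglongrightarrow> 0"
      by (rule filterlim_compose[OF _ filterlim_real_sequentially])
    have "m s > 0" using ms \<open>D * (s + K / \<epsilon>) > 0\<close> by linarith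
    then have "eventually (\<lambda>j. C * (1 + (s + real j * K)) powr \<rho> / (1 + \<epsilon>) powr real j < m s) sequentially"
      using order_tendstoD(2)[OF lim] by blast
    then obtain j where "C * (1 + (s + real j * K)) powr \<rho> / (1 + \<epsilon>) powr real j < m s"
      by (auto simp: eventually_at_top_linorder)
    with *[of j] \<epsilon> show False by (simp add: powr_realpow field_simps)
  qed
  define P where "P = (\<lambda>j. m (s + real (Suc j) * K) \<le> (1 + \<epsilon>) * m (s + real j * K))"
  \<comment> \<open>Minimality matters: all steps before \<open>j\<close> gain the full factor, so
    \<open>m\<close> at step \<open>j\<close> is at least
    \<open>(1 + \<epsilon>) ^ j * m s\<close>.\<close>
  define j where "j = (LEAST j. P j)"
  have j: "P j" "\<And>i. i < j \<Longrightarrow> \<not> P i"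
    using ex unfolding j_def P_def[symmetric] by (auto intro: LeastI_ex dest: not_less_Least)
  have "m (s + real i * K) \<ge> (1 + \<epsilon>) ^ i * m s" if "i \<le> j" for i
    using that
  proof (induction i)
    case (Suc i)
    have "(1 + \<epsilon>) ^ Suc i * m s \<le> (1 + \<epsilon>) * m (s + real i * K)"
      using mult_left_mono[of "(1 + \<epsilon>) ^ i * m s" "m (s + real i * K)" "1 + \<epsilon>"] Suc \<epsilon> by simp
    moreover have "\<not> P i" using j(2) Suc.prems by simp
    ultimately show ?case unfolding P_def by linarith
  qed simp
  then have "(1 + \<epsilon>) ^ j * m s \<le> m (s + real j * K)" by simp
  moreover have "(1 + real j * \<epsilon>) * (D * (s + K / \<epsilon>)) \<le> (1 + \<epsilon>) ^ j * m s"
    using Bernoulli_inequality[of \<epsilon> j] \<epsilon> ms \<open>D * (s + K / \<epsilon>) > 0\<close> by (intro mult_mono) auto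
  moreover have "(1 + real j * \<epsilon>) * (D * (s + K / \<epsilon>)) \<ge> D * (s + real j * K)"
  proof -
    have "(1 + real j * \<epsilon>) * (s + K / \<epsilon>) = s + K / \<epsilon> + real j * \<epsilon> * s + real j * K"
      using \<epsilon> by (simp add: field_simps)
    also have "\<dots> \<ge> s + real j * K" using s K \<epsilon> by simp
    finally show ?thesis using D by (simp add: mult.left_commute mult_left_mono)
  qed
  ultimately have "m (s + real j * K) \<ge> D * (s + real j * K)" by linarith
  moreover have "s + real (Suc j) * K = (s + real j * K) + K" by (simp add: algebra_simps)
  then have "m ((s + real j * K) + K) \<le> (1 + \<epsilon>) * m (s + real j * K)"
    using j(1) unfolding P_def by metis
  moreover have "s + real j * K \<ge> 1" using s K by (simp add: add_increasing2)
  ultimately show ?thesis by (intro that)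
qed

text \<open>
  With \<open>u = log\<^sup>+ \<bar>f\<bar>\<close> the two bounds combine to \<open>ln \<bar>\<Phi>\<bar> \<le> 3 v - 4 u + O(r)\<close>. The harmonic majorant \<open>v\<close> has
  mean below \<open>7/6 T(r)\<close> at a slowly increasing radius, so the mean of the right-hand side tends to \<open>-\<infinity>\<close>.
\<close>

lemma small_over_powers_imp_zero:
  fixes f \<Phi> :: "complex \<Rightarrow> complex"
  assumes f: "fin_type \<rho> f" and order: "growth_order f > 1" and \<Phi>: "\<Phi> holomorphic_on UNIV"
    and \<delta>: "\<delta> > 0" and m: "m \<ge> 2"
    and small: "\<And>z v. (\<And>w. dist z w \<le> \<delta> \<Longrightarrow> norm (f w) \<le> exp v) \<Longrightarrow> v \<ge> 0 \<Longrightarrow>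
                  norm (\<Phi> z) \<le> exp (3 * v + A * (1 + norm z))"
    and large: "\<And>z v. (\<And>w. dist z w \<le> \<delta> \<Longrightarrow> norm (f w) \<le> exp v) \<Longrightarrow> v \<ge> 0 \<Longrightarrow>
                  norm (\<Phi> z) * norm (f z) ^ m \<le> exp (v + A * (1 + norm z))"
  shows "\<Phi> z = 0"
proof (rule ccontr)
  assume nz: "\<Phi> z \<noteq> 0"
  note fh = fin_type_holomorphic[OF f, of UNIV]
  define u where "u = (\<lambda>z. log_plus (norm (f z)))"
  have u_cont: "continuous_on S u" for S
    unfolding u_def by (rule continuous_on_log_plus_norm[OF fh])
  define T where "T = (\<lambda>r. circle_mean r u)"
  have T_eq: "nevanlinna_T r f = T r" for r unfolding T_def u_def by (rule nevanlinna_T_entire[OF fh])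
  obtain C0 where C0: "\<And>r \<phi>. \<lbrakk>r \<ge> 1; continuous_on (sphere 0 r) \<phi>;
      \<And>z. norm z = r \<Longrightarrow> norm (\<Phi> z) \<le> exp (\<phi> z)\<rbrakk> \<Longrightarrow> - C0 \<le> circle_mean r \<phi>"
    using circle_mean_lower_bound[OF \<Phi>] nz by metis
  obtain C where C: "C > 0" "\<And>z. norm (f z) \<le> exp (C * (1 + norm z) powr \<rho>)"
    using fin_typeE[OF f] by metis
  obtain \<tau>' where \<tau>': "ereal 1 < ereal \<tau>'" "ereal \<tau>' < growth_order f"
    using order ereal_dense2[of 1 "growth_order f"] by (auto simp: one_ereal_def)
  define \<tau> where "\<tau> = \<tau>'"
  have \<tau>: "\<tau> > 1" "growth_order f > ereal \<tau>" using \<tau>' by (auto simp: \<tau>_def)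
  \<comment> \<open>Then the Harnack factor on discs of radius \<open>\<delta>\<close> is 26/24 =
    13/12.\<close>
  define K where "K = 25 * \<delta>"
  have K: "K > 0" using \<delta> by (simp add: K_def)
  \<comment> \<open>Half of T(r) survives in the final estimate; \<open>D\<close> is chosen so that
    it outweighs the linear error 2 |A| r, the additive constants and |C0|.\<close>
  define D where "D = 2 * (2 * \<bar>A\<bar> + 10 + \<bar>C0\<bar>)"
  \<comment> \<open>The growth factor 14/13 times the Harnack factor 13/12 is 7/6, and 3 * 7/6 = 7/2
    is still below 4.\<close>
  obtain r where r: "r \<ge> 1" "T (r + K) \<le> (1 + 1 / 13) * T r" "T r \<ge> D * r"
  proof (rule slowly_increasing_radius[of T C \<rho> \<tau> K "1 / 13" D])
    show "T r \<le> C * (1 + r) powr \<rho>" if "r \<ge> 0" for r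
      unfolding T_eq[symmetric] using C that by (intro nevanlinna_T_le fh) auto
    show "\<exists>r\<ge>R. T r > r powr \<tau>" for R
      using growth_order_greater_imp_large_T[OF \<tau>(2), of R] \<tau>(1) unfolding T_eq by (metis less_imp_le order_trans zero_le_one)
  qed (use \<tau> K in \<open>auto simp: D_def\<close>)
  obtain p where p: "\<And>z. norm z = r + K \<Longrightarrow> u z < Re (poly p z)" "Re (poly p 0) \<le> T (r + K) + 1"
    using Re_poly_majorant[OF u_cont, of 1 "r + K"] r K unfolding T_def by (metis add_nonneg_nonneg less_imp_le order_trans zero_le_one zero_less_one)
  have u_nonneg: "u z \<ge> 0" for z by (simp add: u_def)
  have p_nonneg: "Re (poly p z) \<ge> 0" if "norm z \<le> r + K" for z
  proof (rule Re_poly_nonneg[OF _ that])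
    show "0 \<le> Re (poly p z)" if "norm z = r + K" for z
      using p(1)[OF that] u_nonneg[of z] by linarith
  qed (use r K in auto)
  have f_le: "norm (f z) \<le> exp (Re (poly p z))" if "norm z \<le> r + K" for z
  proof (rule maximum_modulus_Re_poly[OF fh _ that])
    fix z :: complex assume "norm z = r + K"
    then have "exp (u z) \<le> exp (Re (poly p z))" using p(1)[of z] by simp
    with le_exp_log_plus show "norm (f z) \<le> exp (Re (poly p z))"
      unfolding u_def by (rule order_trans)
  qed (use r K in auto)
  define v where "v = (\<lambda>z. 13 / 12 * Re (poly p z))"
  have v: "norm (f w) \<le> exp (v z)" if z: "norm z = r" and w: "dist z w \<le> \<delta>" for z w
  proof -
    have in_ball: "norm y \<le> r + K" if "dist z y \<le> K" for y
      using that z norm_triangle_ineq[of z "y - z"] by (simp add: dist_norm norm_minus_commute)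
    have "Re (poly p w) \<le> (K + \<delta>) / (K - \<delta>) * Re (poly p z)"
      by (rule harnack[where G = "poly p"])
         (use w \<delta> in \<open>auto intro!: holomorphic_intros p_nonneg in_ball simp: K_def\<close>)
    also have "(K + \<delta>) / (K - \<delta>) = 13 / 12" using \<delta> by (simp add: K_def field_simps)
    finally have "Re (poly p w) \<le> v z" by (simp add: v_def)
    moreover have "norm (f w) \<le> exp (Re (poly p w))"
      using w \<delta> by (intro f_le in_ball) (auto simp: K_def)
    ultimately show ?thesis by (smt (verit) exp_le_cancel_iff)
  qed
  have v_nonneg: "v z \<ge> 0" if "norm z = r" for z
    using p_nonneg[of z] that K by (simp add: v_def)
  define \<psi> where "\<psi> = (\<lambda>z. 3 * v z - 4 * u z + A * (1 + r))"
  have "- C0 \<le> circle_mean r \<psi>"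
  proof (rule C0[OF r(1)])
    show "continuous_on (sphere 0 r) \<psi>"
      unfolding \<psi>_def v_def by (intro continuous_intros u_cont)
    fix z :: complex assume z: "norm z = r"
    show "norm (\<Phi> z) \<le> exp (\<psi> z)"
    proof (cases "norm (f z) \<le> 1")
      case True
      then have "u z = 0" by (simp add: u_def log_plus_eq_0)
      then show ?thesis using small[of z "v z"] v[OF z] v_nonneg[OF z] z by (simp add: \<psi>_def)
    next
      case False
      then have fu: "norm (f z) = exp (u z)" by (simp add: u_def exp_log_plus)
      have "norm (f z) \<le> exp (v z)" using v[OF z, of z] \<delta> by simp
      \<comment> \<open>Precisely what makes v - 2u at most 3v - 4u, the single continuous majorant
        that serves for both cases.\<close>
      then have uv: "u z \<le> v z" unfolding fu by simp
      have "norm (\<Phi> z) * exp (2 * u z) \<le> norm (\<Phi> z) * norm (f z) ^ m"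
        unfolding fu exp_of_nat_mult[symmetric] using m u_nonneg by (intro mult_left_mono) (auto intro!: mult_right_mono)
      also have "\<dots> \<le> exp (v z + A * (1 + r))" using large[of z "v z"] v[OF z] v_nonneg[OF z] z by simp
      finally have "norm (\<Phi> z) \<le> exp (v z - 2 * u z + A * (1 + r))"
        by (simp add: exp_add exp_diff field_simps)
      also have "\<dots> \<le> exp (\<psi> z)" using uv by (simp add: \<psi>_def)
      finally show ?thesis .
    qed
  qed
  also have "circle_mean r \<psi> = 3 * (13 / 12 * Re (poly p 0)) - 4 * T r + A * (1 + r)"
  proof -
    have c: "continuous_on (sphere 0 r) (\<lambda>z. Re (poly p z))" by (intro continuous_intros)
    have "circle_mean r \<psi> = circle_mean r (\<lambda>z. 3 * v z - 4 * u z) + A * (1 + r)"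
      unfolding \<psi>_def v_def using r by (subst circle_mean_add) (auto intro!: continuous_intros u_cont)
    also have "circle_mean r (\<lambda>z. 3 * v z - 4 * u z) = circle_mean r (\<lambda>z. 3 * v z) - circle_mean r (\<lambda>z. 4 * u z)"
      unfolding v_def using r by (intro circle_mean_diff) (auto intro!: continuous_intros u_cont)
    finally show ?thesis unfolding v_def circle_mean_cmult circle_mean_Re_poly T_def by simp
  qed
  also have "\<dots> \<le> 13 / 4 * (14 / 13 * T r + 1) - 4 * T r + A * (1 + r)"
    using p(2) r(2) by simp
  also have "\<dots> \<le> - (D * r) / 2 + 13 / 4 + \<bar>A\<bar> * (2 * r)"
  proof -
    have "A * (1 + r) \<le> \<bar>A\<bar> * (2 * r)" using r by (intro mult_mono) auto
    moreover have "13 / 4 * (14 / 13 * T r + 1) - 4 * T r = 13 / 4 - T r / 2" by (simp add: field_simps)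
    ultimately show ?thesis using r(3) by linarith
  qed
  also have "\<dots> = 13 / 4 - (10 + \<bar>C0\<bar>) * r" by (simp add: D_def field_simps)
  also have "\<dots> \<le> 13 / 4 - (10 + \<bar>C0\<bar>) * 1"
    using r(1) by (intro diff_left_mono mult_left_mono) auto
  finally have "- C0 \<le> 13 / 4 - 10 - \<bar>C0\<bar>" by simp
  then show False using abs_ge_self[of C0] by linarith
qed

section \<open>Order and degree of solutions\<close>


text \<open>With the coefficients as parameters the derivative is again of this form.\<close>

definition two_exp :: "complex \<Rightarrow> complex \<Rightarrow> complex \<Rightarrow> complex \<Rightarrow> complex \<Rightarrow> complex" where
  "two_exp p1 lam1 p2 lam2 z = p1 * exp (lam1 * z) + p2 * exp (lam2 * z)"

lemma fin_type_exp_linear: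
  assumes "\<tau> \<ge> 1"
  shows "fin_type \<tau> (\<lambda>z. exp (a * z))"
proof -
  have "fin_type \<tau> (\<lambda>z. exp (poly [:0, a:] z))"
    using assms by (intro fin_type_exp_poly) auto
  then show ?thesis by (simp add: mult.commute)
qed

lemma fin_type_two_exp: "\<tau> \<ge> 1 \<Longrightarrow> fin_type \<tau> (two_exp p1 lam1 p2 lam2)"
  unfolding two_exp_def[abs_def]
  by (intro fin_type_add fin_type_mult fin_type_const fin_type_exp_linear) auto

lemma DERIV_two_exp:
  "(two_exp p1 lam1 p2 lam2 has_field_derivative two_exp (lam1 * p1) lam1 (lam2 * p2) lam2 z) (at z)"
  unfolding two_exp_def[abs_def] by (auto intro!: derivative_eq_intros)

text \<open>At a multiple zero the two exponential terms solve a homogeneous linear system with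
  determinant \<open>lam2 - lam1\<close>, so both would vanish.\<close>

lemma two_exp_zero_simple:
  assumes "p1 \<noteq> 0" "lam1 \<noteq> lam2" "two_exp p1 lam1 p2 lam2 z = 0"
  shows "deriv (two_exp p1 lam1 p2 lam2) z \<noteq> 0"
proof
  assume "deriv (two_exp p1 lam1 p2 lam2) z = 0"
  then have "lam1 * p1 * exp (lam1 * z) + lam2 * p2 * exp (lam2 * z) = 0"
    using DERIV_imp_deriv[OF DERIV_two_exp, of p1 lam1 p2 lam2 z] by (simp add: two_exp_def)
  moreover have "p2 * exp (lam2 * z) = - (p1 * exp (lam1 * z))"
    using assms(3) by (simp add: two_exp_def eq_neg_iff_add_eq_0 add.commute)
  ultimately have "(lam1 - lam2) * (p1 * exp (lam1 * z)) = 0" by (simp add: algebra_simps)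
  then show False using assms by simp
qed

lemma two_exp_nonzero:
  assumes "p1 \<noteq> 0" "lam1 \<noteq> lam2"
  obtains w where "two_exp p1 lam1 p2 lam2 w \<noteq> 0"
proof -
  have "\<not> (\<forall>w. two_exp p1 lam1 p2 lam2 w = 0)"
  proof
    assume *: "\<forall>w. two_exp p1 lam1 p2 lam2 w = 0"
    then have "two_exp p1 lam1 p2 lam2 = (\<lambda>_. 0)" by auto
    then have "deriv (two_exp p1 lam1 p2 lam2) 0 = 0" by simp
    then show False using two_exp_zero_simple[OF assms, of p2 0] * by simp
  qed
  then show ?thesis using that by blast
qed

text \<open>The zeros solve exp ((lam1 - lam2) z) = - p2 / p1, whose solutions form an arithmetic
  progression.\<close>

lemma two_exp_infinite_zeros:
  assumes "p1 \<noteq> 0" "p2 \<noteq> 0" "lam1 \<noteq> lam2"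
  shows "infinite {z. two_exp p1 lam1 p2 lam2 z = 0}"
proof -
  define Z where "Z = (\<lambda>k::nat. (Ln (- p2 / p1) + 2 * of_real pi * \<i> * of_nat k) / (lam1 - lam2))"
  have "inj Z"
    using assms by (auto simp: inj_def Z_def)
  moreover have "two_exp p1 lam1 p2 lam2 (Z k) = 0" for k
  proof -
    have "exp ((lam1 - lam2) * Z k) = - p2 / p1"
    proof -
      have "(lam1 - lam2) * Z k = Ln (- p2 / p1) + 2 * of_real pi * \<i> * of_nat k"
        using assms by (simp add: Z_def)
      moreover have "exp (2 * of_real pi * \<i> * of_nat k) = 1"
        using exp_integer_2pi[of "of_nat k"] by (simp add: mult_ac)
      ultimately show ?thesis using assms by (simp add: exp_add)
    qed
    then have "exp (lam1 * Z k) = - p2 / p1 * exp (lam2 * Z k)"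
      by (simp add: left_diff_distrib exp_diff field_simps)
    then show ?thesis using assms by (simp add: two_exp_def field_simps)
  qed
  ultimately show ?thesis
    by (metis (mono_tags, lifting) finite_imageD finite_subset image_subsetI infinite_UNIV_nat mem_Collect_eq)
qed

lemma fin_type_1_common_bound:
  assumes "fin_type 1 A" "fin_type 1 B"
  obtains C where "C > 0" "\<And>z. norm (A z) \<le> exp (C * (1 + norm z))" "\<And>z. norm (B z) \<le> exp (C * (1 + norm z))"
proof -
  obtain C D where C: "C > 0" "\<And>z. norm (A z) \<le> exp (C * (1 + norm z) powr 1)"
     and D: "D > 0" "\<And>z. norm (B z) \<le> exp (D * (1 + norm z) powr 1)"
    using assms by (meson fin_typeE)
  show ?thesis
  proof (rule that[of "max C D"])
    show "norm (A z) \<le> exp (max C D * (1 + norm z))" for z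
      by (rule order_trans[OF C(2)]) (auto intro!: mult_right_mono)
    show "norm (B z) \<le> exp (max C D * (1 + norm z))" for z
      by (rule order_trans[OF D(2)]) (auto intro!: mult_right_mono)
  qed (use C D in auto)
qed

text \<open>Stated for abstract cofactors \<open>G\<close>, \<open>G1\<close> of \<open>f^m\<close>
  in \<open>F\<close> and its derivative, so that the cases \<open>\<omega> = 0\<close> and
  \<open>\<omega> \<noteq> 0\<close> share one proof. The hypothesis \<open>no_zero\<close> covers
  the degenerate case in which \<open>F\<close> vanishes identically.\<close>

lemma growth_order_le_1:
  fixes f F G G1 :: "complex \<Rightarrow> complex" and q Q :: "complex poly"
  assumes f: "fin_type \<rho> f" and nz: "f z0 \<noteq> 0" and m: "m \<ge> 2"
    and G: "G holomorphic_on UNIV" and G1: "G1 holomorphic_on UNIV"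
    and F: "\<And>z. F z = f z ^ m * G z"
    and F': "\<And>z. (F has_field_derivative f z ^ m * G1 z) (at z)"
    and b: "b \<ge> 1"
    and G_le: "\<And>z v. (\<And>w. dist z w \<le> 2 \<Longrightarrow> norm (f w) \<le> exp v) \<Longrightarrow> v \<ge> 0 \<Longrightarrow>
                  norm (G z) \<le> b * exp (2 * v) \<and> norm (G1 z) \<le> b * exp (2 * v)"
    and no_zero: "\<And>z. (\<And>w. G w = 0) \<Longrightarrow> f z \<noteq> 0"
    and q: "q \<noteq> 0"
    and eq: "\<And>z. F z + poly q z * exp (poly Q z) * f (z + c) = two_exp p1 lam1 p2 lam2 z"
    and p: "p1 \<noteq> 0" "p2 \<noteq> 0" "lam1 \<noteq> lam2"
  shows "growth_order f \<le> 1"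
proof (rule ccontr)
  assume "\<not> growth_order f \<le> 1"
  then have order: "growth_order f > 1" by simp
  note fh = fin_type_holomorphic[OF f, of UNIV]
  define g where "g = (\<lambda>z. f (z + c))"
  define P where "P = two_exp p1 lam1 p2 lam2"
  define P' where "P' = two_exp (lam1 * p1) lam1 (lam2 * p2) lam2"
  have dP: "(P has_field_derivative P' z) (at z)" for z
    unfolding P_def P'_def by (rule DERIV_two_exp)
  have gh: "g holomorphic_on UNIV"
    unfolding g_def by (intro holomorphic_on_compose_gen[OF _ fh, unfolded o_def] holomorphic_intros) auto
  have dg: "(g has_field_derivative deriv g z) (at z)" for z
    by (intro holomorphic_derivI[OF gh open_UNIV UNIV_I])
  define s where "s = pderiv q + q * pderiv Q"
  define L where "L = (\<lambda>z. poly s z * g z + poly q z * deriv g z)"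
  \<comment> \<open>By construction \<open>f^m * \<Phi>\<close> is q g F' - F L. The bound on
    \<open>\<Phi>\<close> involves three factors of the size of \<open>f\<close>, that on
    \<open>f^m * \<Phi>\<close> only one, since \<open>f\<close> enters the other side of the
    identity through \<open>g\<close> and \<open>deriv g\<close> alone.\<close>
  define \<Phi> where "\<Phi> = (\<lambda>z. poly q z * g z * G1 z - G z * L z)"
  define E where "E = (\<lambda>z. poly q z * exp (poly Q z) * g z)"
  have E: "E z = P z - F z" for z using eq[of z] by (simp add: E_def P_def g_def algebra_simps)
  have dE: "(E has_field_derivative exp (poly Q z) * L z) (at z)" for z
    unfolding E_def L_def s_def
    by (auto intro!: derivative_eq_intros dg poly_DERIV simp: algebra_simps)
  have E_holo: "E holomorphic_on UNIV" unfolding E_def by (intro holomorphic_intros gh)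
  have P_holo: "P holomorphic_on UNIV" using dP by (auto simp: holomorphic_on_open)
  have id: "f z ^ m * \<Phi> z = poly q z * g z * P' z - P z * L z" for z
  proof -
    have "(E has_field_derivative P' z - f z ^ m * G1 z) (at z)"
      unfolding E by (intro derivative_intros dP F')
    then have "exp (poly Q z) * L z = P' z - f z ^ m * G1 z" using DERIV_unique[OF dE] by simp
    \<comment> \<open>Multiplying by \<open>q g\<close> turns the exponential on the left into
      \<open>E = P - F\<close>, which eliminates \<open>exp Q\<close>.\<close>
    then have "poly q z * g z * (P' z - f z ^ m * G1 z) = (P z - F z) * L z"
      using E[of z] by (metis E_def mult.assoc mult.commute)
    then show ?thesis by (simp add: \<Phi>_def F algebra_simps)
  qed
  obtain A where A: "A > 0" "\<And>z. norm (poly q z) \<le> exp (A * (1 + norm z))"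
      "\<And>z. norm (poly s z) \<le> exp (A * (1 + norm z))"
    using fin_type_1_common_bound[OF fin_type_poly fin_type_poly] by (metis zero_less_one)
  obtain B where B: "B > 0" "\<And>z. norm (P z) \<le> exp (B * (1 + norm z))" "\<And>z. norm (P' z) \<le> exp (B * (1 + norm z))"
    using fin_type_1_common_bound[OF fin_type_two_exp fin_type_two_exp]
    unfolding P_def P'_def by (metis order_refl)
  define K where "K = 3 * b + A + B"
  have three: "3 * b \<le> exp (3 * b * (1 + norm z))" for z :: complex
  proof -
    have "3 * b \<le> exp (3 * b)" using exp_ge_add_one_self[of "3 * b"] by linarith
    also have "\<dots> \<le> exp (3 * b * (1 + norm z))" using b by simp
    finally show ?thesis .
  qed
  have g_le: "norm (g z) \<le> exp v" "norm (L z) \<le> 2 * exp (A * (1 + norm z)) * exp v"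
    if "\<And>w. dist z w \<le> norm c + 2 \<Longrightarrow> norm (f w) \<le> exp v" for z v
  proof -
    show 1: "norm (g z) \<le> exp v" unfolding g_def by (rule that) (simp add: dist_norm)
    have 2: "norm (deriv g z) \<le> exp v"
    proof (rule norm_deriv_le[OF gh])
      fix w assume w: "norm (w - z) = 1"
      have "dist z (w + c) \<le> norm c + 2"
        using norm_triangle_ineq[of "w - z" c] w by (simp add: dist_norm norm_minus_commute algebra_simps)
      then show "norm (g w) \<le> exp v" unfolding g_def by (rule that)
    qed
    have "norm (L z) \<le> norm (poly s z) * norm (g z) + norm (poly q z) * norm (deriv g z)"
      unfolding L_def using norm_triangle_ineq[of "poly s z * g z" "poly q z * deriv g z"] by (simp add: norm_mult)
    also have "\<dots> \<le> exp (A * (1 + norm z)) * exp v + exp (A * (1 + norm z)) * exp v"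
      by (intro add_mono mult_mono A 1 2) auto
    finally show "norm (L z) \<le> 2 * exp (A * (1 + norm z)) * exp v" by (simp add: mult_ac)
  qed
  have \<Phi>0: "\<Phi> z = 0" for z
  proof (rule small_over_powers_imp_zero[OF f order _ _ m, where \<Phi> = \<Phi> and \<delta> = "norm c + 2" and A = K])
    show "\<Phi> holomorphic_on UNIV"
      unfolding \<Phi>_def L_def by (intro holomorphic_intros gh G G1 holomorphic_deriv open_UNIV)
    show "norm c + 2 > 0" by (simp add: add_nonneg_pos)
    fix z :: complex and v :: real
    assume fv: "\<And>w. dist z w \<le> norm c + 2 \<Longrightarrow> norm (f w) \<le> exp v" and v: "v \<ge> 0"
    note gL = g_le[OF fv]
    let ?a = "exp (A * (1 + norm z))" and ?p = "exp (B * (1 + norm z))"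
    have GG: "norm (G z) \<le> b * exp (2 * v)" "norm (G1 z) \<le> b * exp (2 * v)"
      using G_le[of z v] fv v by (auto simp: add_increasing)
    have "norm (\<Phi> z) \<le> norm (poly q z) * norm (g z) * norm (G1 z) + norm (G z) * norm (L z)"
      unfolding \<Phi>_def using norm_triangle_ineq4[of "poly q z * g z * G1 z" "G z * L z"] by (simp add: norm_mult)
    also have "\<dots> \<le> ?a * exp v * (b * exp (2 * v)) + b * exp (2 * v) * (2 * ?a * exp v)"
      using b by (intro add_mono mult_mono A GG gL) auto
    also have "\<dots> = 3 * b * ?a * (exp v * exp (2 * v))" by simp
    also have "exp v * exp (2 * v) = exp (3 * v)" by (simp flip: exp_add)
    also have "3 * b * ?a * exp (3 * v) \<le> exp (3 * b * (1 + norm z)) * ?a * exp (3 * v)"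
      by (intro mult_right_mono three) auto
    also have "\<dots> = exp (3 * v + (3 * b + A) * (1 + norm z))" by (simp add: distrib_right exp_add)
    also have "\<dots> \<le> exp (3 * v + K * (1 + norm z))"
      using B(1) by (simp add: K_def distrib_right)
    finally show "norm (\<Phi> z) \<le> exp (3 * v + K * (1 + norm z))" .
    have "norm (\<Phi> z) * norm (f z) ^ m = norm (f z ^ m * \<Phi> z)" by (simp add: norm_mult norm_power)
    also have "\<dots> \<le> norm (poly q z) * norm (g z) * norm (P' z) + norm (P z) * norm (L z)"
      unfolding id using norm_triangle_ineq4[of "poly q z * g z * P' z" "P z * L z"] by (simp add: norm_mult)
    also have "\<dots> \<le> ?a * exp v * ?p + ?p * (2 * ?a * exp v)"
      by (intro add_mono mult_mono A B gL) auto
    also have "\<dots> = 3 * 1 * (?a * ?p * exp v)" by simp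
    also have "\<dots> \<le> 3 * b * (?a * ?p * exp v)" using b by (intro mult_right_mono mult_left_mono) auto
    also have "\<dots> \<le> exp (3 * b * (1 + norm z)) * (?a * ?p * exp v)"
      by (intro mult_right_mono three) auto
    also have "\<dots> = exp (v + K * (1 + norm z))" by (simp add: K_def distrib_right exp_add)
    finally show "norm (\<Phi> z) * norm (f z) ^ m \<le> exp (v + K * (1 + norm z))" .
  qed
  obtain w where "P w \<noteq> 0" using two_exp_nonzero[OF p(1,3)] unfolding P_def by metis
  then obtain k where k: "\<And>z. E z = k * P z"
  proof (rule wronskian_zero_imp_proportional[OF E_holo P_holo])
    fix z
    \<comment> \<open>With \<open>\<Phi> = 0\<close> the identity says that the Wronskian of
      \<open>E\<close> and \<open>P\<close> vanishes.\<close>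
    have "exp (poly Q z) * L z * P z = poly q z * exp (poly Q z) * g z * P' z"
      using id[of z] \<Phi>0[of z] by (simp add: mult_ac)
    then show "deriv E z * P z = E z * deriv P z"
      by (simp only: DERIV_imp_deriv[OF dE] DERIV_imp_deriv[OF dP]) (simp add: E_def)
  qed metis
  \<comment> \<open>Every zero of \<open>P\<close> is a zero of \<open>E\<close>. If
    \<open>f\<close> had none, these would all be among the finitely many zeros of
    \<open>q\<close>.\<close>
  have "\<exists>z. f z = 0"
  proof (rule ccontr)
    assume *: "\<not> ?thesis"
    have "{z. two_exp p1 lam1 p2 lam2 z = 0} \<subseteq> {z. poly q z = 0}"
    proof safe
      fix z assume "two_exp p1 lam1 p2 lam2 z = 0"
      then have "E z = 0" using k[of z] by (simp add: P_def)
      then show "poly q z = 0" using * by (simp add: E_def g_def)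
    qed
    then show False
      using two_exp_infinite_zeros[OF p] poly_roots_finite[OF q] finite_subset by blast
  qed
  then obtain y where y: "f y = 0" by blast
  have Fk: "F z = (1 - k) * P z" for z using E[of z] k[of z] by (simp add: algebra_simps)
  show False
  \<comment> \<open>Here F = (1 - k) P. For k = 1 the function \<open>F\<close>, hence
    \<open>G\<close>, vanishes identically. Otherwise a zero of \<open>f\<close> is a zero of both
    \<open>F\<close> and its derivative, as both contain \<open>f^m\<close>, hence a multiple zero
    of \<open>P\<close>.\<close>
  proof (cases "k = 1")
    case True
    then have "G z * f z ^ m = 0" for z using Fk[of z] F[of z] by (simp add: mult.commute)
    then have "G w = 0" for w
      using entire_mult_eq_0[OF G, of "\<lambda>z. f z ^ m" z0 w] nz by (auto intro!: holomorphic_intros fh)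
    then show False using no_zero y by blast
  next
    case False
    have m0: "m \<noteq> 0" using m by simp
    have "P y = 0" using Fk[of y] F[of y] y m0 False by (auto simp: power_0_left)
    moreover have "deriv P y = 0"
    proof -
      have "((\<lambda>z. (1 - k) * P z) has_field_derivative (1 - k) * P' y) (at y)"
        by (intro DERIV_cmult dP)
      then have "(F has_field_derivative (1 - k) * P' y) (at y)" using ext[of F "\<lambda>z. (1 - k) * P z", OF Fk] by simp
      then have "(1 - k) * P' y = f y ^ m * G1 y" using F'[of y] by (rule DERIV_unique)
      then show ?thesis using y m0 False DERIV_imp_deriv[OF dP, of y] by (simp add: power_0_left)
    qed
    ultimately show False using two_exp_zero_simple[OF p(1,3)] unfolding P_def by blast
  qed
qed

text \<open>The four exponents may coincide. Indexing the sum by the set of their values merges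
  equal ones, and distinct values give linear exponents whose difference has degree 1 >
  \<open>\<tau>\<close>. Choosing \<open>a\<close> then reads off the total coefficient of one
  exponential.\<close>

lemma borel_four_exp:
  fixes B1 B2 B3 B4 :: "complex \<Rightarrow> complex"
  assumes B: "fin_type \<tau> B1" "fin_type \<tau> B2" "fin_type \<tau> B3" "fin_type \<tau> B4" and \<tau>: "0 < \<tau>" "\<tau> < 1"
    and eq: "\<And>z. B1 z * exp (a1 * z) + B2 z * exp (a2 * z) + B3 z * exp (a3 * z) + B4 z * exp (a4 * z) = 0"
  shows "(if a = a1 then B1 z else 0) + (if a = a2 then B2 z else 0)
         + (if a = a3 then B3 z else 0) + (if a = a4 then B4 z else 0) = 0"
proof (cases "a \<in> {a1, a2, a3, a4}")
  case True
  define B where "B = (\<lambda>a z. (if a = a1 then B1 z else 0) + (if a = a2 then B2 z else 0)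
         + (if a = a3 then B3 z else 0) + (if a = a4 then B4 z else 0))"
  have if_fin: "fin_type \<tau> (\<lambda>z. if P then A z else 0)" if "fin_type \<tau> A" for P A
    using that \<tau> by (cases P) (auto intro: fin_type_const)
  have "B a z = 0"
  proof (rule borel_exp_sum[where B = B and I = "{a1, a2, a3, a4}" and H = "\<lambda>a. [:0, a:]"])
    show "fin_type \<tau> (B i)" for i
      unfolding B_def using \<tau> by (intro fin_type_add if_fin assms) auto
    show "\<tau> < real (degree ([:0, i:] - [:0, j:]))" if "i \<noteq> j" for i j :: complex
      using that \<tau> by simp
    fix z
    have if_mult: "(if P then x else 0) * y = (if P then x * y else 0)" for P and x y :: complex by simp
    have "(\<Sum>i\<in>{a1, a2, a3, a4}. B i z * exp (poly [:0, i:] z)) =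
       (\<Sum>i\<in>{a1, a2, a3, a4}. (if i = a1 then B1 z * exp (a1 * z) else 0) + (if i = a2 then B2 z * exp (a2 * z) else 0)
         + (if i = a3 then B3 z * exp (a3 * z) else 0) + (if i = a4 then B4 z * exp (a4 * z) else 0))"
      by (intro sum.cong refl) (auto simp: B_def algebra_simps)
    also have "\<dots> = 0"
      unfolding sum.distrib using eq[of z] by (subst (1 2 3 4) sum.delta) auto
    finally show "(\<Sum>i\<in>{a1, a2, a3, a4}. B i z * exp (poly [:0, i:] z)) = 0" .
  qed (use True \<tau> in auto)
  then show ?thesis by (simp add: B_def)
qed auto

text \<open>If \<open>Q\<close> had degree at least 2 > \<open>\<tau>\<close>, then exp Q would
  outgrow every other term, so its coefficient q(z) f(z + c) would vanish.\<close>

lemma degree_1_of_order_le_1: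
  fixes f F :: "complex \<Rightarrow> complex" and q Q :: "complex poly"
  assumes f: "fin_type \<tau> f" and F: "fin_type \<tau> F" and \<tau>: "1 \<le> \<tau>" "\<tau> < 2" and nz: "f z0 \<noteq> 0" and q: "q \<noteq> 0"
    and Q: "degree Q > 0"
    and eq: "\<And>z. F z + poly q z * exp (poly Q z) * f (z + c) = two_exp p1 lam1 p2 lam2 z"
  shows "degree Q = 1"
proof (rule ccontr)
  assume "degree Q \<noteq> 1"
  then have deg: "degree Q \<ge> 2" using Q by simp
  have "f (z + c) * poly q z = 0" for z
    unfolding mult.commute[of "f _"]
  proof (rule exp_poly_dominates[where A = "\<lambda>z. poly q z * f (z + c)"])
    show "fin_type \<tau> (\<lambda>z. poly q z * f (z + c))"
      using \<tau> by (intro fin_type_mult fin_type_poly fin_type_shift f) auto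
    show "fin_type \<tau> (\<lambda>z. two_exp p1 lam1 p2 lam2 z - F z)"
      using \<tau> by (intro fin_type_diff fin_type_two_exp F) auto
    show "poly q z * f (z + c) * exp (poly Q z) = two_exp p1 lam1 p2 lam2 z - F z" for z
      using eq[of z] by (simp add: algebra_simps)
    show "\<tau> < real (degree Q)" using deg \<tau> by linarith
  qed (use \<tau> in auto)
  moreover obtain w where "poly q w \<noteq> 0" using q poly_all_0_iff_0[of q] by blast
  ultimately have "f (z + c) = 0" for z
    by (intro entire_mult_eq_0[of "\<lambda>z. f (z + c)" "poly q"])
       (use \<tau> in \<open>auto intro!: fin_type_holomorphic[OF fin_type_shift[OF f]] holomorphic_intros\<close>)
  from this[of "z0 - c"] show False using nz by simp
qed

text \<open>For order below 1 the functions \<open>f\<close> and \<open>F\<close> count as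
  coefficients, and the equation is a sum of exponentials with exponents a, lam1, lam2 and 0, where
  a is the slope of \<open>Q\<close>.\<close>

lemma growth_order_ge_1:
  fixes f F :: "complex \<Rightarrow> complex" and q Q :: "complex poly"
  assumes f: "f holomorphic_on UNIV" and F: "\<And>\<tau>. \<tau> > 0 \<Longrightarrow> fin_type \<tau> f \<Longrightarrow> fin_type \<tau> F"
    and Q: "degree Q = 1" and p: "p1 \<noteq> 0" "p2 \<noteq> 0" "lam1 \<noteq> lam2" "lam1 \<noteq> 0" "lam2 \<noteq> 0"
    and eq: "\<And>z. F z + poly q z * exp (poly Q z) * f (z + c) = two_exp p1 lam1 p2 lam2 z"
  shows "growth_order f \<ge> 1"
proof (rule ccontr)
  assume "\<not> ?thesis"
  then have "growth_order f < 1" by simp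
  \<comment> \<open>The maximum with 0 makes the intermediate exponent positive.\<close>
  then have "max (growth_order f) 0 < 1" by simp
  then obtain \<tau> where "max (growth_order f) 0 < ereal \<tau>" "ereal \<tau> < 1"
    using ereal_dense2 by blast
  then have \<tau>: "growth_order f < ereal \<tau>" "0 < \<tau>" "\<tau> < 1" by auto
  have f_ft: "fin_type \<tau> f" using growth_order_less_imp_fin_type[OF f \<tau>(1)] \<tau>(2) by simp
  obtain a b where Qba: "Q = [:b, a:]"
    by (rule degree1_coeffs[OF Q])
  have *: "(if x = a then poly q z * f (z + c) * exp b else 0) + (if x = lam1 then - p1 else 0)
         + (if x = lam2 then - p2 else 0) + (if x = 0 then F z else 0) = 0" for x z
  proof (rule borel_four_exp[of \<tau> "\<lambda>z. poly q z * f (z + c) * exp b" "\<lambda>_. - p1" "\<lambda>_. - p2" F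
        a lam1 lam2 0 x z])
    have "fin_type \<tau> (poly q)" "fin_type \<tau> (\<lambda>z. f (z + c))" "fin_type \<tau> (\<lambda>z. exp b)"
      using \<tau> f_ft by (simp_all add: fin_type_poly fin_type_shift fin_type_const)
    then show "fin_type \<tau> (\<lambda>z. poly q z * f (z + c) * exp b)"
      by (intro fin_type_mult)
    show "poly q z * f (z + c) * exp b * exp (a * z) + - p1 * exp (lam1 * z) + - p2 * exp (lam2 * z)
            + F z * exp (0 * z) = 0" for z
      using eq[of z] by (simp add: two_exp_def Qba exp_add algebra_simps)
    show "fin_type \<tau> (\<lambda>_. - p1)" "fin_type \<tau> (\<lambda>_. - p2)" "fin_type \<tau> F"
      using \<tau> f_ft F by (auto intro: fin_type_const)
  qed (use \<tau> in auto)
  \<comment> \<open>The coefficient \<open>- p1\<close> must be cancelled; \<open>lam1\<close>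
    differs from \<open>lam2\<close> and from 0, so only the term with exponent \<open>a\<close> can
    do it. The same holds for \<open>lam2\<close>.\<close>
  have "lam1 = a" using *[of lam1 0] p by (auto split: if_splits)
  moreover have "lam2 = a" using *[of lam2 0] p by (auto split: if_splits)
  ultimately show False using p by simp
qed

section \<open>Zeros and canonical products\<close>


text \<open>This is n(r, 1/f), expressed by zeros of \<open>f\<close> instead of poles of its
  reciprocal.\<close>

definition zero_count :: "(complex \<Rightarrow> complex) \<Rightarrow> real \<Rightarrow> nat" where
  "zero_count f r = (\<Sum>z\<in>{z. norm z \<le> r \<and> f z = 0}. nat (zorder f z))"

lemma entire_eventually_nonzero:
  assumes "f holomorphic_on UNIV" "f z0 \<noteq> 0"
  shows "eventually (\<lambda>w. f w \<noteq> 0) (at z)"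
  using non_zero_neighbour_alt[OF assms(1) open_UNIV connected_UNIV UNIV_I UNIV_I assms(2), of z]
  by simp

lemma entire_analytic: "f holomorphic_on UNIV \<Longrightarrow> f analytic_on {z}"
  by (auto simp: analytic_at)

lemma entire_zorder_pos:
  assumes "f holomorphic_on UNIV" "f z0 \<noteq> 0"
  shows "zorder f z > 0 \<longleftrightarrow> f z = 0"
  using entire_eventually_nonzero[OF assms, of z] eventually_frequently[of "at z" "\<lambda>w. f w \<noteq> 0"]
  by (intro zorder_pos_iff'[OF entire_analytic[OF assms(1)]]) auto

lemma entire_finite_zeros:
  assumes "f holomorphic_on UNIV" "f z0 \<noteq> 0"
  shows "finite {z. norm z \<le> r \<and> f z = 0}"
proof (cases "f constant_on UNIV")
  case True
  then have "f z \<noteq> 0" for z using assms(2) by (metis UNIV_I constant_on_def)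
  then show ?thesis by simp
next
  case False
  then have "finite {z \<in> cball 0 r. f z = 0}"
    by (intro holomorphic_compact_finite_zeros[OF assms(1)]) auto
  then show ?thesis by simp
qed

lemma is_pole_reciprocal_iff:
  assumes "f holomorphic_on UNIV" "f z0 \<noteq> 0"
  shows "is_pole (\<lambda>z. 1 / f z) z \<longleftrightarrow> f z = 0"
proof
  have cont: "isCont f z"
    using assms(1) by (simp add: analytic_at_imp_isCont entire_analytic)
  show "is_pole (\<lambda>z. 1 / f z) z" if "f z = 0"
  proof (rule is_pole_divide)
    show "filterlim f (at 0) (at z)"
      using cont that entire_eventually_nonzero[OF assms] by (auto simp: filterlim_at isCont_def)
  qed auto
  show "f z = 0" if "is_pole (\<lambda>z. 1 / f z) z"
  proof (rule ccontr)
    assume "f z \<noteq> 0"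
    then have "(\<lambda>z. 1 / f z) analytic_on {z}"
      by (intro analytic_intros entire_analytic assms) auto
    then show False using that
      by (metis analytic_at not_is_pole_holomorphic)
  qed
qed

lemma zorder_reciprocal:
  assumes "f holomorphic_on UNIV" "f z0 \<noteq> 0"
  shows "zorder (\<lambda>z. 1 / f z) z = - zorder f z"
proof -
  have "frequently (\<lambda>w. f w \<noteq> 0) (at z)"
    using entire_eventually_nonzero[OF assms] by (intro eventually_frequently) auto
  then show ?thesis
    using zorder_inverse[of f z] assms(1)
    by (simp add: inverse_eq_divide isolated_singularity_at_analytic not_essential_analytic entire_analytic)
qed

lemma pole_count_reciprocal:
  assumes "f holomorphic_on UNIV" "f z0 \<noteq> 0"
  shows "pole_count r (\<lambda>z. 1 / f z) = zero_count f r"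
  unfolding pole_count_def zero_count_def is_pole_reciprocal_iff[OF assms] zorder_reciprocal[OF assms] by simp

lemma zero_count_mono:
  assumes "f holomorphic_on UNIV" "f z0 \<noteq> 0" "r \<le> s"
  shows "zero_count f r \<le> zero_count f s"
  unfolding zero_count_def
  by (intro sum_mono2 entire_finite_zeros[OF assms(1,2)]) (use assms(3) in auto)

text \<open>On [r, 2r] the integrand of N is at least its numerator at r divided by 2r, and
  elsewhere it is nonnegative. The logarithmic term is nonnegative because 2r exceeds 1.\<close>

lemma nevanlinna_N_lower:
  assumes f: "f holomorphic_on UNIV" "f z0 \<noteq> 0" and r: "r \<ge> 1"
  shows "(real (zero_count f r) - real (zero_count f 0)) / 2 \<le> nevanlinna_N (2 * r) (\<lambda>z. 1 / f z)"
proof -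
  define n where "n = (\<lambda>t. real (zero_count f t) - real (zero_count f 0))"
  have mono: "n s \<le> n t" if "s \<le> t" for s t
    using zero_count_mono[OF f that] by (simp add: n_def)
  have n0: "n 0 = 0" by (simp add: n_def)
  have nonneg: "n t \<ge> 0" if "t \<ge> 0" for t using mono[OF that] n0 by simp
  have "eventually (\<lambda>w. f w \<noteq> 0) (at 0)" by (rule entire_eventually_nonzero[OF f])
  then obtain e where e: "e > 0" "\<And>w. w \<noteq> 0 \<Longrightarrow> norm w < e \<Longrightarrow> f w \<noteq> 0"
    by (auto simp: eventually_at)
  define d where "d = min (e / 2) r"
  have d: "0 < d" "d < e" "d \<le> r" using e r by (auto simp: d_def)
  have small: "n t = 0" if "0 \<le> t" "t \<le> d" for t
  proof -
    have "{z. norm z \<le> t \<and> f z = 0} = {z. norm z \<le> 0 \<and> f z = 0}"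
      using that e d by force
    then show ?thesis by (simp add: n_def zero_count_def)
  qed
  have int: "(\<lambda>t. n t / t) integrable_on {a..2 * r}" if "0 < a" "a \<le> 2 * r" for a
  proof -
    have "(\<lambda>t::real. 1 / t) integrable_on {a..2 * r}"
      using that by (intro integrable_continuous_interval continuous_intros) auto
    \<comment> \<open>\<open>n\<close> is monotone but has jumps; the second mean value theorem
      supplies integrability of its product with the continuous 1/t. Near 0 the integrand vanishes
      instead.\<close>
    then have "(\<lambda>t. n t * (1 / t)) integrable_on {a..2 * r}"
    proof (rule second_mean_value_theorem_full[where g = n])
      fix c
      assume "((\<lambda>t. n t * (1 / t)) has_integral
        (n a * integral {a..c} (\<lambda>t. 1 / t) + n (2 * r) * integral {c..2 * r} (\<lambda>t. 1 / t))) {a..2 * r}"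
      then show ?thesis by (rule has_integral_integrable)
    qed (use that mono in auto)
    then show ?thesis by simp
  qed
  have int0: "((\<lambda>t. n t / t) has_integral 0) {0..d}"
    by (rule has_integral_is_0) (use small in auto)
  have int_d: "(\<lambda>t. n t / t) integrable_on {d..2 * r}" by (intro int) (use d r in auto)
  have int_r: "(\<lambda>t. n t / t) integrable_on {r..2 * r}" by (intro int) (use r in auto)
  have "(\<lambda>t. n t / t) integrable_on {0..2 * r}"
    by (rule Henstock_Kurzweil_Integration.integrable_combine[OF _ _ has_integral_integrable[OF int0] int_d])
       (use d r in auto)
  then have "integral {0..2 * r} (\<lambda>t. n t / t) = integral {0..d} (\<lambda>t. n t / t) + integral {d..2 * r} (\<lambda>t. n t / t)"
    using Henstock_Kurzweil_Integration.integral_combine[of 0 d "2 * r" "\<lambda>t. n t / t"] d r by linarith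
  also have "integral {0..d} (\<lambda>t. n t / t) = 0" using int0 by (rule integral_unique)
  also have "integral {d..2 * r} (\<lambda>t. n t / t) = integral {d..r} (\<lambda>t. n t / t) + integral {r..2 * r} (\<lambda>t. n t / t)"
    using Henstock_Kurzweil_Integration.integral_combine[OF _ _ int_d, of r] d r by linarith
  finally have "integral {0..2 * r} (\<lambda>t. n t / t) = integral {d..r} (\<lambda>t. n t / t) + integral {r..2 * r} (\<lambda>t. n t / t)"
    by simp
  moreover have "integral {d..r} (\<lambda>t. n t / t) \<ge> 0"
  proof (rule Henstock_Kurzweil_Integration.integral_nonneg)
    show "(\<lambda>t. n t / t) integrable_on {d..r}"
      by (rule integrable_subinterval_real[OF int_d]) (use r in auto)
    show "0 \<le> n t / t" if "t \<in> {d..r}" for t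
      using that d nonneg[of t] by simp
  qed
  moreover have "integral {r..2 * r} (\<lambda>t. n t / t) \<ge> integral {r..2 * r} (\<lambda>t. n r / (2 * r))"
  proof (rule integral_le)
    fix t assume t: "t \<in> {r..2 * r}"
    then show "n r / (2 * r) \<le> n t / t"
      using r nonneg[of r] mono[of r t] by (intro frac_le) auto
  qed (use int_r in auto)
  moreover have "integral {r..2 * r} (\<lambda>t. n r / (2 * r)) = n r / 2" using r by simp
  ultimately have "integral {0..2 * r} (\<lambda>t. n t / t) \<ge> n r / 2" by linarith
  moreover have "real (zero_count f 0) * ln (2 * r) \<ge> 0" using r by simp
  ultimately show ?thesis
    unfolding nevanlinna_N_def pole_count_reciprocal[OF f] n_def by linarith
qed

lemma zero_exponent_less_imp_zero_count:
  assumes f: "f holomorphic_on UNIV" "f z0 \<noteq> 0" and less: "zero_exponent f < ereal \<sigma>" and \<sigma>: "\<sigma> \<ge> 0"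
  obtains C where "\<And>r. r \<ge> 0 \<Longrightarrow> real (zero_count f r) \<le> C * (1 + r) powr \<sigma>"
proof -
  have "eventually (\<lambda>r. ereal (log_plus (nevanlinna_N r (\<lambda>z. 1 / f z)) / ln r) < ereal \<sigma>) at_top"
    using less unfolding zero_exponent_def by (rule Limsup_lessD)
  then obtain r0 where r0: "\<And>r. r \<ge> r0 \<Longrightarrow> log_plus (nevanlinna_N r (\<lambda>z. 1 / f z)) / ln r < \<sigma>"
    by (auto simp: eventually_at_top_linorder)
  define R0 where "R0 = max 2 r0"
  have N: "nevanlinna_N r (\<lambda>z. 1 / f z) \<le> r powr \<sigma>" if "r \<ge> R0" for r
  proof -
    have "ln r > 0" "r > 0" using that by (auto simp: R0_def)
    with r0[of r] that have "log_plus (nevanlinna_N r (\<lambda>z. 1 / f z)) \<le> \<sigma> * ln r"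
      by (simp add: R0_def field_simps)
    then have "exp (log_plus (nevanlinna_N r (\<lambda>z. 1 / f z))) \<le> r powr \<sigma>"
      using \<open>r > 0\<close> by (simp add: powr_def)
    with le_exp_log_plus show ?thesis by (rule order_trans)
  qed
  show ?thesis
  proof (rule that)
    fix r :: real assume r: "r \<ge> 0"
    \<comment> \<open>Large enough for the bound on N to hold at 2s, for any r >= 0, and still
      proportional to 1 + r.\<close>
    define s where "s = R0 * (1 + r)"
    have R0: "R0 \<ge> 2" by (simp add: R0_def)
    have s: "s \<ge> r" "s \<ge> 1" "2 * s \<ge> R0"
      unfolding s_def using mult_mono[OF R0, of "1 + r" "1 + r"] r R0 by (auto simp: algebra_simps)
    have "real (zero_count f r) \<le> real (zero_count f s)"
      using zero_count_mono[OF f s(1)] by simp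
    also have "\<dots> \<le> 2 * (2 * s) powr \<sigma> + real (zero_count f 0)"
      using nevanlinna_N_lower[OF f s(2)] N[OF s(3)] by simp
    also have "(2 * s) powr \<sigma> = (2 * R0) powr \<sigma> * (1 + r) powr \<sigma>"
      using R0 r by (simp add: s_def powr_mult)
    also have "real (zero_count f 0) \<le> real (zero_count f 0) * (1 + r) powr \<sigma>"
      using r \<sigma> by (intro mult_le_cancel_left1[THEN iffD2]) (auto simp: ge_one_powr_ge_zero)
    finally show "real (zero_count f r) \<le> (2 * (2 * R0) powr \<sigma> + real (zero_count f 0)) * (1 + r) powr \<sigma>"
      by (simp add: algebra_simps)
  qed
qed

text \<open>Near 0 the factor differs from 1 by at most 3 |z|^(p+1), and p + 1 > s. Away from 0 one
  has 2 |z| > 1, so the powers k <= p in the exponent are dominated by (2 |z|)^s.\<close>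

lemma weierstrass_factor_growth:
  assumes s: "s > 0" and p: "real p \<le> s" "s < real p + 1"
  obtains K where "K \<ge> 0" "\<And>z. norm (weierstrass_factor p z) \<le> exp (K * norm z powr s)"
proof -
  \<comment> \<open>The summands serve the region near 0, the factor 1 - z, and the exponential sum,
    respectively.\<close>
  define K where "K = 3 + (1 / s) * 3 powr s + real p * 2 powr s"
  have K: "K \<ge> 3" using s by (simp add: K_def)
  show ?thesis
  proof (rule that)
    fix z :: complex
    show "norm (weierstrass_factor p z) \<le> exp (K * norm z powr s)"
    proof (cases "norm z \<le> 1 / 2")
      case True
      have "norm (weierstrass_factor p z) \<le> 1 + norm (weierstrass_factor p z - 1)"
        using norm_triangle_ineq[of 1 "weierstrass_factor p z - 1"] by simp
      also have "\<dots> \<le> 1 + 3 * norm z ^ Suc p"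
        using weierstrass_factor_bound[OF True, of p] by simp
      also have "norm z ^ Suc p \<le> norm z powr s"
      proof (cases "z = 0")
        case False
        have "norm z ^ Suc p = norm z powr (real p + 1)"
          using False by (simp add: powr_add powr_realpow)
        also have "\<dots> \<le> norm z powr s" using False True p by (intro powr_mono') auto
        finally show ?thesis .
      qed simp
      also have "1 + 3 * norm z powr s \<le> exp (3 * norm z powr s)" by (rule exp_ge_add_one_self)
      also have "\<dots> \<le> exp (K * norm z powr s)" using K by (simp add: mult_right_mono)
      finally show ?thesis by simp
    next
      case False
      define x where "x = norm z"
      have x: "x > 1 / 2" using False by (simp add: x_def)
      have "1 + x \<le> exp ((1 / s) * 3 powr s * x powr s)"
      proof -
        have "ln (1 + x) = (1 / s) * ln ((1 + x) powr s)" using s x by (simp add: ln_powr)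
        also have "\<dots> \<le> (1 / s) * (1 + x) powr s"
          using s x by (intro mult_left_mono order_trans[OF ln_le_minus_one]) auto
        also have "(1 + x) powr s \<le> (3 * x) powr s" using s x by (intro powr_mono2) auto
        also have "(3 * x) powr s = 3 powr s * x powr s" using x by (simp add: powr_mult)
        finally have "ln (1 + x) \<le> (1 / s) * 3 powr s * x powr s" using s by (simp add: mult_left_mono divide_right_mono)
        then have "exp (ln (1 + x)) \<le> exp ((1 / s) * 3 powr s * x powr s)" by (simp only: exp_le_cancel_iff)
        then show ?thesis using x by simp
      qed
      moreover have "norm (\<Sum>k=1..p. z ^ k / of_nat k) \<le> real p * 2 powr s * x powr s"
      proof -
        have "norm (\<Sum>k=1..p. z ^ k / of_nat k) \<le> (\<Sum>k=1..p. 2 powr s * x powr s)"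
        proof (rule sum_norm_le)
          fix k assume k: "k \<in> {1..p}"
          have "norm (z ^ k / of_nat k) \<le> x ^ k"
            using k x by (simp add: norm_divide norm_power x_def divide_le_eq mult_le_cancel_left1)
          also have "x ^ k = (2 * x) powr real k / 2 powr real k"
            using x by (simp add: powr_mult powr_realpow)
          also have "\<dots> \<le> (2 * x) powr s / 1"
            using x k p by (intro frac_le powr_mono) (auto simp: ge_one_powr_ge_zero)
          also have "\<dots> = 2 powr s * x powr s" using x by (simp add: powr_mult)
          finally show "norm (z ^ k / of_nat k) \<le> 2 powr s * x powr s" .
        qed
        then show ?thesis by simp
      qed
      then have "norm (exp (\<Sum>k=1..p. z ^ k / of_nat k)) \<le> exp (real p * 2 powr s * x powr s)"
        unfolding norm_exp_eq_Re exp_le_cancel_iff by (rule order_trans[OF complex_Re_le_cmod])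
      moreover have "norm (1 - z) \<le> 1 + x" unfolding x_def by (rule order_trans[OF norm_triangle_ineq4]) simp
      ultimately have "norm (weierstrass_factor p z) \<le> exp ((1 / s) * 3 powr s * x powr s) * exp (real p * 2 powr s * x powr s)"
        unfolding weierstrass_factor_def norm_mult by (intro mult_mono) auto
      also have "\<dots> = exp ((K - 3) * x powr s)" by (simp add: K_def distrib_right flip: exp_add)
      also have "\<dots> \<le> exp (K * norm z powr s)" by (simp add: x_def mult_right_mono)
      finally show ?thesis .
    qed
  qed (use K in simp)
qed

lemma finite_zeros_factorization:
  assumes "f holomorphic_on UNIV" "\<not> (\<forall>z. f z = 0)" "finite {z. f z = 0}"
  obtains p :: "complex poly" and h where "h holomorphic_on UNIV" "\<And>z. h z \<noteq> 0" "\<And>z. f z = h z * poly p z"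
proof -
  have "\<exists>p h. h holomorphic_on UNIV \<and> (\<forall>z. h z \<noteq> 0) \<and> (\<forall>z. f z = h z * poly p z)"
    using assms
  proof (induction "card {z. f z = 0}" arbitrary: f)
    case 0
    then have "{z. f z = 0} = {}" by simp
    then have "\<forall>z. f z \<noteq> 0" by blast
    then show ?case using "0.prems" by (intro exI[of _ 1] exI[of _ f]) simp
  next
    case (Suc m)
    then have "{z. f z = 0} \<noteq> {}" by (metis card.empty nat.distinct(1))
    then obtain w where w: "f w = 0" by blast
    obtain g n where g: "g holomorphic_on UNIV" "g w \<noteq> 0" "\<And>z. f z = (z - w) ^ n * g z"
      using entire_factor_zero[OF Suc.prems(1,2)] by metis
    have n: "n \<noteq> 0" using g(3)[of w] w g(2) by (cases n) auto
    have "{z. f z = 0} - {w} = {z. g z = 0}"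
      using g(2,3) n by auto
    moreover have "card ({z. f z = 0} - {w}) = card {z. f z = 0} - 1"
      by (rule card_Diff_singleton) (use w in simp)
    ultimately have fin: "finite {z. g z = 0}" and card: "m = card {z. g z = 0}"
      using finite_Diff[OF Suc.prems(3), of "{w}"] Suc.hyps(2) by simp_all
    obtain p h where h: "h holomorphic_on UNIV" "\<forall>z. h z \<noteq> 0" "\<forall>z. g z = h z * poly p z"
      using Suc.hyps(1)[OF card g(1) _ fin] g(2) by blast
    then show ?case
      using g(3) by (intro exI[of _ "[:- w, 1:] ^ n * p"] exI[of _ h]) (auto simp: poly_power mult_ac)
  qed
  then show ?thesis using that by blast
qed

text \<open>Enumerating the zeros by modulus with multiplicity, the count gives k + 1 =
  O(|a_k|^sigma). Hence the sum of |a_k|^(-s) is dominated by that of (k + 1)^(-s/sigma) and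
  converges. The Weierstrass product of genus floor(s) then has growth \<open>s\<close>.\<close>

lemma canonical_factorization:
  assumes g: "g holomorphic_on UNIV" "g 0 \<noteq> 0"
    and count: "\<And>r. r \<ge> 0 \<Longrightarrow> real (zero_count g r) \<le> C * (1 + r) powr \<sigma>"
    and s: "0 < \<sigma>" "\<sigma> < s"
  obtains B h where "fin_type s B" "h holomorphic_on UNIV" "\<And>z. h z \<noteq> 0" "\<And>z. g z = h z * B z"
proof (cases "finite {z. g z = 0}")
  case True
  then obtain p :: "complex poly" and h where "h holomorphic_on UNIV" "\<And>z. h z \<noteq> 0" "\<And>z. g z = h z * poly p z"
    using finite_zeros_factorization[OF g(1) _ True] g(2) by metis
  then show ?thesis using that[of "poly p" h] fin_type_poly[of s p] s by simp
next
  case False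
  define Z where "Z = {z. g z = 0}"
  define m where "m = (\<lambda>z. nat (zorder g z))"
  have m_pos: "m z > 0 \<longleftrightarrow> g z = 0" for z
    using entire_zorder_pos[OF g, of z] by (simp add: m_def)
  have fin: "finite (Z \<inter> cball 0 r)" for r
    using entire_finite_zeros[OF g, of r] by (rule rev_finite_subset) (auto simp: Z_def)
  have "closed Z"
  proof -
    have "closed (g -` {0})"
      using holomorphic_on_imp_continuous_on[OF g(1)] by (intro continuous_closed_vimage) (auto simp: continuous_on_eq_continuous_at)
    then show ?thesis by (simp add: Z_def vimage_def)
  qed
  obtain a :: "nat \<Rightarrow> complex" where a: "mono (norm \<circ> a)" "range a = Z" "filterlim a at_infinity at_top"
     "\<And>z. z \<in> Z \<Longrightarrow> finite (a -` {z}) \<and> card (a -` {z}) = m z"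
  proof (rule sequence_of_sparse_set_exists'[of Z m])
    show "infinite Z" using False by (simp add: Z_def)
    show "m z > 0" if "z \<in> Z" for z using that m_pos[of z] by (simp add: Z_def)
  qed (use \<open>closed Z\<close> fin in auto)
  have a_zero: "g (a k) = 0" for k using a(2) by (auto simp: Z_def)
  then have a_nz: "a k \<noteq> 0" for k using g(2) by metis
  have count_a: "real k + 1 \<le> C * (1 + norm (a k)) powr \<sigma>" for k
  proof -
    \<comment> \<open>As the moduli are nondecreasing, the first k + 1 terms lie in the closed disc
      of radius |a_k|.\<close>
    have "{..k} \<subseteq> (\<Union>z\<in>Z \<inter> cball 0 (norm (a k)). a -` {z})"
      using a(1,2) by (auto simp: mono_def)
    then have "card {..k} \<le> card (\<Union>z\<in>Z \<inter> cball 0 (norm (a k)). a -` {z})"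
      using fin a(4) by (intro card_mono) auto
    also have "\<dots> \<le> (\<Sum>z\<in>Z \<inter> cball 0 (norm (a k)). card (a -` {z}))"
      by (rule card_UN_le[OF fin])
    also have "\<dots> = (\<Sum>z\<in>Z \<inter> cball 0 (norm (a k)). m z)"
      using a(4) by (intro sum.cong) auto
    also have "Z \<inter> cball 0 (norm (a k)) = {z. norm z \<le> norm (a k) \<and> g z = 0}"
      by (auto simp: Z_def)
    finally have "Suc k \<le> zero_count g (norm (a k))" by (simp add: zero_count_def m_def)
    then have "real k + 1 \<le> real (zero_count g (norm (a k)))" by linarith
    also have "\<dots> \<le> C * (1 + norm (a k)) powr \<sigma>" by (rule count) simp
    finally show ?thesis .
  qed
  \<comment> \<open>Since |a_0| is the least modulus, 1 + |a_k| is at most (1 + |a_0|) / |a_0| times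
    |a_k|.\<close>
  define D where "D = C * ((1 + norm (a 0)) / norm (a 0)) powr \<sigma>"
  have count_D: "real k + 1 \<le> D * norm (a k) powr \<sigma>" for k
  proof -
    have a0: "norm (a 0) > 0" "norm (a 0) \<le> norm (a k)"
      using a_nz a(1) by (auto simp: mono_def)
    have C: "C \<ge> 0" using count_a[of 0] by (smt (verit) mult_nonpos_nonneg of_nat_0_le_iff powr_ge_zero)
    have "1 + norm (a k) \<le> (1 + norm (a 0)) / norm (a 0) * norm (a k)"
      using a0 by (simp add: field_simps)
    then have "(1 + norm (a k)) powr \<sigma> \<le> ((1 + norm (a 0)) / norm (a 0) * norm (a k)) powr \<sigma>"
      using s by (intro powr_mono2) auto
    also have "\<dots> = ((1 + norm (a 0)) / norm (a 0)) powr \<sigma> * norm (a k) powr \<sigma>"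
      by (subst powr_mult) auto
    finally have "C * (1 + norm (a k)) powr \<sigma> \<le> D * norm (a k) powr \<sigma>"
      using C unfolding D_def mult.assoc by (intro mult_left_mono)
    with count_a[of k] show ?thesis by linarith
  qed
  have D: "D > 0" using count_D[of 0] by (smt (verit) mult_nonpos_nonneg of_nat_0_le_iff powr_ge_zero)
  have a_inv: "norm (a k) powr (- s) \<le> D powr (s / \<sigma>) * real (Suc k) powr (- (s / \<sigma>))" for k
  proof -
    have "real (Suc k) / D \<le> norm (a k) powr \<sigma>"
      using count_D[of k] D by (simp add: field_simps)
    then have "(norm (a k) powr \<sigma>) powr (- (s / \<sigma>)) \<le> (real (Suc k) / D) powr (- (s / \<sigma>))"
      using D s by (intro powr_mono2') (auto intro!: divide_pos_pos)
    also have "(norm (a k) powr \<sigma>) powr (- (s / \<sigma>)) = norm (a k) powr (- s)"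
      using s by (simp add: powr_powr)
    also have "(real (Suc k) / D) powr (- (s / \<sigma>)) = D powr (s / \<sigma>) * real (Suc k) powr (- (s / \<sigma>))"
      using D by (simp add: powr_divide powr_minus field_simps)
    finally show ?thesis .
  qed
  have summable: "summable (\<lambda>k. norm (a k) powr (- s))"
  proof (rule summable_comparison_test)
    have "summable (\<lambda>k. real k powr (- (s / \<sigma>)))"
      unfolding summable_real_powr_iff using s by (simp add: field_simps)
    then have "summable (\<lambda>k. real (Suc k) powr (- (s / \<sigma>)))"
      by (subst summable_Suc_iff)
    then show "summable (\<lambda>k. D powr (s / \<sigma>) * real (Suc k) powr (- (s / \<sigma>)))"
      by (rule summable_mult)
  qed (use a_inv in auto)
  define p where "p = nat \<lfloor>s\<rfloor>"
  have p: "real p \<le> s" "s < real p + 1" using s by (auto simp: p_def)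
  have norm_a: "filterlim (\<lambda>k. norm (a k)) at_top at_top"
    using a(3) by (rule filterlim_at_infinity_imp_norm_at_top)
  interpret W: weierstrass_product a "\<lambda>_. p"
  proof
    fix r :: real assume r: "r > 0"
    have ev: "eventually (\<lambda>k. norm (a k) \<ge> 1) sequentially"
      using norm_a by (simp add: filterlim_at_top)
    show "summable (\<lambda>n. (r / norm (a n)) ^ Suc p)"
    proof (rule summable_comparison_test_ev)
      show "summable (\<lambda>k. r ^ Suc p * norm (a k) powr (- s))"
        by (rule summable_mult[OF summable])
      show "eventually (\<lambda>k. norm ((r / norm (a k)) ^ Suc p) \<le> r ^ Suc p * norm (a k) powr (- s)) sequentially"
        using ev
      proof eventually_elim
        case (elim k)
        have "norm ((r / norm (a k)) ^ Suc p) = r ^ Suc p * (1 / norm (a k) ^ Suc p)"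
          using r by (simp add: power_divide)
        also have "1 / norm (a k) ^ Suc p = norm (a k) powr (- (real p + 1))"
        proof -
          have "norm (a k) ^ Suc p = norm (a k) powr (real p + 1)"
            using powr_realpow[of "norm (a k)" "Suc p"] a_nz[of k] by (simp add: add.commute)
          then show ?thesis by (simp only: powr_minus divide_inverse mult_1_left)
        qed
        also have "\<dots> \<le> norm (a k) powr (- s)"
          using p elim by (intro powr_mono) auto
        finally show ?case using r by (simp add: mult_left_mono)
      qed
    qed
  qed (use a_nz a(3) in auto)
  obtain K where K: "K \<ge> 0" "\<And>z. norm (weierstrass_factor p z) \<le> exp (K * norm z powr s)"
    using weierstrass_factor_growth[of s p] p s by auto
  define S where "S = (\<Sum>k. norm (a k) powr (- s))"
  have "fin_type s W.f"
  proof (rule fin_typeI[OF W.holomorphic])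
    fix z
    have "(\<lambda>n. \<Prod>k\<le>n. weierstrass_factor p (z / a k)) \<longlonglongrightarrow> W.f z"
      using convergent_prod_LIMSEQ[OF W.convergent[of z]] by (simp add: W.f_def)
    then have "(\<lambda>n. norm (\<Prod>k\<le>n. weierstrass_factor p (z / a k))) \<longlonglongrightarrow> norm (W.f z)"
      by (rule tendsto_norm)
    moreover have "norm (\<Prod>k\<le>n. weierstrass_factor p (z / a k)) \<le> exp (K * S * norm z powr s)" for n
    proof -
      have "norm (\<Prod>k\<le>n. weierstrass_factor p (z / a k)) \<le> (\<Prod>k\<le>n. exp (K * norm (z / a k) powr s))"
        unfolding prod_norm[symmetric] by (intro prod_mono conjI K) auto
      also have "\<dots> = exp (\<Sum>k\<le>n. K * norm (z / a k) powr s)"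
        by (simp add: exp_sum)
      also have "(\<Sum>k\<le>n. K * norm (z / a k) powr s) = K * norm z powr s * (\<Sum>k\<le>n. norm (a k) powr (- s))"
      proof -
        have "norm (z / a k) powr s = norm z powr s * norm (a k) powr (- s)" for k
          by (simp add: norm_divide powr_divide powr_minus_divide)
        then show ?thesis by (simp add: sum_distrib_left mult.assoc)
      qed
      also have "(\<Sum>k\<le>n. norm (a k) powr (- s)) \<le> S"
        unfolding S_def by (intro sum_le_suminf summable) auto
      then have "exp (K * norm z powr s * (\<Sum>k\<le>n. norm (a k) powr (- s))) \<le> exp (K * norm z powr s * S)"
        using K by (simp add: mult_left_mono)
      finally show ?thesis by (simp add: mult_ac)
    qed
    ultimately have "norm (W.f z) \<le> exp (K * S * norm z powr s)"
      by (intro Lim_bounded[where M = 0]) auto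
    also have "\<dots> \<le> exp (K * S * (1 + norm z) powr s)"
    proof -
      have "S \<ge> 0" unfolding S_def by (intro suminf_nonneg summable) auto
      then show ?thesis using K s by (auto intro!: mult_left_mono powr_mono2)
    qed
    finally show "norm (W.f z) \<le> exp (K * S * (1 + norm z) powr s)" .
  qed
  \<comment> \<open>The product has the same zeros as \<open>g\<close> with the same orders, so the
    quotient extends to a zero-free entire function.\<close>
  moreover obtain h where "h holomorphic_on UNIV" "\<And>z. z \<in> UNIV \<Longrightarrow> h z \<noteq> 0" "\<And>z. z \<in> UNIV \<Longrightarrow> g z = h z * W.f z"
  proof (rule holomorphic_zorder_factorization[OF g(1) open_UNIV connected_UNIV W.holomorphic])
    show iff: "W.f z = 0 \<longleftrightarrow> g z = 0" for z
      using W.zero[of z] a(2) by (simp add: Z_def)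
    show "zorder W.f z = zorder g z" for z
    proof (cases "g z = 0")
      case True
      then have "card (a -` {z}) = m z" using a(4)[of z] by (simp add: Z_def)
      moreover have "zorder g z > 0" using entire_zorder_pos[OF g] True by simp
      ultimately show ?thesis by (simp add: W.zorder m_def)
    next
      case False
      then show ?thesis
        using iff zorder_eq_0I[OF W.analytic] zorder_eq_0I[OF entire_analytic[OF g(1)]] by simp
    qed
  qed auto
  ultimately show ?thesis by (intro that) auto
qed

section \<open>Hadamard factorization\<close>


text \<open>ln |h| = ln |f| - ln |B|, and - ln |B| is controlled in the mean: the lower bound for
  circle means of ln |B| bounds it from above. The pointwise bound on \<open>h\<close> follows by
  Harnack.\<close>

lemma fin_type_cofactor:
  assumes f: "fin_type \<rho> f" and B: "fin_type \<rho> B" and \<rho>: "\<rho> \<ge> 0"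
    and h: "h holomorphic_on UNIV" and eq: "\<And>z. f z = h z * B z" and nz: "B z0 \<noteq> 0"
  shows "fin_type \<rho> h"
proof -
  note Bh = fin_type_holomorphic[OF B, of UNIV]
  obtain C0 where C0: "\<And>r \<phi>. \<lbrakk>r \<ge> 1; continuous_on (sphere 0 r) \<phi>;
      \<And>z. norm z = r \<Longrightarrow> norm (B z) \<le> exp (\<phi> z)\<rbrakk> \<Longrightarrow> - C0 \<le> circle_mean r \<phi>"
    using circle_mean_lower_bound[OF Bh] nz by metis
  obtain C D where C: "C > 0" "\<And>z. norm (f z) \<le> exp (C * (1 + norm z) powr \<rho>)"
     and D: "D > 0" "\<And>z. norm (B z) \<le> exp (D * (1 + norm z) powr \<rho>)"
    using f B by (meson fin_typeE)
  define K where "K = max C D"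
  have K: "K > 0" using C by (simp add: K_def)
  show ?thesis
  proof (rule fin_typeI[OF h])
    fix w :: complex
    \<comment> \<open>A radius avoiding the finitely many moduli of zeros of \<open>B\<close> makes
      ln |B| continuous on the circle. The window for \<open>R\<close> keeps the Harnack factor at
      most 3.\<close>
    have "finite (norm ` {z. norm z \<le> 2 * norm w + 2 \<and> B z = 0})"
      using entire_finite_zeros[OF Bh nz] by blast
    moreover have "infinite {2 * norm w + 1<..<2 * norm w + 2}"
      by (rule infinite_Ioo) simp
    ultimately obtain R where R: "R \<in> {2 * norm w + 1<..<2 * norm w + 2}"
      "R \<notin> norm ` {z. norm z \<le> 2 * norm w + 2 \<and> B z = 0}"
      by (meson finite_subset subsetI)
    have B_nz: "B z \<noteq> 0" if "norm z = R" for z using R that by force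
    have R2: "2 * norm w + 1 < R" "R < 2 * norm w + 2" using R(1) by auto
    then have R1: "R \<ge> 1" "norm w < R" using norm_ge_zero[of w] by linarith+
    let ?X = "K * (1 + R) powr \<rho>"
    define \<psi> where "\<psi> = (\<lambda>z. 2 * ?X - ln (norm (B z)))"
    have lnB_cont: "continuous_on (sphere 0 R) (\<lambda>z. ln (norm (B z)))"
      using B_nz by (intro continuous_intros holomorphic_on_imp_continuous_on holomorphic_on_subset[OF Bh]) auto
    have \<psi>_cont: "continuous_on (sphere 0 R) \<psi>"
      unfolding \<psi>_def by (intro continuous_intros lnB_cont)
    have lnB: "ln (norm (B z)) \<le> ?X" if z: "norm z = R" for z
    proof -
      have "norm (B z) \<le> exp ?X"
        by (rule order_trans[OF D(2)]) (use z in \<open>auto simp: K_def mult_right_mono\<close>)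
      then show ?thesis using B_nz[OF z] by (metis ln_exp ln_le_cancel_iff exp_gt_zero zero_less_norm_iff)
    qed
    have \<psi>_nonneg: "\<psi> z \<ge> 0" if "norm z = R" for z
    proof -
      have "?X \<ge> 0" using K by simp
      then show ?thesis using lnB[OF that] by (simp add: \<psi>_def)
    qed
    have mean: "circle_mean R \<psi> \<le> 2 * ?X + \<bar>C0\<bar>"
    proof -
      have "- C0 \<le> circle_mean R (\<lambda>z. ln (norm (B z)))"
        by (rule C0[OF R1(1) lnB_cont]) (use B_nz in simp)
      moreover have "circle_mean R \<psi> = 2 * ?X - circle_mean R (\<lambda>z. ln (norm (B z)))"
        unfolding \<psi>_def using R1 lnB_cont by (subst circle_mean_diff) auto
      ultimately show ?thesis by linarith
    qed
    have mean0: "circle_mean R \<psi> \<ge> 0"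
      using \<psi>_nonneg R1 by (intro circle_mean_nonneg \<psi>_cont) auto
    have "norm (h w) \<le> exp ((R + norm w) / (R - norm w) * circle_mean R \<psi>)"
    proof (rule norm_le_exp_circle_mean[OF h \<psi>_cont \<psi>_nonneg _ R1(2)])
      fix z :: complex assume z: "norm z = R"
      have "norm (h z) = norm (f z) / norm (B z)" using B_nz[OF z] by (simp add: eq norm_mult)
      also have "norm (f z) \<le> exp ?X"
        by (rule order_trans[OF C(2)]) (use z in \<open>auto simp: K_def mult_right_mono\<close>)
      then have "norm (f z) / norm (B z) \<le> exp ?X / norm (B z)" by (rule divide_right_mono) simp
      also have "\<dots> = exp (?X - ln (norm (B z)))" using B_nz[OF z] by (simp add: exp_diff)
      also have "\<dots> \<le> exp (\<psi> z)" using K by (simp add: \<psi>_def)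
      finally show "norm (h z) \<le> exp (\<psi> z)" .
    qed
    also have "\<dots> \<le> exp (3 * circle_mean R \<psi>)"
      unfolding exp_le_cancel_iff using R1 R2 by (intro mult_right_mono mean0) (auto simp: divide_le_eq)
    also have "\<dots> \<le> exp (3 * (2 * ?X + \<bar>C0\<bar>))" using mean by simp
    also have "(1 + R) powr \<rho> \<le> (3 * (1 + norm w)) powr \<rho>"
    proof (intro powr_mono2)
      show "1 + R \<le> 3 * (1 + norm w)" using R2 norm_ge_zero[of w] unfolding distrib_left by linarith
    qed (use R1 \<rho> in auto)
    then have "(1 + R) powr \<rho> \<le> 3 powr \<rho> * (1 + norm w) powr \<rho>"
      by (subst (asm) powr_mult) auto
    then have "exp (3 * (2 * ?X + \<bar>C0\<bar>)) \<le> exp (3 * (2 * (K * (3 powr \<rho> * (1 + norm w) powr \<rho>)) + \<bar>C0\<bar> * (1 + norm w) powr \<rho>))"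
      using K one_le_one_plus_norm_powr[OF \<rho>, of w]
      by (auto simp: mult_le_cancel_left1 intro!: add_mono mult_left_mono)
    also have "\<dots> = exp ((6 * K * 3 powr \<rho> + 3 * \<bar>C0\<bar>) * (1 + norm w) powr \<rho>)"
      by (simp add: algebra_simps)
    finally show "norm (h w) \<le> exp ((6 * K * 3 powr \<rho> + 3 * \<bar>C0\<bar>) * (1 + norm w) powr \<rho>)" .
  qed
qed

text \<open>A holomorphic logarithm \<open>g\<close> has Re g bounded by a power of 1 + |z|. Applied
  to M - g with M a bound for Re g on a disc, the estimate for nonnegative real part bounds |g|, and
  Liouville's theorem makes \<open>g\<close> a polynomial.\<close>

lemma zero_free_fin_type_imp_exp_poly:
  assumes h: "fin_type \<rho> h" and \<rho>: "\<rho> \<ge> 0" and nz: "\<And>z. h z \<noteq> 0"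
  obtains H where "\<And>z. h z = exp (poly H z)"
proof -
  have contr: "contractible (UNIV :: complex set)"
    by (simp add: convex_imp_contractible)
  obtain g where g: "g holomorphic_on UNIV" "\<And>z. h z = exp (g z)"
    using contractible_imp_holomorphic_log[OF fin_type_holomorphic[OF h] contr] nz by (metis UNIV_I)
  obtain C where C: "C > 0" "\<And>z. norm (h z) \<le> exp (C * (1 + norm z) powr \<rho>)"
    using fin_typeE[OF h] by metis
  have Re_g: "Re (g z) \<le> C * (1 + norm z) powr \<rho>" for z
    using C(2)[of z] unfolding g(2) norm_exp_eq_Re exp_le_cancel_iff .
  \<comment> \<open>On the disc of radius 2 (1 + |w|) the factor is at most 3, so |g(w)| is at most
    3 (M + |g(0)|) + (M + |g(0)|); 3^rho comes from the change of radius in M.\<close>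
  define D where "D = 4 * C * 3 powr \<rho> + 4 * norm (g 0)"
  have g_le: "norm (g w) \<le> D * (1 + norm w) powr \<rho>" for w
  proof -
    define R where "R = 2 * (1 + norm w)"
    have "R = 2 + 2 * norm w" by (simp add: R_def)
    then have Rw: "norm w < R" "0 < R" using norm_ge_zero[of w] by linarith+
    define M where "M = C * (1 + R) powr \<rho>"
    have M: "M \<ge> 0" using C by (simp add: M_def)
    have "norm ((of_real M - g w) - \<i> * Im (of_real M - g 0)) \<le> (R + norm w) / (R - norm w) * Re (of_real M - g 0)"
    proof (rule Re_nonneg_ball_bound[where G = "\<lambda>z. of_real M - g z"])
      show "(\<lambda>z. of_real M - g z) holomorphic_on ball 0 R"
        by (intro holomorphic_intros holomorphic_on_subset[OF g(1)]) auto
      fix z :: complex assume "z \<in> ball 0 R"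
      then have "C * (1 + norm z) powr \<rho> \<le> M"
        unfolding M_def using C \<rho> by (intro mult_left_mono powr_mono2) auto
      then show "0 \<le> Re (of_real M - g z)" using Re_g[of z] by simp
    qed (use Rw in auto)
    also have "\<dots> \<le> 3 * (M + norm (g 0))"
    proof (intro mult_mono)
      have "R - norm w > 0" using Rw by simp
      then show "(R + norm w) / (R - norm w) \<le> 3" by (simp add: divide_le_eq) (simp add: R_def)
      show "Re (of_real M - g 0) \<le> M + norm (g 0)"
        using abs_Re_le_cmod[of "g 0"] by simp
      have "C * (1 + norm (0::complex)) powr \<rho> \<le> M"
        unfolding M_def using C \<rho> by (intro mult_left_mono powr_mono2) (auto simp: R_def)
      then show "0 \<le> Re (of_real M - g 0)" using Re_g[of 0] by simp
    qed auto
    finally have 1: "norm ((of_real M - g w) - \<i> * Im (of_real M - g 0)) \<le> 3 * (M + norm (g 0))" .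
    have "norm (g w) \<le> norm ((of_real M - g w) - \<i> * Im (of_real M - g 0)) + norm (of_real M + \<i> * Im (g 0))"
      using norm_triangle_ineq4[of "of_real M + \<i> * Im (g 0)" "(of_real M - g w) - \<i> * Im (of_real M - g 0)"]
      by (simp add: algebra_simps)
    moreover have "norm (of_real M + \<i> * Im (g 0)) \<le> M + norm (g 0)"
      using norm_triangle_ineq[of "of_real M" "\<i> * Im (g 0)"] M abs_Im_le_cmod[of "g 0"] by (simp add: norm_mult)
    ultimately have "norm (g w) \<le> 4 * M + 4 * norm (g 0)" using 1 unfolding distrib_left by linarith
    moreover have "M \<le> C * (3 powr \<rho> * (1 + norm w) powr \<rho>)"
    proof -
      have "(1 + R) powr \<rho> \<le> (3 * (1 + norm w)) powr \<rho>"
        using \<rho> by (intro powr_mono2) (auto simp: R_def)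
      also have "(3 * (1 + norm w)) powr \<rho> = 3 powr \<rho> * (1 + norm w) powr \<rho>"
        by (subst powr_mult) auto
      finally show ?thesis unfolding M_def using C by (intro mult_left_mono) auto
    qed
    moreover have "norm (g 0) \<le> norm (g 0) * (1 + norm w) powr \<rho>"
      using one_le_one_plus_norm_powr[OF \<rho>, of w] by (simp add: mult_le_cancel_left1)
    ultimately show ?thesis by (simp add: D_def algebra_simps)
  qed
  define N where "N = nat \<lceil>\<rho>\<rceil>"
  have D: "D \<ge> 0" using C by (simp add: D_def)
  have "norm (g z) \<le> D * 2 ^ N * norm z ^ N" if "1 \<le> norm z" for z
  proof -
    have "(1 + norm z) powr \<rho> \<le> (1 + norm z) powr real N"
      using \<rho> by (intro powr_mono) (auto simp: N_def)
    also have "\<dots> = (1 + norm z) ^ N" using that by (intro powr_realpow) auto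
    also have "\<dots> \<le> (2 * norm z) ^ N" using that by (intro power_mono) auto
    finally have "D * (1 + norm z) powr \<rho> \<le> D * (2 * norm z) ^ N" using D by (rule mult_left_mono)
    with g_le[of z] show ?thesis by (simp add: power_mult_distrib mult.assoc)
  qed
  then have "g \<xi> = (\<Sum>k\<le>N. (deriv ^^ k) g 0 / fact k * \<xi> ^ k)" for \<xi>
    by (rule Liouville_polynomial[OF g(1)])
  then have "h z = exp (poly (\<Sum>k\<le>N. monom ((deriv ^^ k) g 0 / fact k) k) z)" for z
    by (simp add: g(2) poly_sum poly_monom)
  then show ?thesis by (rule that)
qed

text \<open>The canonical product requires zeros away from 0, so a zero at the origin is split off
  first and returned to \<open>B\<close> as a power of \<open>z\<close>. The gap between
  \<open>\<sigma>\<close> and \<open>s\<close> pays for the convergence of the product.\<close>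

lemma hadamard_factorization:
  assumes f: "fin_type \<rho> f" "f z0 \<noteq> 0" and less: "zero_exponent f < ereal \<sigma>" and s: "0 < \<sigma>" "\<sigma> < s" "s \<le> \<rho>"
  obtains B H where "fin_type s B" "\<And>z. f z = B z * exp (poly H z)"
proof -
  note fh = fin_type_holomorphic[OF f(1), of UNIV]
  obtain g k where g: "g holomorphic_on UNIV" "g 0 \<noteq> 0" "\<And>z. f z = (z - 0) ^ k * g z"
    using entire_factor_zero[OF fh, of 0] f(2) by metis
  obtain C where C: "\<And>r. r \<ge> 0 \<Longrightarrow> real (zero_count f r) \<le> C * (1 + r) powr \<sigma>"
    using zero_exponent_less_imp_zero_count[OF fh f(2) less] s by auto
  have count: "zero_count g r \<le> zero_count f r" for r
  proof -
    have "zorder f z = zorder g z" if "g z = 0" for z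
    proof -
      have z: "z \<noteq> 0" using that g(2) by auto
      have "zorder (\<lambda>z. z ^ k * g z) z = zorder (\<lambda>z. z ^ k) z + zorder g z"
      proof (rule zorder_times_analytic)
        show "eventually (\<lambda>z. z ^ k * g z \<noteq> 0) (at z)"
          using entire_eventually_nonzero[OF fh f(2), of z] by (simp add: g(3))
        show "(\<lambda>z. z ^ k) analytic_on {z}" by (intro analytic_intros)
        show "g analytic_on {z}" by (rule entire_analytic[OF g(1)])
      qed
      moreover have "zorder (\<lambda>z. z ^ k) z = 0"
        using z by (intro zorder_eq_0I) (auto intro!: analytic_intros)
      moreover have "f = (\<lambda>z. z ^ k * g z)" using g(3) by auto
      ultimately show ?thesis by simp
    qed
    then have "zero_count g r = (\<Sum>z\<in>{z. norm z \<le> r \<and> g z = 0}. nat (zorder f z))"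
      unfolding zero_count_def by (intro sum.cong) auto
    also have "\<dots> \<le> zero_count f r"
      unfolding zero_count_def by (intro sum_mono2 entire_finite_zeros[OF fh f(2)]) (auto simp: g(3))
    finally show ?thesis .
  qed
  obtain B h where Bh: "fin_type s B" "h holomorphic_on UNIV" "\<And>z. h z \<noteq> 0" "\<And>z. g z = h z * B z"
  proof (rule canonical_factorization[OF g(1,2) _ s(1,2), of C])
    show "real (zero_count g r) \<le> C * (1 + r) powr \<sigma>" if "r \<ge> 0" for r
      using C[OF that] count[of r] by simp
  qed metis
  have B': "fin_type s (\<lambda>z. z ^ k * B z)"
    using s Bh(1) by (intro fin_type_mult fin_type_power fin_type_ident) auto
  have "fin_type \<rho> h"
  proof (rule fin_type_cofactor[OF f(1) fin_type_mono[OF B' s(3)] _ Bh(2)])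
    show fz: "f z = h z * (z ^ k * B z)" for z using g(3)[of z] Bh(4)[of z] by simp
    show "z0 ^ k * B z0 \<noteq> 0" using fz[of z0] f(2) by auto
  qed (use s in auto)
  then obtain H where "\<And>z. h z = exp (poly H z)"
    using zero_free_fin_type_imp_exp_poly[of \<rho> h] s Bh(3) by (metis less_imp_le less_le_trans)
  then show ?thesis
    using g(3) Bh(4) by (intro that[OF B', of H]) simp
qed

text \<open>With \<open>\<tau> >= 1\<close> the function \<open>P\<close> is an admissible
  coefficient, so the equation relates the exponentials of n H, K and 0. The cases record which of
  these agree up to degree \<open>\<tau>\<close>; whenever \<open>P\<close> stands alone it would
  vanish identically.\<close>

lemma degree_2_impossible:
  fixes B :: "complex \<Rightarrow> complex" and H K :: "complex poly"
  assumes B: "fin_type \<tau> B" "B w \<noteq> 0" and A2: "fin_type \<tau> A2" and \<tau>: "\<tau> \<ge> 1" and n: "n \<ge> 1"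
    and deg: "real (degree H) > \<tau>" and p: "p1 \<noteq> 0" "lam1 \<noteq> lam2"
    and eq: "\<And>z. B z ^ (n - 1) * (B z + \<omega> * (deriv B z + B z * poly (pderiv H) z)) * exp (poly (smult (of_nat n) H) z)
                + A2 z * exp (poly K z) = two_exp p1 lam1 p2 lam2 z"
  shows False
proof -
  define A1 where "A1 = (\<lambda>z. B z ^ (n - 1) * (B z + \<omega> * (deriv B z + B z * poly (pderiv H) z)))"
  define P where "P = two_exp p1 lam1 p2 lam2"
  have eq': "A1 z * exp (poly (smult (of_nat n) H) z) + A2 z * exp (poly K z) = P z" for z
    using eq[of z] by (simp add: A1_def P_def)
  have A1: "fin_type \<tau> A1"
    unfolding A1_def using B \<tau>
    by (intro fin_type_mult fin_type_add fin_type_power fin_type_const fin_type_deriv fin_type_poly) auto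
  have P: "fin_type \<tau> P" unfolding P_def by (rule fin_type_two_exp[OF \<tau>])
  obtain y where y: "P y \<noteq> 0" using two_exp_nonzero[OF p] unfolding P_def by metis
  have degn: "real (degree (smult (of_nat n) H)) > \<tau>" using deg n by simp
  consider "real (degree K) \<le> \<tau>" | "real (degree K) > \<tau>" "real (degree (smult (of_nat n) H - K)) \<le> \<tau>"
    | "real (degree K) > \<tau>" "real (degree (smult (of_nat n) H - K)) > \<tau>" by linarith
  then show False
  proof cases
    case 1
    have A10: "A1 z = 0" for z
    proof (rule exp_poly_dominates[OF A1 _ _ degn])
      show "fin_type \<tau> (\<lambda>z. P z - A2 z * exp (poly K z))"
        using \<tau> 1 by (intro fin_type_diff fin_type_mult fin_type_exp_poly P A2) auto
      show "A1 z * exp (poly (smult (of_nat n) H) z) = P z - A2 z * exp (poly K z)" for z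
        using eq'[of z] by (simp add: algebra_simps)
    qed (use \<tau> in auto)
    have Bh: "B holomorphic_on UNIV" by (rule fin_type_holomorphic[OF B(1)])
    have L0: "B z + \<omega> * (deriv B z + B z * poly (pderiv H) z) = 0" for z
    proof (rule entire_mult_eq_0[where f = "\<lambda>z. B z + \<omega> * (deriv B z + B z * poly (pderiv H) z)"])
      show "(\<lambda>z. B z + \<omega> * (deriv B z + B z * poly (pderiv H) z)) holomorphic_on UNIV"
        by (intro holomorphic_intros Bh holomorphic_deriv open_UNIV)
      show "(\<lambda>z. B z ^ (n - 1)) holomorphic_on UNIV" by (intro holomorphic_intros Bh)
      show "(B z + \<omega> * (deriv B z + B z * poly (pderiv H) z)) * B z ^ (n - 1) = 0" for z
        using A10[of z] unfolding A1_def by (simp only: mult.commute)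
      show "B w ^ (n - 1) \<noteq> 0" using B by simp
    qed
    show False
    proof (cases "\<omega> = 0")
      case True
      then show False using L0[of w] B(2) by simp
    next
      case False
      \<comment> \<open>If f + omega f' = 0 for f = B exp H, then f exp (z / omega) is constant.
        This product is B exp M, and adding a linear term does not lower the degree of
        \<open>H\<close>.\<close>
      define M where "M = H + [:0, 1 / \<omega>:]"
      have dM: "((\<lambda>z. B z * exp (poly M z)) has_field_derivative 0) (at z)" for z
      proof -
        have "((\<lambda>z. B z * exp (poly M z)) has_field_derivative
            (deriv B z + B z * poly (pderiv M) z) * exp (poly M z)) (at z)"
          by (auto intro!: derivative_eq_intros holomorphic_derivI[OF Bh open_UNIV UNIV_I] poly_DERIV simp: algebra_simps)
        moreover have "deriv B z + B z * poly (pderiv M) z = 0"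
          using L0[of z] False by (simp add: M_def pderiv_add pderiv_pCons field_simps)
        ultimately show ?thesis by simp
      qed
      obtain b where b: "\<And>z. B z * exp (poly M z) = b"
        using has_field_derivative_0_imp_constant_on[OF dM connected_UNIV open_UNIV]
        unfolding constant_on_def by auto
      have "degree M = degree H"
        unfolding M_def using deg \<tau> by (intro degree_add_eq_left) auto
      then have "B w = 0"
        using deg \<tau> b by (intro exp_poly_dominates[OF B(1) fin_type_const[of \<tau> b], of M]) auto
      then show False using B(2) by simp
    qed
  next
    case 2
    have eq2: "(A1 z * exp (poly (smult (of_nat n) H - K) z) + A2 z) * exp (poly K z) = P z" for z
      using eq'[of z] by (simp add: exp_diff field_simps)
    have "A1 y * exp (poly (smult (of_nat n) H - K) y) + A2 y = 0"
    proof (rule exp_poly_dominates[OF _ P eq2 2(1)])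
      show "fin_type \<tau> (\<lambda>z. A1 z * exp (poly (smult (of_nat n) H - K) z) + A2 z)"
        using \<tau> 2 by (intro fin_type_add fin_type_mult fin_type_exp_poly A1 A2) auto
    qed (use \<tau> in auto)
    then show False using eq2[of y] y by simp
  next
    case 3
    define E where "E = (\<lambda>i::nat. if i = 0 then 0 else if i = 1 then K else smult (of_nat n) H)"
    define X where "X = (\<lambda>i::nat. if i = 0 then (\<lambda>z. - P z) else if i = 1 then A2 else A1)"
    have "X 0 y = 0"
    proof (rule borel_exp_sum[where I = "{0, 1, 2}" and H = E and B = X])
      show "fin_type \<tau> (X i)" for i
        unfolding X_def using A1 A2 P by (auto intro: fin_type_minus)
      show "\<tau> < real (degree (E i - E j))" if "i \<in> {0,1,2}" "j \<in> {0,1,2}" "i \<noteq> j" for i j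
        using that 3 degn degree_minus[of "K - smult (of_nat n) H"] by (auto simp: E_def)
      show "(\<Sum>i\<in>{0, 1, 2}. X i z * exp (poly (E i) z)) = 0" for z
        using eq'[of z] by (simp add: X_def E_def algebra_simps)
    qed (use \<tau> in auto)
    then show False using y by (simp add: X_def)
  qed
qed

text \<open>\<open>Y\<close> makes q(z) B(z + c) a nonzero constant up to a fixed factor, so
  \<open>q\<close> has no zeros and is constant, and then \<open>B\<close> is constant too.
  \<open>X\<close> turns into A^n (1 + omega h1) = p with A = B exp h0. As p is nonzero, so is n +
  omega lam = n (1 + omega h1).\<close>

lemma degree_1_solution:
  fixes B :: "complex \<Rightarrow> complex" and q :: "complex poly"
  assumes n: "n \<ge> 1" and p: "p \<noteq> 0" "p' \<noteq> 0"
    and f: "\<And>z. f z = B z * exp (h0 + h1 * z)" and lam: "lam = of_nat n * h1" "mu = q1 + h1"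
    and X: "\<And>z. B z ^ (n - 1) * (B z + \<omega> * (deriv B z + B z * h1)) * exp (of_nat n * h0) = p"
    and Y: "\<And>z. poly q z * B (z + c) * exp (q0 + h0 + h1 * c) = p'"
  shows "\<exists>A b. of_nat n + \<omega> * lam \<noteq> 0
               \<and> A ^ n = p * of_nat n / (of_nat n + \<omega> * lam)
               \<and> (\<forall>z. f z = A * exp (lam * z / of_nat n))
               \<and> (\<forall>z. poly [:q0, q1:] z = (mu - lam / of_nat n) * z + b)
               \<and> (\<forall>z. p' = poly q z * A * exp (lam * c / of_nat n + b))"
proof -
  have "poly q z \<noteq> 0" for z using Y[of z] p by auto
  then have "constant (poly q)" using Fundamental_Theorem_Algebra.fundamental_theorem_of_algebra[of q] by blast
  then obtain a where a: "\<And>z. poly q z = a" by (metis constant_def)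
  have a0: "a \<noteq> 0" using Y[of 0] a p by auto
  define \<beta> where "\<beta> = p' / (a * exp (q0 + h0 + h1 * c))"
  have B: "B z = \<beta>" for z
    using Y[of "z - c"] a a0 by (simp add: \<beta>_def field_simps)
  have "B = (\<lambda>_. \<beta>)" using B by auto
  then have dB: "deriv B z = 0" for z by simp
  have nn: "of_nat n \<noteq> (0 :: complex)" using n by simp
  have h1: "h1 = lam / of_nat n" using lam nn by simp
  define A where "A = \<beta> * exp h0"
  have "\<beta> ^ (n - 1) * \<beta> = \<beta> ^ n" using n by (metis power_minus_mult less_le_trans zero_less_one)
  then have "\<beta> ^ n * (1 + \<omega> * h1) * exp (of_nat n * h0) = p"
    using X[of 0] B dB by (simp add: algebra_simps) (metis mult.assoc mult.commute)
  moreover have "A ^ n = \<beta> ^ n * exp (of_nat n * h0)"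
    by (simp add: A_def power_mult_distrib exp_of_nat_mult)
  ultimately have An: "A ^ n * (1 + \<omega> * h1) = p"
    by (simp add: mult_ac)
  have fac: "of_nat n + \<omega> * lam = of_nat n * (1 + \<omega> * h1)" using lam by (simp add: algebra_simps)
  have nz: "1 + \<omega> * h1 \<noteq> 0" using An p by auto
  show ?thesis
  proof (rule exI[of _ A], rule exI[of _ q0], intro conjI allI)
    show "of_nat n + \<omega> * lam \<noteq> 0" using fac nz nn by simp
    show "A ^ n = p * of_nat n / (of_nat n + \<omega> * lam)"
      unfolding fac An[symmetric] using nz nn by simp
    show "f z = A * exp (lam * z / of_nat n)" for z
      by (simp add: f B A_def h1 exp_add)
    show "poly [:q0, q1:] z = (mu - lam / of_nat n) * z + q0" for z
      using lam h1 by (simp add: algebra_simps)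
    show "p' = poly q z * A * exp (lam * c / of_nat n + q0)" for z
      using Y[of z] by (simp add: B A_def h1 exp_add mult_ac)
  qed
qed

section \<open>Solutions of the equation\<close>


definition lhs_part :: "nat \<Rightarrow> complex \<Rightarrow> (complex \<Rightarrow> complex) \<Rightarrow> complex \<Rightarrow> complex" where
  "lhs_part n \<omega> f z = f z ^ n + \<omega> * f z ^ (n - 1) * deriv f z"

lemma fin_type_lhs_part:
  assumes "fin_type \<tau> f" "\<tau> \<ge> 0"
  shows "fin_type \<tau> (lhs_part n \<omega> f)"
  unfolding lhs_part_def[abs_def]
  using assms by (intro fin_type_add fin_type_mult fin_type_power fin_type_const fin_type_deriv) auto

lemma solution_order_le_1:
  fixes f :: "complex \<Rightarrow> complex" and q Q :: "complex poly"
  assumes f: "fin_type \<rho> f" and nz: "f z0 \<noteq> 0" and n: "\<omega> \<noteq> 0 \<and> n \<ge> 4 \<or> \<omega> = 0 \<and> n \<ge> 3"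
    and q: "q \<noteq> 0" and p: "p1 \<noteq> 0" "p2 \<noteq> 0" "lam1 \<noteq> lam2"
    and eq: "\<And>z. lhs_part n \<omega> f z + poly q z * exp (poly Q z) * f (z + c) = two_exp p1 lam1 p2 lam2 z"
  shows "growth_order f \<le> 1"
proof -
  note fh = fin_type_holomorphic[OF f, of UNIV]
  have f'h: "deriv f holomorphic_on UNIV" and f''h: "deriv (deriv f) holomorphic_on UNIV"
    by (intro holomorphic_deriv fh open_UNIV)+
  have df: "(f has_field_derivative deriv f z) (at z)" for z
    by (rule holomorphic_derivI[OF fh open_UNIV UNIV_I])
  have ddf: "(deriv f has_field_derivative deriv (deriv f) z) (at z)" for z
    by (rule holomorphic_derivI[OF f'h open_UNIV UNIV_I])
  have f_le: "norm (f z) \<le> exp v" "norm (deriv f z) \<le> exp v" "norm (deriv (deriv f) z) \<le> exp v"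
    if *: "\<And>w. dist z w \<le> 2 \<Longrightarrow> norm (f w) \<le> exp v" for z v
  proof -
    show "norm (f z) \<le> exp v" by (rule *) simp
    \<comment> \<open>Two Cauchy estimates on unit circles reach the second derivative, which
      explains the disc of radius 2.\<close>
    have d1: "norm (deriv f w) \<le> exp v" if "dist z w \<le> 1" for w
    proof (rule norm_deriv_le[OF fh])
      fix x assume "norm (x - w) = 1"
      then have "dist z x \<le> 2" using that dist_triangle[of z x w] by (simp add: dist_norm norm_minus_commute)
      then show "norm (f x) \<le> exp v" by (rule *)
    qed
    then show "norm (deriv f z) \<le> exp v" by simp
    show "norm (deriv (deriv f) z) \<le> exp v"
      by (rule norm_deriv_le[OF f'h]) (auto intro!: d1 simp: dist_norm norm_minus_commute)
  qed
  have e2: "exp (2 * v) = exp v * exp v" for v :: real by (simp flip: exp_add)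
  show ?thesis
  proof (cases "\<omega> = 0")
    case True
    then obtain k where k: "n = Suc k" "k \<ge> 2" using n by (cases n) auto
    show ?thesis
    proof (rule growth_order_le_1[OF f nz k(2) fh _ _ _ _ _ _ q eq p])
      show "(\<lambda>z. of_nat n * deriv f z) holomorphic_on UNIV" by (intro holomorphic_intros f'h)
      show "lhs_part n \<omega> f z = f z ^ k * f z" for z using True k by (simp add: lhs_part_def)
      show "(lhs_part n \<omega> f has_field_derivative f z ^ k * (of_nat n * deriv f z)) (at z)" for z
        unfolding lhs_part_def[abs_def] True k(1) using DERIV_power[OF df, of "Suc k" z] by (simp add: mult_ac)
      show "real n \<ge> 1" using k by simp
      show "f z \<noteq> 0" if "\<And>w. f w = 0" for z using that nz by simp
      fix z v
      assume fv: "\<And>w. dist z w \<le> 2 \<Longrightarrow> norm (f w) \<le> exp v" and v: "v \<ge> (0 :: real)"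
      note le = f_le[of z v, OF fv]
      have "exp v \<le> exp (2 * v)" using v by simp
      moreover have "exp (2 * v) \<le> real n * exp (2 * v)" using k by simp
      moreover have "real n * norm (deriv f z) \<le> real n * exp (2 * v)"
        using order_trans[OF le(2) \<open>exp v \<le> exp (2 * v)\<close>] by (intro mult_left_mono) auto
      ultimately show "norm (f z) \<le> real n * exp (2 * v) \<and> norm (of_nat n * deriv f z) \<le> real n * exp (2 * v)"
        using le(1) unfolding norm_mult norm_of_nat by linarith
    qed
  next
    case False
    then have "n \<ge> 4" using n by simp
    then have "n = Suc (Suc (n - 2))" "n - 2 \<ge> 2" by simp_all
    then obtain k where k: "n = Suc (Suc k)" "k \<ge> 2" by blast
    \<comment> \<open>Differentiating \<open>f^(n-1) * f'\<close> leaves a term with only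
      \<open>f^(n-2)\<close>, so here \<open>m = n - 2\<close>, one less than for
      \<open>\<omega> = 0\<close>.\<close>
    define G where "G = (\<lambda>z. f z * (f z + \<omega> * deriv f z))"
    define G1 where "G1 = (\<lambda>z. of_nat n * (f z * deriv f z)
        + \<omega> * (of_nat (Suc k) * (deriv f z * deriv f z) + f z * deriv (deriv f) z))"
    show ?thesis
    proof (rule growth_order_le_1[OF f nz k(2) _ _ _ _ _ _ _ q eq p])
      show "G holomorphic_on UNIV" "G1 holomorphic_on UNIV"
        unfolding G_def G1_def by (intro holomorphic_intros fh f'h f''h)+
      show "lhs_part n \<omega> f z = f z ^ k * G z" for z by (simp add: lhs_part_def k G_def algebra_simps)
      show "(lhs_part n \<omega> f has_field_derivative f z ^ k * G1 z) (at z)" for z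
      proof -
        have "lhs_part n \<omega> f = (\<lambda>z. f z ^ Suc (Suc k) + \<omega> * (f z ^ Suc k * deriv f z))"
          by (simp add: fun_eq_iff lhs_part_def k)
        moreover have "((\<lambda>z. f z ^ Suc (Suc k) + \<omega> * (f z ^ Suc k * deriv f z)) has_field_derivative
           (of_nat (Suc (Suc k)) * (deriv f z * f z ^ (Suc (Suc k) - Suc 0))) +
           \<omega> * ((of_nat (Suc k) * (deriv f z * f z ^ (Suc k - Suc 0))) * deriv f z
             + deriv (deriv f) z * f z ^ Suc k)) (at z)"
          by (intro DERIV_add DERIV_cmult DERIV_mult DERIV_power df ddf)
        moreover have "(of_nat (Suc (Suc k)) * (deriv f z * f z ^ (Suc (Suc k) - Suc 0))) +
           \<omega> * ((of_nat (Suc k) * (deriv f z * f z ^ (Suc k - Suc 0))) * deriv f z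
             + deriv (deriv f) z * f z ^ Suc k) = f z ^ k * G1 z"
          by (simp add: G1_def k algebra_simps)
        ultimately show ?thesis by metis
      qed
      show "real n * (1 + norm \<omega>) \<ge> 1" 
        using mult_mono[of 1 "real n" 1 "1 + norm \<omega>"] k by simp
      show "f z \<noteq> 0" if G0: "\<And>w. G w = 0" for z
      proof
        assume fz: "f z = 0"
        have L0: "f w + \<omega> * deriv f w = 0" for w
        proof (rule entire_mult_eq_0[of "\<lambda>w. f w + \<omega> * deriv f w" f z0])
          show "(\<lambda>w. f w + \<omega> * deriv f w) holomorphic_on UNIV" by (intro holomorphic_intros fh f'h)
          show "(f w + \<omega> * deriv f w) * f w = 0" for w
            using G0[of w] by (simp only: G_def mult.commute)
        qed (rule fh, rule nz)
        \<comment> \<open>\<open>G = 0\<close> means f + omega f' = 0, so \<open>f\<close> is a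
          constant multiple of exp (- w / omega) and cannot vanish anywhere.\<close>
        have "((\<lambda>w. f w * exp (w / \<omega>)) has_field_derivative 0) (at w)" for w
        proof -
          have "((\<lambda>w. f w * exp (w / \<omega>)) has_field_derivative
             (f w + \<omega> * deriv f w) * exp (w / \<omega>) / \<omega>) (at w)"
            using False by (auto intro!: derivative_eq_intros df simp: field_simps)
          then show ?thesis using L0[of w] by simp
        qed
        then have "(\<lambda>w. f w * exp (w / \<omega>)) constant_on UNIV"
          by (intro has_field_derivative_0_imp_constant_on) auto
        then have "f z0 * exp (z0 / \<omega>) = f z * exp (z / \<omega>)"
          unfolding constant_on_def by (metis UNIV_I)
        then show False using fz nz by simp
      qed
      fix z v
      assume fv: "\<And>w. dist z w \<le> 2 \<Longrightarrow> norm (f w) \<le> exp v" and v: "v \<ge> (0 :: real)"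
      note le = f_le[of z v, OF fv]
      let ?b = "real n * (1 + norm \<omega>)" and ?e = "exp v * exp v"
      have "norm (G z) \<le> exp v * (exp v + norm \<omega> * exp v)"
        unfolding G_def norm_mult
        by (intro mult_mono order_trans[OF norm_triangle_ineq] add_mono le) (auto simp: norm_mult intro!: mult_left_mono le)
      also have "\<dots> = (1 + norm \<omega>) * ?e" by (simp add: algebra_simps)
      also have "\<dots> \<le> ?b * ?e" using k mult_right_mono[of 1 "real n" "1 + norm \<omega>"] by (intro mult_right_mono) auto
      finally have 1: "norm (G z) \<le> ?b * exp (2 * v)" by (simp add: e2)
      have prods: "norm (f z) * norm (deriv f z) \<le> ?e" "norm (deriv f z) * norm (deriv f z) \<le> ?e"
          "norm (f z) * norm (deriv (deriv f) z) \<le> ?e"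
        by (rule mult_mono[OF le(1,2)] mult_mono[OF le(2,2)] mult_mono[OF le(1,3)]; simp)+
      have "norm (G1 z) \<le> norm (of_nat n * (f z * deriv f z)) +
          norm (\<omega> * (of_nat (Suc k) * (deriv f z * deriv f z) + f z * deriv (deriv f) z))"
        unfolding G1_def by (rule norm_triangle_ineq)
      also have "\<dots> \<le> real n * ?e + norm \<omega> * (real (Suc k) * ?e + ?e)"
      proof (intro add_mono)
        show "norm (of_nat n * (f z * deriv f z)) \<le> real n * ?e"
          unfolding norm_mult norm_of_nat by (intro mult_left_mono prods) simp
        have "norm (of_nat (Suc k) * (deriv f z * deriv f z) + f z * deriv (deriv f) z) \<le> real (Suc k) * ?e + ?e"
          by (intro order_trans[OF norm_triangle_ineq] add_mono)
             (auto simp only: norm_mult norm_of_nat intro!: mult_left_mono prods of_nat_0_le_iff)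
        then show "norm (\<omega> * (of_nat (Suc k) * (deriv f z * deriv f z) + f z * deriv (deriv f) z))
            \<le> norm \<omega> * (real (Suc k) * ?e + ?e)"
          unfolding norm_mult by (intro mult_left_mono) auto
      qed
      also have "\<dots> = ?b * ?e" by (simp add: k algebra_simps)
      finally have "norm (G1 z) \<le> ?b * exp (2 * v)" by (simp add: e2)
      with 1 show "norm (G z) \<le> ?b * exp (2 * v) \<and> norm (G1 z) \<le> ?b * exp (2 * v)" by blast
    qed
  qed
qed

text \<open>The witness \<open>A\<close> is the chosen \<open>n\<close>-th root; binding it once
  makes the same root occur in \<open>f\<close> and in the relation for \<open>b1\<close> or
  \<open>b2\<close>.\<close>

theorem theorem1p7:
  fixes n :: nat and \<omega> c lam1 lam2 p1 p2 :: complex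
    and q Q :: "complex poly" and f :: "complex \<Rightarrow> complex"
  assumes "n \<ge> 1"
    and "c \<noteq> 0" "lam1 \<noteq> 0" "lam2 \<noteq> 0" "p1 \<noteq> 0" "p2 \<noteq> 0"
    and "lam1 \<noteq> lam2"
    and "degree Q > 0" "q \<noteq> 0"
    and "transcendental_entire f"
    and "growth_order f < \<infinity>"
    and "\<And>z. f z ^ n + \<omega> * f z ^ (n - 1) * deriv f z + poly q z * exp (poly Q z) * f (z + c)
             = p1 * exp (lam1 * z) + p2 * exp (lam2 * z)"
  shows "((\<omega> \<noteq> 0 \<and> n \<ge> 4 \<or> \<omega> = 0 \<and> n \<ge> 3) \<longrightarrow>
            growth_order f = ereal (real (degree Q)) \<and> degree Q = 1)
       \<and> (zero_exponent f < growth_order f \<longrightarrow>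
            (\<exists>A b1. of_nat n + \<omega> * lam2 \<noteq> 0
               \<and> A ^ n = p2 * of_nat n / (of_nat n + \<omega> * lam2)
               \<and> (\<forall>z. f z = A * exp (lam2 * z / of_nat n))
               \<and> (\<forall>z. poly Q z = (lam1 - lam2 / of_nat n) * z + b1)
               \<and> (\<forall>z. p1 = poly q z * A * exp (lam2 * c / of_nat n + b1)))
          \<or> (\<exists>A b2. of_nat n + \<omega> * lam1 \<noteq> 0
               \<and> A ^ n = p1 * of_nat n / (of_nat n + \<omega> * lam1)
               \<and> (\<forall>z. f z = A * exp (lam1 * z / of_nat n))
               \<and> (\<forall>z. poly Q z = (lam2 - lam1 / of_nat n) * z + b2)
               \<and> (\<forall>z. p2 = poly q z * A * exp (lam1 * c / of_nat n + b2))))"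
proof -
  define F where "F = lhs_part n \<omega> f"
  have fh: "f holomorphic_on UNIV" using assms(10) by (simp add: transcendental_entire_def)
  have "\<not> (\<forall>z. f z = poly 0 z)" using assms(10) unfolding transcendental_entire_def by blast
  then obtain z0 where z0: "f z0 \<noteq> 0" by auto
  have eq: "F z + poly q z * exp (poly Q z) * f (z + c) = two_exp p1 lam1 p2 lam2 z" for z
    using assms(12)[of z] by (simp add: F_def lhs_part_def two_exp_def)
  obtain N :: nat where N: "growth_order f < ereal (real N)"
    using assms(11) less_PInf_Ex_of_nat[of "growth_order f"] by auto
  have f_ft: "fin_type (real N) f" by (rule growth_order_less_imp_fin_type[OF fh N]) simp
  have part1: "growth_order f = ereal (real (degree Q)) \<and> degree Q = 1"
    if n: "\<omega> \<noteq> 0 \<and> n \<ge> 4 \<or> \<omega> = 0 \<and> n \<ge> 3"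
  proof -
    have le: "growth_order f \<le> 1"
      by (rule solution_order_le_1[OF f_ft z0 n assms(9,5,6,7) eq[unfolded F_def]])
    \<comment> \<open>Order at most 1 yields finite type only for exponents above 1; 3/2 still lies
      below 2, as the bound on the degree of \<open>Q\<close> requires.\<close>
    also have "1 < ereal (3 / 2)" by (simp add: one_ereal_def)
    finally have ft: "fin_type (3 / 2) f" by (intro growth_order_less_imp_fin_type[OF fh]) auto
    have Q: "degree Q = 1"
      by (rule degree_1_of_order_le_1[OF ft _ _ _ z0 assms(9,8) eq])
         (auto simp: F_def intro: fin_type_lhs_part ft)
    have "growth_order f \<ge> 1"
      by (rule growth_order_ge_1[OF fh _ Q assms(5,6,7,3,4) eq]) (auto simp: F_def intro: fin_type_lhs_part)
    with le Q show ?thesis by (simp add: one_ereal_def)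
  qed
  have part2: "(\<exists>A b1. of_nat n + \<omega> * lam2 \<noteq> 0
               \<and> A ^ n = p2 * of_nat n / (of_nat n + \<omega> * lam2)
               \<and> (\<forall>z. f z = A * exp (lam2 * z / of_nat n))
               \<and> (\<forall>z. poly Q z = (lam1 - lam2 / of_nat n) * z + b1)
               \<and> (\<forall>z. p1 = poly q z * A * exp (lam2 * c / of_nat n + b1)))
          \<or> (\<exists>A b2. of_nat n + \<omega> * lam1 \<noteq> 0
               \<and> A ^ n = p1 * of_nat n / (of_nat n + \<omega> * lam1)
               \<and> (\<forall>z. f z = A * exp (lam1 * z / of_nat n))
               \<and> (\<forall>z. poly Q z = (lam2 - lam1 / of_nat n) * z + b2)
               \<and> (\<forall>z. p2 = poly q z * A * exp (lam1 * c / of_nat n + b2)))"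
    if less: "zero_exponent f < growth_order f"
  proof -
    have "zero_exponent f \<ge> 0"
      unfolding zero_exponent_def
      by (intro le_Limsup eventually_mono[OF eventually_gt_at_top[of 1]]) auto
    \<comment> \<open>Two exponents are inserted between the exponent of convergence and the order:
      \<open>\<sigma>\<close> for counting zeros and \<open>s\<close> for the growth of the
      product.\<close>
    obtain s where s: "zero_exponent f < ereal s" "ereal s < growth_order f"
      using less ereal_dense2 by blast
    obtain \<sigma> where \<sigma>: "zero_exponent f < ereal \<sigma>" "ereal \<sigma> < ereal s"
      using s(1) ereal_dense2 by blast
    have \<sigma>0: "0 < \<sigma>" "\<sigma> < s"
      using \<sigma> \<open>zero_exponent f \<ge> 0\<close> by (auto dest: order_le_less_trans)
    have "ereal s < ereal (real N)" using s(2) N by (rule less_trans)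
    then have sN: "s \<le> real N" by simp
    obtain B H where B: "fin_type s B" and fB: "\<And>z. f z = B z * exp (poly H z)"
      using hadamard_factorization[OF f_ft z0 \<sigma>(1) \<sigma>0 sN] by metis
    have f_fun: "f = (\<lambda>z. B z * exp (poly H z))" by (rule ext) (rule fB)
    note Bh = fin_type_holomorphic[OF B, of UNIV]
    have Bz0: "B z0 \<noteq> 0" using fB[of z0] z0 by auto
    have degH: "real (degree H) > s"
    \<comment> \<open>Otherwise \<open>f\<close> itself would have growth \<open>s\<close>, below
      its order.\<close>
    proof (rule ccontr)
      assume "\<not> ?thesis"
      then have "fin_type s (\<lambda>z. B z * exp (poly H z))" by (intro fin_type_mult B fin_type_exp_poly) simp
      then have "fin_type s f" by (simp only: f_fun)
      then have "growth_order f \<le> ereal s" using \<sigma>0 by (intro fin_type_imp_growth_order_le) auto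
      with s(2) show False by simp
    qed
    have df: "deriv f z = (deriv B z + B z * poly (pderiv H) z) * exp (poly H z)" for z
    proof (rule DERIV_imp_deriv)
      show "(f has_field_derivative (deriv B z + B z * poly (pderiv H) z) * exp (poly H z)) (at z)"
        unfolding f_fun
        by (auto intro!: derivative_eq_intros holomorphic_derivI[OF Bh open_UNIV UNIV_I] poly_DERIV simp: algebra_simps)
    qed
    have F: "F z = B z ^ (n - 1) * (B z + \<omega> * (deriv B z + B z * poly (pderiv H) z)) * exp (poly H z) ^ n" for z
    proof -
      obtain k where k: "n = Suc k" using assms(1) by (cases n) auto
      show ?thesis unfolding F_def lhs_part_def df fB k by (simp add: power_mult_distrib algebra_simps)
    qed
    define K where "K = Q + pcompose H [:c, 1:]"
    have fc: "exp (poly Q z) * f (z + c) = B (z + c) * exp (poly K z)" for z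
      by (simp add: fB K_def poly_pcompose exp_add add.commute)
    have degH1: "degree H = 1"
    proof (rule ccontr)
      assume "degree H \<noteq> 1"
      moreover have "degree H > 0" using degH \<sigma>0 by linarith
      ultimately have d2: "degree H \<ge> 2" by simp
      \<comment> \<open>At least 1, so that the right-hand side is a coefficient, and still below
        the degree of \<open>H\<close>, which exceeds \<open>s\<close> and is at least 2.\<close>
      define \<tau> where "\<tau> = max s 1"
      have \<tau>: "s \<le> \<tau>" "1 \<le> \<tau>" "real (degree H) > \<tau>" using degH d2 by (auto simp: \<tau>_def)
      show False
      proof (rule degree_2_impossible[OF fin_type_mono[OF B \<tau>(1)] Bz0 _ \<tau>(2) assms(1) \<tau>(3) assms(5,7)])
        show "fin_type \<tau> (\<lambda>z. poly q z * B (z + c))"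
          using \<tau> by (intro fin_type_mult fin_type_poly fin_type_shift fin_type_mono[OF B]) auto
        show "B z ^ (n - 1) * (B z + \<omega> * (deriv B z + B z * poly (pderiv H) z)) * exp (poly (smult (of_nat n) H) z)
                + poly q z * B (z + c) * exp (poly K z) = two_exp p1 lam1 p2 lam2 z" for z
          using eq[of z] fc[of z] F[of z] by (simp add: exp_of_nat_mult mult.assoc)
      qed
    qed
    obtain h1 h0 where H: "H = [:h0, h1:]" by (rule degree1_coeffs[OF degH1])
    \<comment> \<open>Now the coefficients have order below 1, so distinct linear exponents can be
      separated.\<close>
    have s1: "s < 1" using degH degH1 by simp
    have ft1: "fin_type 1 f"
    proof -
      have "fin_type 1 (\<lambda>z. B z * exp (poly H z))"
        using s1 degH1 by (intro fin_type_mult fin_type_mono[OF B] fin_type_exp_poly) auto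
      then show ?thesis by (simp only: f_fun)
    qed
    have "degree Q = 1"
      by (rule degree_1_of_order_le_1[OF ft1 _ _ _ z0 assms(9,8) eq])
         (auto simp: F_def intro: fin_type_lhs_part ft1)
    then obtain q1 q0 where Q: "Q = [:q0, q1:]" by (rule degree1_coeffs)
    define X where "X = (\<lambda>z. B z ^ (n - 1) * (B z + \<omega> * (deriv B z + B z * h1)) * exp (of_nat n * h0))"
    define Y where "Y = (\<lambda>z. poly q z * B (z + c) * exp (q0 + h0 + h1 * c))"
    have X_ft: "fin_type s X"
      unfolding X_def using B \<sigma>0
      by (intro fin_type_mult fin_type_add fin_type_power fin_type_const fin_type_deriv) auto
    have Y_ft: "fin_type s Y"
      unfolding Y_def using B \<sigma>0
      by (intro fin_type_mult fin_type_poly fin_type_const fin_type_shift) auto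
    have XY: "X z * exp (of_nat n * h1 * z) + Y z * exp ((q1 + h1) * z)
        + - p1 * exp (lam1 * z) + - p2 * exp (lam2 * z) = 0" for z
    proof -
      have "X z * exp (of_nat n * h1 * z) = F z"
      proof -
        have "exp (poly H z) ^ n = exp (of_nat n * h0) * exp (of_nat n * h1 * z)"
          by (simp add: H exp_of_nat_mult[symmetric] algebra_simps flip: exp_add)
        then show ?thesis by (simp add: X_def F H pderiv_pCons)
      qed
      moreover have "Y z * exp ((q1 + h1) * z) = poly q z * exp (poly Q z) * f (z + c)"
      proof -
        have "exp (q0 + h0 + h1 * c) * exp ((q1 + h1) * z) = exp (poly K z)"
          by (simp add: K_def H Q pcompose_pCons algebra_simps flip: exp_add)
        then show ?thesis using fc[of z] by (simp add: Y_def mult.assoc)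
      qed
      ultimately show ?thesis using eq[of z] by (simp add: two_exp_def)
    qed
    have borel: "(if x = of_nat n * h1 then X z else 0) + (if x = q1 + h1 then Y z else 0)
         + (if x = lam1 then - p1 else 0) + (if x = lam2 then - p2 else 0) = 0" for x z
      by (rule borel_four_exp[OF X_ft Y_ft fin_type_const fin_type_const \<sigma>0(1)[THEN less_trans, OF \<sigma>0(2)] s1 XY])
         (use \<sigma>0 in auto)
    have f_eq: "f z = B z * exp (h0 + h1 * z)" for z by (simp add: fB H mult.commute)
    note sol = degree_1_solution[OF assms(1) _ _ f_eq, where c = c and q = q and \<omega> = \<omega> and ?q0.0 = q0 and ?q1.0 = q1]
    \<comment> \<open>Neither \<open>- p1\<close> nor \<open>- p2\<close> can remain uncancelled,
      and as \<open>lam1 \<noteq> lam2\<close> they cannot cancel each other. Each exponent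
      therefore equals one of the two on the left, and not both the same one.\<close>
    have "lam1 = of_nat n * h1 \<or> lam1 = q1 + h1" "lam2 = of_nat n * h1 \<or> lam2 = q1 + h1"
      using borel[of lam1 0] borel[of lam2 0] assms(5-7) by (auto split: if_splits)
    then consider "lam2 = of_nat n * h1" "lam1 = q1 + h1" | "lam1 = of_nat n * h1" "lam2 = q1 + h1"
      using assms(7) by metis
    then show ?thesis
    proof cases
      case 1
      \<comment> \<open>Reading off the coefficients of the matched exponentials shows that
        \<open>X\<close> and \<open>Y\<close> are constant.\<close>
      have "X z = p2" "Y z = p1" for z
        using borel[of lam2 z] borel[of lam1 z] 1 assms(7) by (auto split: if_splits)
      then show ?thesis
        using sol[OF assms(6,5) 1] unfolding X_def Y_def Q by blast
    next
      case 2
      have "X z = p1" "Y z = p2" for z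
        using borel[of lam2 z] borel[of lam1 z] 2 assms(7) by (auto split: if_splits)
      then show ?thesis
        using sol[OF assms(5,6) 2] unfolding X_def Y_def Q by blast
    qed
  qed
  show ?thesis using part1 part2 by blast
qed

end
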